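(* Let $2<p<\infty$, let $A$ be a countably infinite set, let $P=\{N_i : i\in B\}$ be a regular partition of $A$ (indexed by a set $B$), and let $W=(w_j)_{j\in A}$ be weights with $w_j\in(0,1]$. Let $X$ be the Banach space with Alspach norm with the one partition and weights $(P,W)$, i.e. the space of all $(x_j)_{j\in A}\in\mathbb{R}^A$ for which $$\|(x_j)\|_X=\max\left\{\Big(\sum_{j\in A}|x_j|^p\Big)^{1/p},\ \Big(\sum_{i\in B}\Big(\sum_{j\in N_i}x_j^2w_j^2\Big)^{p/2}\Big)^{1/p}\right\}$$ is finite. Let $|N_i|$ be the cardinality of $N_i$ and let $I=\{i\in B: |N_i|=\infty\}$. Then: (1) If $|I|<\infty$, then $X$ is isomorphic to one of $\ell_p$, $X_p$, $\ell_2$, or $\ell_2\oplus\ell_p$. (2) If $|I|=\infty$, then $X$ is isomorphic to one of $\ell_p$, $X_p$, $\ell_2\oplus\ell_p$, $B_p$, $(\sum\ell_2)_{\ell_p}$, $(\sum\ell_2)_{\ell_p}\oplus X_p$, $B_p\oplus X_p$, or $(\sum X_p)_{\ell_p}$.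
   Context: Isomorphic means linearly homeomorphic. Sequence spaces are real. A partition of $A$ is discrete if every element of it is a singleton, indiscrete if it is $\{A\}$, and regular if it is neither discrete nor indiscrete. For Banach spaces $Y_n$, $(\sum Y_n)_{\ell_p}$ is the $\ell_p$-direct sum with norm $(\sum\|y_n\|^p)^{1/p}$; $(\sum Y)_{\ell_p}$ denotes the $\ell_p$-sum of countably infinitely many copies of $Y$. For $v=(v_n)_{n\in\mathbb{N}}$ with $v_n\in(0,1]$, let $X_{p,v}$ be the space of all real sequences $(x_n)\in\ell_p$ with $\sum v_n^2x_n^2<\infty$, with norm $\max\{(\sum|x_n|^p)^{1/p},(\sum v_n^2x_n^2)^{1/2}\}$. Rosenthal's space $X_p$ is $X_{p,v}$ for any fixed $v$ tending to $0$ slowly, meaning $v_n\to0$ and $\sum_n v_n^{2p/(p-2)}=\infty$ (up to isomorphism, the space does not depend on the choice of such $v$). Rosenthal's space $B_p$ is $(Y_1\oplus Y_2\oplus\cdots)_{\ell_p}$, where $Y_n=X_{p,v^{(n)}}$ with constant weight sequence $v^{(n)}_j=n^{-(p-2)/(2p)}$ for all $j$. Each $Y_n$ is isomorphic to $\ell_2$, and $\sup_n d(Y_n,\ell_2)=\infty$, where $d$ is the Banach–Mazur distance. *)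

theory Defs
  imports "HOL-Analysis.Analysis" "HOL-Library.Function_Algebras" "HOL-Library.Disjoint_Sets"
begin

instantiation "fun" :: (type, real_vector) real_vector
begin

definition "scaleR r f = (\<lambda>x. r *\<^sub>R f x)"

instance
  by standard (auto simp: scaleR_fun_def fun_eq_iff scaleR_add_right scaleR_add_left)

end

text \<open>
  The Banach spaces below depend on real parameters and on weights, so they are given as a linear
  subspace of an ambient real vector space together with a norm on that subspace.
\<close>

record 'v nspace =
  vecs :: "'v set"
  nrm :: "'v \<Rightarrow> real"

definition ntopology :: "'v::real_vector nspace \<Rightarrow> 'v topology" where
  "ntopology X = Metric_space.mtopology (vecs X) (\<lambda>x y. nrm X (x - y))"

definition linear_between ::
    "'v::real_vector nspace \<Rightarrow> 'w::real_vector nspace \<Rightarrow> ('v \<Rightarrow> 'w) \<Rightarrow> bool" where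
  "linear_between X Y T \<longleftrightarrow>
     T ` vecs X \<subseteq> vecs Y \<and>
     (\<forall>x\<in>vecs X. \<forall>y\<in>vecs X. T (x + y) = T x + T y) \<and>
     (\<forall>c. \<forall>x\<in>vecs X. T (c *\<^sub>R x) = c *\<^sub>R T x)"

definition isomorphic :: "'v::real_vector nspace \<Rightarrow> 'w::real_vector nspace \<Rightarrow> bool"
    (infix "\<simeq>\<^sub>B" 50) where
  "X \<simeq>\<^sub>B Y \<longleftrightarrow>
     (\<exists>T. linear_between X Y T \<and> homeomorphic_map (ntopology X) (ntopology Y) T)"

text \<open>The usual norms on a direct sum of two spaces are all equivalent; we take the maximum.\<close>

definition dsum :: "'v nspace \<Rightarrow> 'w nspace \<Rightarrow> ('v \<times> 'w) nspace" (infixr "\<oplus>\<^sub>B" 65) where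
  "X \<oplus>\<^sub>B Y = \<lparr> vecs = vecs X \<times> vecs Y, nrm = (\<lambda>(x, y). max (nrm X x) (nrm Y y)) \<rparr>"

text \<open>
  All series below have nonnegative terms, so unordered summability and unordered sums agree
  with the usual ones.
\<close>

definition lp_sum :: "real \<Rightarrow> (nat \<Rightarrow> 'v nspace) \<Rightarrow> (nat \<Rightarrow> 'v) nspace" where
  "lp_sum p Y = \<lparr>
     vecs = {y. (\<forall>n. y n \<in> vecs (Y n)) \<and> (\<lambda>n. nrm (Y n) (y n) powr p) summable_on UNIV},
     nrm = (\<lambda>y. (\<Sum>\<^sub>\<infinity>n. nrm (Y n) (y n) powr p) powr (1 / p)) \<rparr>"

definition lp :: "real \<Rightarrow> (nat \<Rightarrow> real) nspace" where
  "lp p = \<lparr>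
     vecs = {x. (\<lambda>n. \<bar>x n\<bar> powr p) summable_on UNIV},
     nrm = (\<lambda>x. (\<Sum>\<^sub>\<infinity>n. \<bar>x n\<bar> powr p) powr (1 / p)) \<rparr>"

definition Xpv :: "real \<Rightarrow> (nat \<Rightarrow> real) \<Rightarrow> (nat \<Rightarrow> real) nspace" where
  "Xpv p v = \<lparr>
     vecs = {x. (\<lambda>n. \<bar>x n\<bar> powr p) summable_on UNIV \<and>
                (\<lambda>n. (v n)\<^sup>2 * (x n)\<^sup>2) summable_on UNIV},
     nrm = (\<lambda>x. max ((\<Sum>\<^sub>\<infinity>n. \<bar>x n\<bar> powr p) powr (1 / p))
                    (sqrt (\<Sum>\<^sub>\<infinity>n. (v n)\<^sup>2 * (x n)\<^sup>2))) \<rparr>"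

definition slow_weights :: "real \<Rightarrow> (nat \<Rightarrow> real) \<Rightarrow> bool" where
  "slow_weights p v \<longleftrightarrow>
     (\<forall>n. 0 < v n \<and> v n \<le> 1) \<and> v \<longlonglongrightarrow> 0 \<and> \<not> summable (\<lambda>n. v n powr (2 * p / (p - 2)))"

text \<open>The summand with index \<open>n\<close> below is the space \<open>Y\<^sub>n\<^sub>+\<^sub>1\<close> of the usual numbering from 1.\<close>

definition Bp :: "real \<Rightarrow> (nat \<Rightarrow> nat \<Rightarrow> real) nspace" where
  "Bp p = lp_sum p (\<lambda>n. Xpv p (\<lambda>j. real (Suc n) powr (- ((p - 2) / (2 * p)))))"

definition regular_partition :: "'a set \<Rightarrow> 'a set set \<Rightarrow> bool" where
  "regular_partition A P \<longleftrightarrow>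
     partition_on A P \<and> \<not> (\<forall>E\<in>P. is_singleton E) \<and> P \<noteq> {A}"

text \<open>
  \<open>\<real>\<^sup>A\<close> is realised as the space of functions that vanish outside \<open>A\<close>.  The summability
  conditions express that the norm is finite.
\<close>

definition alspach ::
    "real \<Rightarrow> 'a set \<Rightarrow> 'b set \<Rightarrow> ('b \<Rightarrow> 'a set) \<Rightarrow> ('a \<Rightarrow> real) \<Rightarrow> ('a \<Rightarrow> real) nspace" where
  "alspach p A B N w = \<lparr>
     vecs = {x. (\<forall>j. j \<notin> A \<longrightarrow> x j = 0) \<and>
                (\<lambda>j. \<bar>x j\<bar> powr p) summable_on A \<and>
                (\<forall>i\<in>B. (\<lambda>j. (x j)\<^sup>2 * (w j)\<^sup>2) summable_on N i) \<and>
                (\<lambda>i. (\<Sum>\<^sub>\<infinity>j\<in>N i. (x j)\<^sup>2 * (w j)\<^sup>2) powr (p / 2)) summable_on B},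
     nrm = (\<lambda>x. max ((\<Sum>\<^sub>\<infinity>j\<in>A. \<bar>x j\<bar> powr p) powr (1 / p))
                    ((\<Sum>\<^sub>\<infinity>i\<in>B. (\<Sum>\<^sub>\<infinity>j\<in>N i. (x j)\<^sup>2 * (w j)\<^sup>2) powr (p / 2)) powr (1 / p))) \<rparr>"

end

theory Submission
  imports Defs
begin

text \<open>
  Put \<open>r = 2p/(p-2)\<close>.  Everything depends on how the numbers \<open>w\<^sub>j\<^sup>r\<close> are distributed over the cells of the
  partition, and on two facts about the norm.

  First, there are block bases (\<open>blocks_complemented\<close>).  A finite block of coordinates in one cell
  contains a vector that behaves exactly like a single coordinate whose value of \<open>w\<^sup>r\<close> is the sum over
  the block, and the weighted orthogonal projections onto such vectors are bounded in both parts of the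
  norm at once.  So a cell in which the coordinates with \<open>w\<^sub>j\<^sup>r \<le> s\<close> have divergent sum \<open>\<Sum>w\<^sub>j\<^sup>r\<close> provides
  as many copies of a coordinate with \<open>w\<^sup>r = s\<close> as desired, up to a factor 2, and their span is
  complemented (\<open>rich_complemented\<close>).  A space
  that contains countably many copies of \<open>U\<close> as a complemented subspace absorbs \<open>U\<close>, by Pelczynski's
  argument (\<open>complemented_absorbs\<close>), and two spaces that absorb each other are isomorphic.

  Second, a cell with \<open>\<Sum>w\<^sub>j\<^sup>r < \<infinity>\<close> is negligible (\<open>summable_cells_iso_ell\<close>): an \<open>\<ell>\<^sub>p\<close>-sum of such
  cells is just \<open>\<ell>\<^sub>p\<close>.  Where the sum is at most 1 this is Hoelder's inequality.  The finitely many
  remaining coordinates of each cell are embedded into a finite-dimensional \<open>\<ell>\<^sub>p\<close> as independent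
  three-valued random variables; by Rosenthal's inequality (\<open>Rosenthal_inequality\<close>) and duality the
  embedding and the projection are bounded uniformly in the cell, and absorption does the rest.

  Now remove from each cell its summable part, which altogether leaves a space \<open>\<ell>\<^sub>p\<close> or a
  finite-dimensional one.  What remains of a cell is nothing, or it is rich at all levels \<open>s > 0\<close>,
  or its numbers \<open>w\<^sub>j\<^sup>r\<close> are bounded below by some \<open>\<sigma> > 0\<close> with infinitely many of them in
  \<open>[\<sigma>, 2\<sigma>]\<close>.  Single cells of the last two kinds are copies of \<open>X\<^sub>p\<close> and of \<open>\<ell>\<^sub>2\<close>, but the isomorphism
  constants for \<open>\<ell>\<^sub>2\<close> depend on \<open>\<sigma>\<close>: infinitely many such cells form \<open>(\<Sum>\<ell>\<^sub>2)\<^sub>\<ell>\<^sub>p\<close> if the bounds \<open>\<sigma>\<close> stay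
  away from zero, and \<open>B\<^sub>p\<close> otherwise (\<open>bounded_below_cells_case\<close>).  Infinitely many cells that are rich
  at all levels form \<open>(\<Sum>X\<^sub>p)\<^sub>\<ell>\<^sub>p\<close>, finitely many form \<open>X\<^sub>p\<close> (\<open>Xp_case\<close>).  Combining the cases and absorbing
  what can be absorbed leaves the spaces of the theorem (\<open>cell_space_classification\<close>).
\<close>

section \<open>Bounded linear maps and complemented subspaces\<close>

definition normed :: "'v::real_vector nspace \<Rightarrow> bool" where
  "normed X \<longleftrightarrow>
     0 \<in> vecs X \<and>
     (\<forall>x\<in>vecs X. \<forall>y\<in>vecs X. x + y \<in> vecs X \<and> nrm X (x + y) \<le> nrm X x + nrm X y) \<and>
     (\<forall>c. \<forall>x\<in>vecs X. c *\<^sub>R x \<in> vecs X \<and> nrm X (c *\<^sub>R x) = \<bar>c\<bar> * nrm X x) \<and>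
     (\<forall>x\<in>vecs X. nrm X x = 0 \<longrightarrow> x = 0)"

definition bounded_between ::
    "'v::real_vector nspace \<Rightarrow> 'w::real_vector nspace \<Rightarrow> ('v \<Rightarrow> 'w) \<Rightarrow> bool" where
  "bounded_between X Y T \<longleftrightarrow>
     linear_between X Y T \<and> (\<exists>C. \<forall>x\<in>vecs X. nrm Y (T x) \<le> C * nrm X x)"

text \<open>
  Isomorphy is treated through bounds for the norms, which compose easily; these bounds yield
  homeomorphisms as soon as the norms define metrics.
\<close>

definition lin_iso :: "'v::real_vector nspace \<Rightarrow> 'w::real_vector nspace \<Rightarrow> bool"
    (infix "\<cong>\<^sub>B" 50) where
  "X \<cong>\<^sub>B Y \<longleftrightarrow>
     (\<exists>T S. bounded_between X Y T \<and> bounded_between Y X S \<and>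
            (\<forall>x\<in>vecs X. S (T x) = x) \<and> (\<forall>y\<in>vecs Y. T (S y) = y))"

text \<open>
  Up to isomorphism, the first space is a complemented subspace of the second one: the composite
  \<open>i \<circ> q\<close> is a bounded projection onto a copy of it.
\<close>

definition complemented :: "'v::real_vector nspace \<Rightarrow> 'w::real_vector nspace \<Rightarrow> bool"
    (infix "\<unlhd>\<^sub>B" 50) where
  "Q \<unlhd>\<^sub>B W \<longleftrightarrow>
     (\<exists>i q. bounded_between Q W i \<and> bounded_between W Q q \<and> (\<forall>x\<in>vecs Q. q (i x) = x))"

lemma normedD:
  assumes "normed X"
  shows "0 \<in> vecs X"
    and "x \<in> vecs X \<Longrightarrow> y \<in> vecs X \<Longrightarrow> x + y \<in> vecs X"
    and "x \<in> vecs X \<Longrightarrow> y \<in> vecs X \<Longrightarrow> x - y \<in> vecs X"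
    and "x \<in> vecs X \<Longrightarrow> c *\<^sub>R x \<in> vecs X"
    and "x \<in> vecs X \<Longrightarrow> y \<in> vecs X \<Longrightarrow> nrm X (x + y) \<le> nrm X x + nrm X y"
    and "x \<in> vecs X \<Longrightarrow> nrm X (c *\<^sub>R x) = \<bar>c\<bar> * nrm X x"
    and "x \<in> vecs X \<Longrightarrow> nrm X x = 0 \<Longrightarrow> x = 0"
    and "nrm X 0 = 0"
    and "x \<in> vecs X \<Longrightarrow> 0 \<le> nrm X x"
proof -
  show 1: "0 \<in> vecs X"
    using assms by (simp add: normed_def)
  show 2: "x + y \<in> vecs X" and 4: "nrm X (x + y) \<le> nrm X x + nrm X y"
    if "x \<in> vecs X" "y \<in> vecs X" for x y
    using assms that by (auto simp: normed_def)
  show 3: "c *\<^sub>R x \<in> vecs X" and 5: "nrm X (c *\<^sub>R x) = \<bar>c\<bar> * nrm X x" if "x \<in> vecs X" for c x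
    using assms that by (auto simp: normed_def)
  show "x \<in> vecs X \<Longrightarrow> nrm X x = 0 \<Longrightarrow> x = 0"
    using assms by (simp add: normed_def)
  show "x - y \<in> vecs X" if "x \<in> vecs X" "y \<in> vecs X"
    using 2[OF that(1) 3[OF that(2), of "-1"]] by simp
  show 6: "nrm X 0 = 0"
    using 5[OF 1, of 0] by simp
  show "0 \<le> nrm X x" if "x \<in> vecs X"
    using 4[OF that 3[OF that, of "-1"]] 5[OF that, of "-1"] 6 by simp
qed

lemma bounded_between_bound:
  assumes "bounded_between X Y T" "normed X"
  obtains C where "0 \<le> C" "\<And>x. x \<in> vecs X \<Longrightarrow> nrm Y (T x) \<le> C * nrm X x"
proof -
  obtain C where C: "\<And>x. x \<in> vecs X \<Longrightarrow> nrm Y (T x) \<le> C * nrm X x"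
    using assms by (auto simp: bounded_between_def)
  show ?thesis
  proof (rule that[of "max 0 C"])
    fix x assume "x \<in> vecs X"
    then show "nrm Y (T x) \<le> max 0 C * nrm X x"
      using C[of x] normedD(9)[OF assms(2), of x]
      by (meson max.cobounded2 mult_right_mono order_trans)
  qed simp
qed

lemma bounded_betweenD:
  assumes "bounded_between X Y T"
  shows "x \<in> vecs X \<Longrightarrow> T x \<in> vecs Y"
    and "x \<in> vecs X \<Longrightarrow> y \<in> vecs X \<Longrightarrow> T (x + y) = T x + T y"
    and "x \<in> vecs X \<Longrightarrow> T (c *\<^sub>R x) = c *\<^sub>R T x"
  using assms by (auto simp: bounded_between_def linear_between_def)

lemma bounded_between_diff_arg:
  assumes "bounded_between X Y T" "normed X" "x \<in> vecs X" "y \<in> vecs X"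
  shows "T (x - y) = T x - T y"
  using bounded_betweenD(2)[OF assms(1,3) normedD(4)[OF assms(2,4), of "-1"]]
    bounded_betweenD(3)[OF assms(1,4), of "-1"] by simp

lemma bounded_betweenI:
  assumes "\<And>x. x \<in> vecs X \<Longrightarrow> T x \<in> vecs Y"
    and "\<And>x y. x \<in> vecs X \<Longrightarrow> y \<in> vecs X \<Longrightarrow> T (x + y) = T x + T y"
    and "\<And>x c. x \<in> vecs X \<Longrightarrow> T (c *\<^sub>R x) = c *\<^sub>R T x"
    and "\<And>x. x \<in> vecs X \<Longrightarrow> nrm Y (T x) \<le> C * nrm X x"
  shows "bounded_between X Y T"
  using assms unfolding bounded_between_def linear_between_def by blast

lemma bounded_between_id: "bounded_between X X (\<lambda>x. x)"
  by (rule bounded_betweenI[where C = 1]) auto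

lemma bounded_between_compose:
  assumes T: "bounded_between X Y T" and S: "bounded_between Y Z S" and "normed Y"
  shows "bounded_between X Z (\<lambda>x. S (T x))"
proof -
  obtain C where C: "0 \<le> C" "\<And>x. x \<in> vecs Y \<Longrightarrow> nrm Z (S x) \<le> C * nrm Y x"
    using bounded_between_bound[OF S \<open>normed Y\<close>] by metis
  obtain D where D: "\<And>x. x \<in> vecs X \<Longrightarrow> nrm Y (T x) \<le> D * nrm X x"
    using T by (auto simp: bounded_between_def)
  show ?thesis
  proof (rule bounded_betweenI[where C = "C * D"])
    fix x assume x: "x \<in> vecs X"
    have "nrm Z (S (T x)) \<le> C * nrm Y (T x)"
      by (rule C(2)) (rule bounded_betweenD(1)[OF T x])
    also have "\<dots> \<le> C * (D * nrm X x)"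
      using D[OF x] C(1) by (rule mult_left_mono)
    finally show "nrm Z (S (T x)) \<le> C * D * nrm X x" by simp
  qed (simp_all add: bounded_betweenD[OF T] bounded_betweenD[OF S])
qed

lemma bounded_between_add:
  assumes T: "bounded_between X Y T" and S: "bounded_between X Y S" and "normed Y"
  shows "bounded_between X Y (\<lambda>x. T x + S x)"
proof -
  obtain C where C: "\<And>x. x \<in> vecs X \<Longrightarrow> nrm Y (S x) \<le> C * nrm X x"
    using S by (auto simp: bounded_between_def)
  obtain D where D: "\<And>x. x \<in> vecs X \<Longrightarrow> nrm Y (T x) \<le> D * nrm X x"
    using T by (auto simp: bounded_between_def)
  show ?thesis
  proof (rule bounded_betweenI[where C = "D + C"])
    fix x assume x: "x \<in> vecs X"
    show "nrm Y (T x + S x) \<le> (D + C) * nrm X x"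
      using normedD(5)[OF \<open>normed Y\<close> bounded_betweenD(1)[OF T x] bounded_betweenD(1)[OF S x]]
        C[OF x] D[OF x] by (simp add: algebra_simps)
    show "T x + S x \<in> vecs Y"
      by (intro normedD(2)[OF \<open>normed Y\<close>] bounded_betweenD(1)[OF T x] bounded_betweenD(1)[OF S x])
  qed (simp_all add: bounded_betweenD[OF T] bounded_betweenD[OF S] algebra_simps)
qed

lemma bounded_between_uminus:
  assumes T: "bounded_between X Y T" and "normed Y"
  shows "bounded_between X Y (\<lambda>x. - T x)"
proof -
  have "bounded_between Y Y (\<lambda>x. (-1) *\<^sub>R x)"
    by (rule bounded_betweenI[where C = 1])
       (use normedD(4,6)[OF \<open>normed Y\<close>, where c = "-1"] in \<open>auto simp: algebra_simps\<close>)
  from bounded_between_compose[OF T this \<open>normed Y\<close>] show ?thesis by simp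
qed

lemma bounded_between_minus:
  assumes "bounded_between X Y T" "bounded_between X Y S" "normed Y"
  shows "bounded_between X Y (\<lambda>x. T x - S x)"
  using bounded_between_add[OF assms(1) bounded_between_uminus[OF assms(2,3)] assms(3)] by simp

lemma vecs_dsum [simp]: "vecs (X \<oplus>\<^sub>B Y) = vecs X \<times> vecs Y"
  and nrm_dsum [simp]: "nrm (X \<oplus>\<^sub>B Y) z = max (nrm X (fst z)) (nrm Y (snd z))"
  by (auto simp: dsum_def case_prod_beta)

lemma normed_dsum:
  assumes "normed X" "normed Y"
  shows "normed (X \<oplus>\<^sub>B Y)"
  unfolding normed_def
proof (intro conjI ballI allI impI)
  fix x y assume "x \<in> vecs (X \<oplus>\<^sub>B Y)" "y \<in> vecs (X \<oplus>\<^sub>B Y)"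
  then show "nrm (X \<oplus>\<^sub>B Y) (x + y) \<le> nrm (X \<oplus>\<^sub>B Y) x + nrm (X \<oplus>\<^sub>B Y) y"
    using normedD(5)[OF assms(1), of "fst x" "fst y"] normedD(5)[OF assms(2), of "snd x" "snd y"]
    by auto
next
  fix x c assume "x \<in> vecs (X \<oplus>\<^sub>B Y)"
  then show "nrm (X \<oplus>\<^sub>B Y) (c *\<^sub>R x) = \<bar>c\<bar> * nrm (X \<oplus>\<^sub>B Y) x"
    using normedD(6)[OF assms(1), of "fst x" c] normedD(6)[OF assms(2), of "snd x" c]
    by (auto simp: max_mult_distrib_left)
next
  fix x assume "x \<in> vecs (X \<oplus>\<^sub>B Y)" "nrm (X \<oplus>\<^sub>B Y) x = 0"
  then show "x = 0"
    using normedD(7,9)[OF assms(1), of "fst x"] normedD(7,9)[OF assms(2), of "snd x"]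
    by (cases x) (auto simp: max_def zero_prod_def split: if_splits)
qed (auto simp: normedD[OF assms(1)] normedD[OF assms(2)] zero_prod_def)

lemma bounded_between_fst: "bounded_between (X \<oplus>\<^sub>B Y) X fst"
  and bounded_between_snd: "bounded_between (X \<oplus>\<^sub>B Y) Y snd"
  by (rule bounded_betweenI[where C = 1]; auto)+

lemma bounded_between_Pair:
  assumes T: "bounded_between Z X T" and S: "bounded_between Z Y S" and "normed Z"
  shows "bounded_between Z (X \<oplus>\<^sub>B Y) (\<lambda>z. (T z, S z))"
proof -
  obtain C where C: "0 \<le> C" "\<And>x. x \<in> vecs Z \<Longrightarrow> nrm X (T x) \<le> C * nrm Z x"
    using bounded_between_bound[OF T \<open>normed Z\<close>] by metis
  obtain D where D: "0 \<le> D" "\<And>x. x \<in> vecs Z \<Longrightarrow> nrm Y (S x) \<le> D * nrm Z x"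
    using bounded_between_bound[OF S \<open>normed Z\<close>] by metis
  show ?thesis
  proof (rule bounded_betweenI[where C = "C + D"])
    fix x assume x: "x \<in> vecs Z"
    then have "0 \<le> C * nrm Z x" "0 \<le> D * nrm Z x"
      using C(1) D(1) normedD(9)[OF \<open>normed Z\<close> x] by auto
    then show "nrm (X \<oplus>\<^sub>B Y) (T x, S x) \<le> (C + D) * nrm Z x"
      using C(2)[OF x] D(2)[OF x] by (simp add: distrib_right)
  qed (auto simp: bounded_betweenD[OF T] bounded_betweenD[OF S])
qed

lemma lin_isoI:
  assumes "bounded_between X Y T" "bounded_between Y X S"
    and "\<And>x. x \<in> vecs X \<Longrightarrow> S (T x) = x" "\<And>y. y \<in> vecs Y \<Longrightarrow> T (S y) = y"
  shows "X \<cong>\<^sub>B Y"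
  using assms unfolding lin_iso_def by blast

lemma lin_iso_refl: "X \<cong>\<^sub>B X"
  by (rule lin_isoI[OF bounded_between_id bounded_between_id]) auto

lemma lin_iso_sym: "X \<cong>\<^sub>B Y \<Longrightarrow> Y \<cong>\<^sub>B X"
  unfolding lin_iso_def by blast

lemma lin_iso_trans:
  assumes "X \<cong>\<^sub>B Y" "Y \<cong>\<^sub>B Z" "normed Y"
  shows "X \<cong>\<^sub>B Z"
proof -
  obtain T S where T: "bounded_between X Y T" "bounded_between Y X S"
    "\<And>x. x \<in> vecs X \<Longrightarrow> S (T x) = x" "\<And>y. y \<in> vecs Y \<Longrightarrow> T (S y) = y"
    using assms(1) unfolding lin_iso_def by blast
  obtain U V where U: "bounded_between Y Z U" "bounded_between Z Y V"
    "\<And>x. x \<in> vecs Y \<Longrightarrow> V (U x) = x" "\<And>y. y \<in> vecs Z \<Longrightarrow> U (V y) = y"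
    using assms(2) unfolding lin_iso_def by blast
  show ?thesis
    by (rule lin_isoI[OF bounded_between_compose[OF T(1) U(1) assms(3)]
          bounded_between_compose[OF U(2) T(2) assms(3)]])
       (simp_all add: T U bounded_betweenD(1)[OF T(1)] bounded_betweenD(1)[OF U(2)])
qed

lemma lin_iso_dsum_cong:
  assumes "X \<cong>\<^sub>B X'" "Y \<cong>\<^sub>B Y'" "normed X" "normed Y" "normed X'" "normed Y'"
  shows "X \<oplus>\<^sub>B Y \<cong>\<^sub>B X' \<oplus>\<^sub>B Y'"
proof -
  obtain T S where T: "bounded_between X X' T" "bounded_between X' X S"
    "\<And>x. x \<in> vecs X \<Longrightarrow> S (T x) = x" "\<And>y. y \<in> vecs X' \<Longrightarrow> T (S y) = y"
    using assms(1) unfolding lin_iso_def by blast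
  obtain U V where U: "bounded_between Y Y' U" "bounded_between Y' Y V"
    "\<And>x. x \<in> vecs Y \<Longrightarrow> V (U x) = x" "\<And>y. y \<in> vecs Y' \<Longrightarrow> U (V y) = y"
    using assms(2) unfolding lin_iso_def by blast
  note cp = bounded_between_compose[OF bounded_between_fst] bounded_between_compose[OF bounded_between_snd]
  show ?thesis
    by (rule lin_isoI[OF
          bounded_between_Pair[OF cp(1)[OF T(1) assms(3)] cp(2)[OF U(1) assms(4)] normed_dsum[OF assms(3,4)]]
          bounded_between_Pair[OF cp(1)[OF T(2) assms(5)] cp(2)[OF U(2) assms(6)] normed_dsum[OF assms(5,6)]]])
       (auto simp: T U)
qed

lemma lin_iso_dsum_commute:
  assumes "normed X" "normed Y"
  shows "X \<oplus>\<^sub>B Y \<cong>\<^sub>B Y \<oplus>\<^sub>B X"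
  by (rule lin_isoI[OF
        bounded_between_Pair[OF bounded_between_snd bounded_between_fst normed_dsum[OF assms]]
        bounded_between_Pair[OF bounded_between_snd bounded_between_fst normed_dsum[OF assms(2,1)]]])
     auto

lemma lin_iso_imp_complemented: "X \<cong>\<^sub>B Y \<Longrightarrow> X \<unlhd>\<^sub>B Y"
  unfolding lin_iso_def complemented_def by blast

lemma complemented_trans:
  assumes "X \<unlhd>\<^sub>B Y" "Y \<unlhd>\<^sub>B Z" "normed Y"
  shows "X \<unlhd>\<^sub>B Z"
proof -
  obtain T S where T: "bounded_between X Y T" "bounded_between Y X S"
    "\<And>x. x \<in> vecs X \<Longrightarrow> S (T x) = x"
    using assms(1) unfolding complemented_def by blast
  obtain U V where U: "bounded_between Y Z U" "bounded_between Z Y V"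
    "\<And>x. x \<in> vecs Y \<Longrightarrow> V (U x) = x"
    using assms(2) unfolding complemented_def by blast
  have "\<forall>x\<in>vecs X. S (V (U (T x))) = x"
    by (simp add: T U bounded_betweenD(1)[OF T(1)])
  then show ?thesis
    using bounded_between_compose[OF T(1) U(1) assms(3)] bounded_between_compose[OF U(2) T(2) assms(3)]
    unfolding complemented_def by blast
qed

text \<open>
  The absorption principle behind Pelczynski's decomposition method.  Write \<open>W = Q \<oplus> R\<close>; then
  \<open>W \<cong> (Q \<oplus> U) \<oplus> R \<cong> W \<oplus> U\<close>.  The isomorphism below is this chain with \<open>R\<close> eliminated: it
  replaces the component \<open>i (q x)\<close> of \<open>x\<close> by the image of the first component of \<open>h (q x)\<close>.
\<close>

lemma complemented_absorbs:
  assumes "Q \<unlhd>\<^sub>B W" "Q \<cong>\<^sub>B Q \<oplus>\<^sub>B U" and nQ: "normed Q" and nW: "normed W" and nU: "normed U"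
  shows "W \<cong>\<^sub>B W \<oplus>\<^sub>B U"
proof -
  obtain i q where i: "bounded_between Q W i" and q: "bounded_between W Q q"
    and qi: "\<And>x. x \<in> vecs Q \<Longrightarrow> q (i x) = x"
    using assms(1) unfolding complemented_def by blast
  obtain h g where h: "bounded_between Q (Q \<oplus>\<^sub>B U) h" and g: "bounded_between (Q \<oplus>\<^sub>B U) Q g"
    and gh: "\<And>x. x \<in> vecs Q \<Longrightarrow> g (h x) = x"
    and hg: "\<And>y. y \<in> vecs (Q \<oplus>\<^sub>B U) \<Longrightarrow> h (g y) = y"
    using assms(2) unfolding lin_iso_def by blast
  note nQU = normed_dsum[OF nQ nU] and nWU = normed_dsum[OF nW nU]
  note hq = bounded_between_compose[OF q h nQ]
  define T1 where "T1 x = x - i (q x) + i (fst (h (q x)))" for x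
  define T where "T x = (T1 x, snd (h (q x)))" for x
  define S where "S z = fst z - i (q (fst z)) + i (g (q (fst z), snd z))" for z
  have r: "bounded_between W W (\<lambda>x. x - i (q x))"
    by (rule bounded_between_minus[OF bounded_between_id bounded_between_compose[OF q i nQ] nW])
  have T1: "bounded_between W W T1"
    unfolding T1_def
    by (rule bounded_between_add[OF r bounded_between_compose[OF
              bounded_between_compose[OF hq bounded_between_fst nQU] i nQ] nW])
  have T: "bounded_between W (W \<oplus>\<^sub>B U) T"
    unfolding T_def
    by (rule bounded_between_Pair[OF T1 bounded_between_compose[OF hq bounded_between_snd nQU] nW])
  have S: "bounded_between (W \<oplus>\<^sub>B U) W S"
    unfolding S_def
    by (rule bounded_between_add[OF bounded_between_compose[OF bounded_between_fst r nW]
          bounded_between_compose[OF bounded_between_compose[OF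
            bounded_between_Pair[OF bounded_between_compose[OF bounded_between_fst q nW] bounded_between_snd nWU]
            g nQU] i nQ] nW])
  have qr: "q (x - i (q x) + i y) = y" if "x \<in> vecs W" "y \<in> vecs Q" for x y
  proof -
    note mem = bounded_betweenD(1)[OF i] bounded_betweenD(1)[OF q]
    have "q (x - i (q x) + i y) = q x - q (i (q x)) + q (i y)"
      using that
      by (simp add: bounded_betweenD(2)[OF q] bounded_between_diff_arg[OF q nW] mem normedD(3)[OF nW])
    then show ?thesis
      using that by (simp add: qi mem)
  qed
  show ?thesis
  proof (rule lin_isoI[OF T S])
    fix x assume x: "x \<in> vecs W"
    then have "h (q x) \<in> vecs (Q \<oplus>\<^sub>B U)"
      by (rule bounded_betweenD(1)[OF hq])
    then have "q (T1 x) = fst (h (q x))"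
      unfolding T1_def by (intro qr x) auto
    then show "S (T x) = x"
      by (simp add: S_def T_def gh bounded_betweenD(1)[OF q x]) (simp add: T1_def)
  next
    fix z assume z: "z \<in> vecs (W \<oplus>\<^sub>B U)"
    define y where "y = g (q (fst z), snd z)"
    have m: "(q (fst z), snd z) \<in> vecs (Q \<oplus>\<^sub>B U)"
      using z bounded_betweenD(1)[OF q] by auto
    then have y: "y \<in> vecs Q"
      unfolding y_def by (rule bounded_betweenD(1)[OF g])
    have "q (S z) = y"
      unfolding S_def y_def[symmetric] using z y by (intro qr) auto
    then show "T (S z) = z"
      unfolding T_def T1_def
      by (simp add: y_def hg[OF m]) (simp add: S_def)
  qed
qed

lemma mutual_absorption:
  assumes "W \<cong>\<^sub>B W \<oplus>\<^sub>B U" "U \<cong>\<^sub>B U \<oplus>\<^sub>B W" "normed W" "normed U"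
  shows "W \<cong>\<^sub>B U"
  by (meson assms lin_iso_dsum_commute lin_iso_sym lin_iso_trans normed_dsum)

section \<open>Inequalities for finite sums\<close>

lemma powr_add_convex:
  fixes a b s t p :: real
  assumes "1 \<le> p" "0 \<le> a" "0 \<le> b" "0 \<le> s" "0 \<le> t" "s + t = 1"
  shows "(s * a + t * b) powr p \<le> s * a powr p + t * b powr p"
proof -
  have small: "u powr p \<le> u" if "0 \<le> u" "u \<le> 1" for u :: real
    using powr_mono'[of 1 p u] assms(1) that by simp
  have st: "s \<le> 1" "t \<le> 1"
    using assms by auto
  show ?thesis
  proof (cases "a = 0 \<or> b = 0")
    case True
    then show ?thesis
    proof
      assume "a = 0"
      have "(t * b) powr p \<le> t * b powr p"
        unfolding powr_mult by (intro mult_right_mono small assms st) simp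
      then show ?thesis
        using \<open>a = 0\<close> assms(1) by simp
    next
      assume "b = 0"
      have "(s * a) powr p \<le> s * a powr p"
        unfolding powr_mult by (intro mult_right_mono small assms st) simp
      then show ?thesis
        using \<open>b = 0\<close> assms(1) by simp
    qed
  next
    case False
    then have "a \<in> {0<..}" "b \<in> {0<..}"
      using assms by auto
    with powr_convex[OF assms(1)] assms(4-6) show ?thesis
      unfolding convex_on_def by (auto simp: mult.commute)
  qed
qed

lemma sum_powr_eq_0:
  assumes "finite F" "(\<Sum>j\<in>F. \<bar>f j\<bar> powr p) = 0"
  shows "\<forall>j\<in>F. f j = (0::real)"
  using assms by (simp add: sum_nonneg_eq_0_iff)

lemma Minkowski_sum:
  fixes f g :: "'a \<Rightarrow> real"
  assumes "1 \<le> p" "finite F"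
  shows "(\<Sum>j\<in>F. \<bar>f j + g j\<bar> powr p) powr (1 / p) \<le>
         (\<Sum>j\<in>F. \<bar>f j\<bar> powr p) powr (1 / p) + (\<Sum>j\<in>F. \<bar>g j\<bar> powr p) powr (1 / p)"
proof -
  define A where "A = (\<Sum>j\<in>F. \<bar>f j\<bar> powr p)"
  define B where "B = (\<Sum>j\<in>F. \<bar>g j\<bar> powr p)"
  have nonneg: "0 \<le> A" "0 \<le> B"
    by (auto simp: A_def B_def intro: sum_nonneg)
  consider "A = 0" | "B = 0" | "0 < A" "0 < B"
    using nonneg by linarith
  then show ?thesis
  proof cases
    case 1
    then have "\<forall>j\<in>F. f j = 0"
      unfolding A_def by (rule sum_powr_eq_0[OF assms(2)])
    then have "(\<Sum>j\<in>F. \<bar>f j + g j\<bar> powr p) = B"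
      unfolding B_def by (intro sum.cong) auto
    then show ?thesis
      by (simp add: B_def)
  next
    case 2
    then have "\<forall>j\<in>F. g j = 0"
      unfolding B_def by (rule sum_powr_eq_0[OF assms(2)])
    then have "(\<Sum>j\<in>F. \<bar>f j + g j\<bar> powr p) = A"
      unfolding A_def by (intro sum.cong) auto
    then show ?thesis
      by (simp add: A_def)
  next
    case 3
    define a where "a = A powr (1 / p)"
    define b where "b = B powr (1 / p)"
    have ab: "0 < a" "0 < b" "a powr p = A" "b powr p = B"
      using 3 assms(1) by (auto simp: a_def b_def powr_powr)
    define s where "s = a / (a + b)"
    define t where "t = b / (a + b)"
    have st: "0 \<le> s" "0 \<le> t" "s + t = 1"
      using ab by (auto simp: s_def t_def add_divide_distrib[symmetric])
    have pt: "\<bar>f j + g j\<bar> powr p \<le>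
        (a + b) powr p * (s * (\<bar>f j\<bar> powr p / A) + t * (\<bar>g j\<bar> powr p / B))" for j
    proof -
      have "\<bar>f j + g j\<bar> \<le> \<bar>f j\<bar> + \<bar>g j\<bar>"
        by simp
      also have "\<dots> = (a + b) * (\<bar>f j\<bar> / (a + b) + \<bar>g j\<bar> / (a + b))"
        using ab by (simp add: add_divide_distrib[symmetric])
      also have "\<dots> = (a + b) * (s * (\<bar>f j\<bar> / a) + t * (\<bar>g j\<bar> / b))"
        using ab by (simp add: s_def t_def)
      finally have "\<bar>f j + g j\<bar> powr p \<le> ((a + b) * (s * (\<bar>f j\<bar> / a) + t * (\<bar>g j\<bar> / b))) powr p"
        using assms(1) by (intro powr_mono2) auto
      also have "\<dots> = (a + b) powr p * (s * (\<bar>f j\<bar> / a) + t * (\<bar>g j\<bar> / b)) powr p"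
        by (rule powr_mult)
      also have "\<dots> \<le> (a + b) powr p * (s * (\<bar>f j\<bar> / a) powr p + t * (\<bar>g j\<bar> / b) powr p)"
        using ab st by (intro mult_left_mono powr_add_convex assms(1)) auto
      finally show ?thesis
        using ab by (simp add: powr_divide)
    qed
    have "(\<Sum>j\<in>F. \<bar>f j + g j\<bar> powr p) \<le>
        (\<Sum>j\<in>F. (a + b) powr p * (s * (\<bar>f j\<bar> powr p / A) + t * (\<bar>g j\<bar> powr p / B)))"
      by (intro sum_mono pt)
    also have "\<dots> = (a + b) powr p * (s * (A / A) + t * (B / B))"
      unfolding A_def B_def by (simp only: sum_distrib_left[symmetric] sum.distrib sum_divide_distrib[symmetric])
    also have "\<dots> = (a + b) powr p"
      using 3 st by simp
    finally have "(\<Sum>j\<in>F. \<bar>f j + g j\<bar> powr p) powr (1 / p) \<le> ((a + b) powr p) powr (1 / p)"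
      using assms(1) by (intro powr_mono2) (auto intro: sum_nonneg)
    also have "\<dots> = a + b"
      using ab assms(1) by (simp add: powr_powr)
    finally show ?thesis
      by (simp add: a_def b_def A_def B_def)
  qed
qed

lemma Hoelder_sum:
  fixes f g :: "'a \<Rightarrow> real"
  assumes "1 < p" "1 < q" "1 / p + 1 / q = 1" "finite F"
  shows "(\<Sum>j\<in>F. \<bar>f j * g j\<bar>) \<le>
         (\<Sum>j\<in>F. \<bar>f j\<bar> powr p) powr (1 / p) * (\<Sum>j\<in>F. \<bar>g j\<bar> powr q) powr (1 / q)"
proof -
  define A where "A = (\<Sum>j\<in>F. \<bar>f j\<bar> powr p)"
  define B where "B = (\<Sum>j\<in>F. \<bar>g j\<bar> powr q)"
  have nonneg: "0 \<le> A" "0 \<le> B"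
    by (auto simp: A_def B_def intro: sum_nonneg)
  consider "A = 0" | "B = 0" | "0 < A" "0 < B"
    using nonneg by linarith
  then show ?thesis
  proof cases
    case 1
    then have "\<forall>j\<in>F. f j = 0"
      unfolding A_def by (rule sum_powr_eq_0[OF assms(4)])
    then have "(\<Sum>j\<in>F. \<bar>f j * g j\<bar>) = 0"
      by (intro sum.neutral) auto
    then show ?thesis by simp
  next
    case 2
    then have "\<forall>j\<in>F. g j = 0"
      unfolding B_def by (rule sum_powr_eq_0[OF assms(4)])
    then have "(\<Sum>j\<in>F. \<bar>f j * g j\<bar>) = 0"
      by (intro sum.neutral) auto
    then show ?thesis by simp
  next
    case 3
    define a where "a = A powr (1 / p)"
    define b where "b = B powr (1 / q)"
    have ab: "0 < a" "0 < b" "a powr p = A" "b powr q = B"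
      using 3 assms(1,2) by (auto simp: a_def b_def powr_powr)
    have "\<bar>f j * g j\<bar> \<le> a * b * (\<bar>f j\<bar> powr p / A / p + \<bar>g j\<bar> powr q / B / q)" for j
    proof -
      have "(\<bar>f j\<bar> / a) * (\<bar>g j\<bar> / b) \<le> (\<bar>f j\<bar> / a) powr p / p + (\<bar>g j\<bar> / b) powr q / q"
        using assms(1-3) ab by (intro Youngs_inequality) auto
      then have "a * b * ((\<bar>f j\<bar> / a) * (\<bar>g j\<bar> / b)) \<le>
          a * b * (\<bar>f j\<bar> powr p / A / p + \<bar>g j\<bar> powr q / B / q)"
        using ab by (intro mult_left_mono) (auto simp: powr_divide)
      then show ?thesis
        using ab by (simp add: abs_mult)
    qed
    then have "(\<Sum>j\<in>F. \<bar>f j * g j\<bar>) \<le> (\<Sum>j\<in>F. a * b * (\<bar>f j\<bar> powr p / A / p + \<bar>g j\<bar> powr q / B / q))"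
      by (intro sum_mono)
    also have "\<dots> = a * b * (A / A / p + B / B / q)"
      unfolding A_def B_def by (simp only: sum_distrib_left[symmetric] sum.distrib sum_divide_distrib[symmetric])
    also have "\<dots> = a * b"
      using 3 assms(3) by simp
    finally show ?thesis
      by (simp add: a_def b_def A_def B_def)
  qed
qed

section \<open>Spaces with a partition and weights\<close>

text \<open>
  All spaces of the classification are given by a set of coordinates, a function \<open>c\<close> whose fibres
  are the cells of a partition, and weights.  The norm is built from its finite sections.  Every
  operator needed below is local, each coordinate of the image depending on finitely many
  coordinates of the argument, so that its boundedness is a statement about finite sums.
\<close>

definition psum :: "real \<Rightarrow> 'a set \<Rightarrow> ('a \<Rightarrow> real) \<Rightarrow> real" where
  "psum p F x = (\<Sum>j\<in>F. \<bar>x j\<bar> powr p)"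

definition qsum :: "real \<Rightarrow> ('a \<Rightarrow> 'b) \<Rightarrow> ('a \<Rightarrow> real) \<Rightarrow> 'a set \<Rightarrow> ('a \<Rightarrow> real) \<Rightarrow> real" where
  "qsum p c w F x = (\<Sum>i\<in>c ` F. (\<Sum>j | j \<in> F \<and> c j = i. (w j * x j)\<^sup>2) powr (p / 2))"

definition secn :: "real \<Rightarrow> ('a \<Rightarrow> 'b) \<Rightarrow> ('a \<Rightarrow> real) \<Rightarrow> 'a set \<Rightarrow> ('a \<Rightarrow> real) \<Rightarrow> real" where
  "secn p c w F x = max (psum p F x) (qsum p c w F x)"

definition cell_space :: "real \<Rightarrow> 'a set \<Rightarrow> ('a \<Rightarrow> 'b) \<Rightarrow> ('a \<Rightarrow> real) \<Rightarrow> ('a \<Rightarrow> real) nspace" where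
  "cell_space p J c w = \<lparr>
     vecs = {x. (\<forall>j. j \<notin> J \<longrightarrow> x j = 0) \<and> bdd_above ((\<lambda>F. secn p c w F x) ` Fpow J)},
     nrm = (\<lambda>x. (SUP F\<in>Fpow J. secn p c w F x) powr (1 / p)) \<rparr>"

lemma psum_nonneg [simp]: "0 \<le> psum p F x"
  by (simp add: psum_def sum_nonneg)

lemma qsum_nonneg [simp]: "0 \<le> qsum p c w F x"
  by (simp add: qsum_def sum_nonneg)

lemma secn_nonneg [simp]: "0 \<le> secn p c w F x"
  by (simp add: secn_def le_max_iff_disj)

lemma qsum_superset:
  assumes "finite S" "c ` F \<subseteq> S"
  shows "qsum p c w F x = (\<Sum>i\<in>S. (\<Sum>j | j \<in> F \<and> c j = i. (w j * x j)\<^sup>2) powr (p / 2))"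
  unfolding qsum_def
proof (rule sum.mono_neutral_left)
  show "\<forall>i\<in>S - c ` F. (\<Sum>j | j \<in> F \<and> c j = i. (w j * x j)\<^sup>2) powr (p / 2) = 0"
  proof
    fix i assume "i \<in> S - c ` F"
    then have "{j. j \<in> F \<and> c j = i} = {}"
      by auto
    then show "(\<Sum>j | j \<in> F \<and> c j = i. (w j * x j)\<^sup>2) powr (p / 2) = 0"
      by (simp only:) simp
  qed
qed (use assms in auto)

lemma psum_cong: "(\<And>j. j \<in> F \<Longrightarrow> x j = y j) \<Longrightarrow> psum p F x = psum p F y"
  by (simp add: psum_def)

lemma qsum_cong:
  assumes "\<And>j. j \<in> F \<Longrightarrow> w j * x j = w' j * y j" "\<And>j. j \<in> F \<Longrightarrow> c j = c' j"
  shows "qsum p c w F x = qsum p c' w' F y"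
proof -
  have "c ` F = c' ` F" "\<And>i. {j. j \<in> F \<and> c j = i} = {j. j \<in> F \<and> c' j = i}"
    using assms(2) by auto
  then show ?thesis
    unfolding qsum_def using assms(1) by (auto intro!: sum.cong arg_cong[where f = "\<lambda>t. t powr (p / 2)"])
qed

lemma secn_cong:
  assumes "\<And>j. j \<in> F \<Longrightarrow> x j = y j"
  shows "secn p c w F x = secn p c w F y"
  using psum_cong[of F x y p] qsum_cong[of F w x w y c c p] assms by (simp add: secn_def)

text \<open>With \<open>F \<subseteq> G\<close> this is monotonicity; the more general form lets \<open>F\<close> be cut down to the support.\<close>

lemma psum_mono:
  assumes "finite G" "finite F" "\<And>j. j \<in> F - G \<Longrightarrow> x j = 0"
  shows "psum p F x \<le> psum p G x"
proof -
  have "psum p F x = psum p (F \<inter> G) x"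
    unfolding psum_def using assms by (intro sum.mono_neutral_right) auto
  also have "\<dots> \<le> psum p G x"
    unfolding psum_def using assms by (intro sum_mono2) auto
  finally show ?thesis .
qed

lemma qsum_mono:
  assumes "0 \<le> p" "finite G" "finite F" "\<And>j. j \<in> F - G \<Longrightarrow> x j = 0"
  shows "qsum p c w F x \<le> qsum p c w G x"
proof -
  let ?S = "c ` F \<union> c ` G"
  have in_le: "(\<Sum>j | j \<in> F \<and> c j = i. (w j * x j)\<^sup>2) \<le> (\<Sum>j | j \<in> G \<and> c j = i. (w j * x j)\<^sup>2)" for i
  proof -
    have "(\<Sum>j | j \<in> F \<and> c j = i. (w j * x j)\<^sup>2) = (\<Sum>j | j \<in> F \<inter> G \<and> c j = i. (w j * x j)\<^sup>2)"
      using assms by (intro sum.mono_neutral_right) auto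
    also have "\<dots> \<le> (\<Sum>j | j \<in> G \<and> c j = i. (w j * x j)\<^sup>2)"
      using assms by (intro sum_mono2) auto
    finally show ?thesis .
  qed
  have "qsum p c w F x = (\<Sum>i\<in>?S. (\<Sum>j | j \<in> F \<and> c j = i. (w j * x j)\<^sup>2) powr (p / 2))"
    using assms by (intro qsum_superset) auto
  also have "\<dots> \<le> (\<Sum>i\<in>?S. (\<Sum>j | j \<in> G \<and> c j = i. (w j * x j)\<^sup>2) powr (p / 2))"
    using in_le assms(1) by (intro sum_mono powr_mono2) (auto intro: sum_nonneg)
  also have "\<dots> = qsum p c w G x"
    using assms by (intro qsum_superset[symmetric]) auto
  finally show ?thesis .
qed

lemma secn_mono:
  assumes "0 \<le> p" "finite G" "finite F" "\<And>j. j \<in> F - G \<Longrightarrow> x j = 0"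
  shows "secn p c w F x \<le> secn p c w G x"
  using psum_mono[of G F x p, OF assms(2,3)] qsum_mono[of p G F x c w, OF assms(1-3)] assms(4)
  by (auto simp: secn_def)

lemma psum_scale: "psum p F (a *\<^sub>R x) = \<bar>a\<bar> powr p * psum p F x"
  by (simp add: psum_def scaleR_fun_def abs_mult powr_mult sum_distrib_left)

lemma qsum_scale: "qsum p c w F (a *\<^sub>R x) = \<bar>a\<bar> powr p * qsum p c w F x"
proof -
  have 1: "(\<Sum>j | j \<in> F \<and> c j = i. (w j * (a *\<^sub>R x) j)\<^sup>2) = \<bar>a\<bar>\<^sup>2 * (\<Sum>j | j \<in> F \<and> c j = i. (w j * x j)\<^sup>2)" for i
    by (simp add: scaleR_fun_def sum_distrib_left power_mult_distrib algebra_simps)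
  have 2: "(\<bar>a\<bar>\<^sup>2) powr (p / 2) = \<bar>a\<bar> powr p"
    using powr_powr[of "\<bar>a\<bar>" 2 "p / 2"] by simp
  show ?thesis
    unfolding qsum_def 1 by (simp only: powr_mult 2 sum_distrib_left[where r = "\<bar>a\<bar> powr p"])
qed

lemma secn_scale: "secn p c w F (a *\<^sub>R x) = \<bar>a\<bar> powr p * secn p c w F x"
  by (simp add: secn_def psum_scale qsum_scale max_mult_distrib_left)

lemma L2_set_powr: "(\<Sum>j\<in>E. (f j)\<^sup>2) powr (p / 2) = \<bar>L2_set f E\<bar> powr p"
  by (simp add: L2_set_def powr_half_sqrt[symmetric] powr_powr sum_nonneg)

lemma secn_triangle:
  assumes "1 \<le> p" "finite F"
  shows "secn p c w F (x + y) powr (1 / p) \<le> secn p c w F x powr (1 / p) + secn p c w F y powr (1 / p)"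
proof -
  have le: "psum p F x powr (1 / p) \<le> secn p c w F x powr (1 / p)"
           "qsum p c w F x powr (1 / p) \<le> secn p c w F x powr (1 / p)" for x
    using assms by (auto simp: secn_def intro!: powr_mono2)
  have "psum p F (x + y) powr (1 / p) \<le> psum p F x powr (1 / p) + psum p F y powr (1 / p)"
    using Minkowski_sum[OF assms] by (simp add: psum_def plus_fun_def)
  moreover have "qsum p c w F (x + y) powr (1 / p) \<le> qsum p c w F x powr (1 / p) + qsum p c w F y powr (1 / p)"
  proof -
    let ?l = "\<lambda>x i. L2_set (\<lambda>j. w j * x j) {j \<in> F. c j = i}"
    have q: "qsum p c w F x = (\<Sum>i\<in>c ` F. \<bar>?l x i\<bar> powr p)" for x
      by (simp add: qsum_def L2_set_powr)
    have "?l (x + y) i \<le> ?l x i + ?l y i" for i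
      using L2_set_triangle_ineq[of "\<lambda>j. w j * x j" "\<lambda>j. w j * y j"] by (simp add: algebra_simps)
    then have "\<bar>?l (x + y) i\<bar> \<le> \<bar>?l x i + ?l y i\<bar>" for i
      by (simp add: L2_set_nonneg)
    then have "qsum p c w F (x + y) powr (1 / p) \<le> (\<Sum>i\<in>c ` F. \<bar>?l x i + ?l y i\<bar> powr p) powr (1 / p)"
      unfolding q using assms by (intro powr_mono2 sum_mono) (auto intro: sum_nonneg)
    also have "\<dots> \<le> qsum p c w F x powr (1 / p) + qsum p c w F y powr (1 / p)"
      unfolding q using assms by (intro Minkowski_sum) auto
    finally show ?thesis .
  qed
  ultimately show ?thesis
    using le[of x] le[of y] by (auto simp: secn_def max_def)
qed

lemma cell_space_vecsD:
  assumes "x \<in> vecs (cell_space p J c w)"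
  shows "j \<notin> J \<Longrightarrow> x j = 0"
    and "0 < p \<Longrightarrow> F \<in> Fpow J \<Longrightarrow> secn p c w F x \<le> nrm (cell_space p J c w) x powr p"
proof -
  show "j \<notin> J \<Longrightarrow> x j = 0"
    using assms by (simp add: cell_space_def)
  have bdd: "bdd_above ((\<lambda>F. secn p c w F x) ` Fpow J)"
    using assms by (simp add: cell_space_def)
  assume "0 < p" and F: "F \<in> Fpow J"
  have "secn p c w F x \<le> (SUP F\<in>Fpow J. secn p c w F x)"
    by (rule cSUP_upper[OF F bdd])
  moreover have "0 \<le> (SUP F\<in>Fpow J. secn p c w F x)"
    using calculation secn_nonneg order_trans by blast
  ultimately show "secn p c w F x \<le> nrm (cell_space p J c w) x powr p"
    using \<open>0 < p\<close> by (simp add: cell_space_def powr_powr)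
qed

lemma cell_space_off: "x \<in> vecs (cell_space p J c w) \<Longrightarrow> \<forall>j. j \<notin> J \<longrightarrow> x j = 0"
  by (simp add: cell_space_def)

lemma cell_space_bound:
  assumes "0 < p" "0 \<le> C" "\<And>j. j \<notin> J \<Longrightarrow> x j = 0" "\<And>F. F \<in> Fpow J \<Longrightarrow> secn p c w F x \<le> C powr p"
  shows "x \<in> vecs (cell_space p J c w)" "nrm (cell_space p J c w) x \<le> C"
proof -
  show "x \<in> vecs (cell_space p J c w)"
    using assms by (auto simp: cell_space_def intro!: bdd_aboveI2)
  then have bdd: "bdd_above ((\<lambda>F. secn p c w F x) ` Fpow J)"
    by (simp add: cell_space_def)
  have E: "{} \<in> Fpow J"
    by (simp add: Fpow_def)
  have "0 \<le> (SUP F\<in>Fpow J. secn p c w F x)"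
    using cSUP_upper[OF E bdd] secn_nonneg order_trans by blast
  moreover have "(SUP F\<in>Fpow J. secn p c w F x) \<le> C powr p"
    using E assms(4) by (intro cSUP_least) auto
  ultimately have "nrm (cell_space p J c w) x \<le> (C powr p) powr (1 / p)"
    using assms(1) by (auto simp: cell_space_def intro!: powr_mono2)
  then show "nrm (cell_space p J c w) x \<le> C"
    using assms(1,2) by (simp add: powr_powr)
qed

lemma nrm_cell_space_nonneg [simp]: "0 \<le> nrm (cell_space p J c w) x"
  by (simp add: cell_space_def)

lemma normed_cell_space:
  assumes p: "1 \<le> p"
  shows "normed (cell_space p J c w)"
  unfolding normed_def
proof (intro conjI ballI allI impI)
  let ?X = "cell_space p J c w"
  have p0: "0 < p"
    using p by simp
  have "(0::'a \<Rightarrow> real) \<in> vecs ?X"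
    by (rule cell_space_bound(1)[of p 0]) (use p0 in \<open>auto simp: secn_def psum_def qsum_def\<close>)
  then show "0 \<in> vecs ?X" .
  fix x assume x: "x \<in> vecs ?X"
  have sx: "secn p c w F x powr (1 / p) \<le> nrm ?X x" if "F \<in> Fpow J" "x \<in> vecs ?X" for F x
  proof -
    have "secn p c w F x powr (1 / p) \<le> (nrm ?X x powr p) powr (1 / p)"
      using p0 by (intro powr_mono2 cell_space_vecsD(2) that) auto
    then show ?thesis
      using p0 by (simp add: powr_powr)
  qed
  {
    fix y assume y: "y \<in> vecs ?X"
    have "secn p c w F (x + y) \<le> (nrm ?X x + nrm ?X y) powr p" if F: "F \<in> Fpow J" for F
    proof -
      have "secn p c w F (x + y) = (secn p c w F (x + y) powr (1 / p)) powr p"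
        using p0 by (simp add: powr_powr)
      also have "\<dots> \<le> (nrm ?X x + nrm ?X y) powr p"
        using secn_triangle[OF p, of F c w x y] sx[OF F x] sx[OF F y] F p0
        by (intro powr_mono2) (auto simp: Fpow_def)
      finally show ?thesis .
    qed
    note b = cell_space_bound[OF p0 _ _ this, simplified]
    show "x + y \<in> vecs ?X" "nrm ?X (x + y) \<le> nrm ?X x + nrm ?X y"
      by (rule b; simp add: cell_space_vecsD(1)[OF x] cell_space_vecsD(1)[OF y])+
  }
  {
    fix a
    have *: "a *\<^sub>R x \<in> vecs ?X \<and> nrm ?X (a *\<^sub>R x) \<le> \<bar>a\<bar> * nrm ?X x" if x: "x \<in> vecs ?X" for a x
    proof -
      have "secn p c w F (a *\<^sub>R x) \<le> (\<bar>a\<bar> * nrm ?X x) powr p" if "F \<in> Fpow J" for F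
        using cell_space_vecsD(2)[OF x p0 that] by (simp add: secn_scale powr_mult mult_left_mono)
      note b = cell_space_bound[OF p0 _ _ this, simplified]
      show ?thesis
        by (intro conjI b; simp add: cell_space_vecsD(1)[OF x] scaleR_fun_def)
    qed
    show "a *\<^sub>R x \<in> vecs ?X"
      using *[OF x] by blast
    show "nrm ?X (a *\<^sub>R x) = \<bar>a\<bar> * nrm ?X x"
    proof (cases "a = 0")
      case True
      then show ?thesis
        using *[OF x, of 0] nrm_cell_space_nonneg[of p J c w 0] by simp
    next
      case False
      have "nrm ?X x \<le> \<bar>inverse a\<bar> * nrm ?X (a *\<^sub>R x)"
        using *[of "a *\<^sub>R x" "inverse a"] *[OF x] False by simp
      then show ?thesis
        using *[OF x, of a] False by (intro antisym) (auto simp: field_simps)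
    qed
  }
  assume n: "nrm ?X x = 0"
  show "x = 0"
  proof
    fix j show "x j = 0 j"
    proof (cases "j \<in> J")
      case True
      then have "secn p c w {j} x \<le> 0"
        using cell_space_vecsD(2)[OF x p0, of "{j}"] n by (simp add: Fpow_def)
      then have "psum p {j} x \<le> 0"
        by (simp add: secn_def)
      then show ?thesis
        by (simp add: psum_def)
    qed (simp add: cell_space_vecsD(1)[OF x])
  qed
qed

lemma cell_space_bounded:
  assumes p: "0 < p" and C: "0 \<le> C"
    and lin: "\<And>x y. T (x + y) = T x + T y" "\<And>a x. T (a *\<^sub>R x) = a *\<^sub>R T x"
    and off: "\<And>x k. x \<in> vecs (cell_space p J c w) \<Longrightarrow> k \<notin> K \<Longrightarrow> T x k = 0"
    and sec: "\<And>F. F \<in> Fpow K \<Longrightarrow> \<exists>G\<in>Fpow J. \<forall>x. secn p c' w' F (T x) \<le> C * secn p c w G x"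
  shows "bounded_between (cell_space p J c w) (cell_space p K c' w') T"
proof -
  let ?X = "cell_space p J c w" and ?Y = "cell_space p K c' w'"
  have "T x \<in> vecs ?Y \<and> nrm ?Y (T x) \<le> C powr (1 / p) * nrm ?X x" if x: "x \<in> vecs ?X" for x
  proof -
    have "secn p c' w' F (T x) \<le> (C powr (1 / p) * nrm ?X x) powr p" if F: "F \<in> Fpow K" for F
    proof -
      obtain G where G: "G \<in> Fpow J" and "secn p c' w' F (T x) \<le> C * secn p c w G x"
        using sec[OF F] by blast
      note this(2)
      also have "C * secn p c w G x \<le> C * nrm ?X x powr p"
        using C by (intro mult_left_mono cell_space_vecsD(2)[OF x p G])
      finally show ?thesis
        using p C by (simp add: powr_mult powr_powr)
    qed
    note b = cell_space_bound[OF p _ _ this, simplified]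
    show ?thesis
      by (intro conjI b; simp add: off[OF x])
  qed
  then show ?thesis
    by (intro bounded_betweenI[where C = "C powr (1 / p)"]) (simp_all add: lin)
qed

lemma cell_space_iso_same:
  assumes p: "0 < p" and C: "0 \<le> C" "0 \<le> D"
    and le: "\<And>F x. F \<in> Fpow J \<Longrightarrow> secn p c' w' F x \<le> C * secn p c w F x"
            "\<And>F x. F \<in> Fpow J \<Longrightarrow> secn p c w F x \<le> D * secn p c' w' F x"
  shows "cell_space p J c w \<cong>\<^sub>B cell_space p J c' w'"
proof (rule lin_isoI)
  show "bounded_between (cell_space p J c w) (cell_space p J c' w') (\<lambda>x. x)"
    using le(1) by (intro cell_space_bounded[OF p C(1)]) (auto simp: cell_space_vecsD(1))
  show "bounded_between (cell_space p J c' w') (cell_space p J c w) (\<lambda>x. x)"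
    using le(2) by (intro cell_space_bounded[OF p C(2)]) (auto simp: cell_space_vecsD(1))
qed auto

lemma secn_reindex:
  assumes inj: "inj_on f K" and FK: "F \<subseteq> K"
    and w: "\<And>k. k \<in> K \<Longrightarrow> w' k = w (f k)"
    and c: "\<And>k l. k \<in> K \<Longrightarrow> l \<in> K \<Longrightarrow> c' k = c' l \<longleftrightarrow> c (f k) = c (f l)"
  shows "secn p c' w' F (\<lambda>k. if k \<in> K then x (f k) else 0) = secn p c w (f ` F) x"
proof -
  let ?y = "\<lambda>k. if k \<in> K then x (f k) else 0"
  note inj = inj_on_subset[OF inj FK]
  have "psum p F ?y = psum p (f ` F) x"
    unfolding psum_def sum.reindex[OF inj] using FK by (intro sum.cong) auto
  moreover have "qsum p c' w' F ?y = qsum p c w (f ` F) x"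
  proof -
    define \<psi> where "\<psi> i = c (f (SOME k. k \<in> K \<and> c' k = i))" for i
    have \<psi>: "\<psi> (c' k) = c (f k)" if "k \<in> K" for k
    proof -
      have "(SOME l. l \<in> K \<and> c' l = c' k) \<in> K \<and> c' (SOME l. l \<in> K \<and> c' l = c' k) = c' k"
        using that by (intro someI_ex[of "\<lambda>l. l \<in> K \<and> c' l = c' k"]) auto
      with c[of _ k] that show ?thesis
        unfolding \<psi>_def by blast
    qed
    have inj\<psi>: "inj_on \<psi> (c' ` F)"
      using FK c by (auto simp: inj_on_def \<psi> subset_iff)
    have im: "c ` f ` F = \<psi> ` c' ` F"
      using FK \<psi> by (force simp: image_iff)
    have "(\<Sum>k | k \<in> F \<and> c' k = i. (w' k * ?y k)\<^sup>2) = (\<Sum>j | j \<in> f ` F \<and> c j = \<psi> i. (w j * x j)\<^sup>2)"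
      if i: "i \<in> c' ` F" for i
    proof -
      have "{j. j \<in> f ` F \<and> c j = \<psi> i} = f ` {k. k \<in> F \<and> c' k = i}"
      proof -
        obtain k where k: "k \<in> F" "i = c' k"
          using i by auto
        have "c (f l) = \<psi> i \<longleftrightarrow> c' l = i" if l: "l \<in> F" for l
        proof -
          have "k \<in> K" "l \<in> K"
            using k(1) l FK by auto
          then show ?thesis
            using \<psi>[of k] c[of l k] k(2) by auto
        qed
        then show ?thesis by auto
      qed
      moreover have "inj_on f {k. k \<in> F \<and> c' k = i}"
        using inj by (rule inj_on_subset) auto
      ultimately have "(\<Sum>j | j \<in> f ` F \<and> c j = \<psi> i. (w j * x j)\<^sup>2) =
          (\<Sum>k | k \<in> F \<and> c' k = i. (w (f k) * x (f k))\<^sup>2)"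
        by (simp add: sum.reindex)
      also have "\<dots> = (\<Sum>k | k \<in> F \<and> c' k = i. (w' k * ?y k)\<^sup>2)"
        using FK w by (intro sum.cong) auto
      finally show ?thesis ..
    qed
    then show ?thesis
      unfolding qsum_def im sum.reindex[OF inj\<psi>] by (intro sum.cong) auto
  qed
  ultimately show ?thesis
    by (simp add: secn_def)
qed

lemma cell_space_reindex:
  assumes p: "0 < p" and f: "bij_betw f K J"
    and w: "\<And>k. k \<in> K \<Longrightarrow> w' k = w (f k)"
    and c: "\<And>k l. k \<in> K \<Longrightarrow> l \<in> K \<Longrightarrow> c' k = c' l \<longleftrightarrow> c (f k) = c (f l)"
  shows "cell_space p K c' w' \<cong>\<^sub>B cell_space p J c w"
proof -
  let ?T = "\<lambda>x k. if k \<in> K then x (f k) else 0"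
  let ?g = "inv_into K f"
  let ?S = "\<lambda>y j. if j \<in> J then y (?g j) else 0"
  have g: "bij_betw ?g J K" and fg: "\<And>j. j \<in> J \<Longrightarrow> f (?g j) = j" and gK: "\<And>j. j \<in> J \<Longrightarrow> ?g j \<in> K"
    and gf: "\<And>k. k \<in> K \<Longrightarrow> ?g (f k) = k" and fJ: "\<And>k. k \<in> K \<Longrightarrow> f k \<in> J"
    using f bij_betw_inv_into[OF f] bij_betw_inv_into_left[OF f] bij_betw_inv_into_right[OF f]
    by (auto simp: bij_betw_def)
  have inj: "inj_on f K" "inj_on ?g J"
    using f g by (auto simp: bij_betw_def)
  have T: "bounded_between (cell_space p J c w) (cell_space p K c' w') ?T"
  proof (rule cell_space_bounded[OF p zero_le_one])
    fix F assume F: "F \<in> Fpow K"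
    then have "secn p c' w' F (?T x) = secn p c w (f ` F) x" for x
      by (intro secn_reindex inj w c) (auto simp: Fpow_def)
    then show "\<exists>G\<in>Fpow J. \<forall>x. secn p c' w' F (?T x) \<le> 1 * secn p c w G x"
      using F fJ by (intro bexI[of _ "f ` F"]) (auto simp: Fpow_def)
  qed (auto simp: fun_eq_iff scaleR_fun_def)
  have S: "bounded_between (cell_space p K c' w') (cell_space p J c w) ?S"
  proof (rule cell_space_bounded[OF p zero_le_one])
    fix F assume F: "F \<in> Fpow J"
    have "c j = c l \<longleftrightarrow> c' (?g j) = c' (?g l)" "w j = w' (?g j)" if "j \<in> J" "l \<in> J" for j l
      using c[of "?g j" "?g l"] w[of "?g j"] that by (simp_all add: fg gK)
    with F have "secn p c w F (?S x) = secn p c' w' (?g ` F) x" for x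
      by (intro secn_reindex inj) (auto simp: Fpow_def)
    then show "\<exists>G\<in>Fpow K. \<forall>x. secn p c w F (?S x) \<le> 1 * secn p c' w' G x"
      using F gK by (intro bexI[of _ "?g ` F"]) (auto simp: Fpow_def)
  qed (auto simp: fun_eq_iff scaleR_fun_def)
  show ?thesis
    by (rule lin_isoI[OF S T])
       (auto simp: fun_eq_iff fg gf gK fJ dest!: cell_space_off)
qed

lemma cell_space_restrict_bounded:
  assumes "0 < p" "J \<subseteq> K"
  shows "bounded_between (cell_space p K c w) (cell_space p J c w) (\<lambda>x j. if j \<in> J then x j else 0)"
    and "bounded_between (cell_space p J c w) (cell_space p K c w) (\<lambda>x. x)"
proof -
  show "bounded_between (cell_space p K c w) (cell_space p J c w) (\<lambda>x j. if j \<in> J then x j else 0)"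
  proof (rule cell_space_bounded[OF assms(1) zero_le_one])
    fix F assume F: "F \<in> Fpow J"
    then have "secn p c w F (\<lambda>j. if j \<in> J then x j else 0) = secn p c w F x" for x
      by (intro secn_cong) (auto simp: Fpow_def)
    then show "\<exists>G\<in>Fpow K. \<forall>x. secn p c w F (\<lambda>j. if j \<in> J then x j else 0) \<le> 1 * secn p c w G x"
      using F assms(2) by (intro bexI[of _ F]) (auto simp: Fpow_def)
  qed (auto simp: fun_eq_iff scaleR_fun_def)
  have b: "secn p c w F x \<le> nrm (cell_space p J c w) x powr p"
    if x: "x \<in> vecs (cell_space p J c w)" and F: "F \<in> Fpow K" for F x
  proof -
    have "secn p c w F x \<le> secn p c w (F \<inter> J) x"
      using F assms(1) cell_space_vecsD(1)[OF x] by (intro secn_mono) (auto simp: Fpow_def)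
    also have "\<dots> \<le> nrm (cell_space p J c w) x powr p"
      using F assms(1) by (intro cell_space_vecsD(2)[OF x]) (auto simp: Fpow_def)
    finally show ?thesis .
  qed
  show "bounded_between (cell_space p J c w) (cell_space p K c w) (\<lambda>x. x)"
  proof (rule bounded_betweenI[where C = 1])
    fix x assume x: "x \<in> vecs (cell_space p J c w)"
    note bb = cell_space_bound[OF assms(1) nrm_cell_space_nonneg _ b[OF x]]
    show "x \<in> vecs (cell_space p K c w)" "nrm (cell_space p K c w) x \<le> 1 * nrm (cell_space p J c w) x"
      using bb cell_space_vecsD(1)[OF x] assms(2) by auto
  qed auto
qed

lemma cell_space_subset_complemented:
  assumes "0 < p" "J \<subseteq> K"
  shows "cell_space p J c w \<unlhd>\<^sub>B cell_space p K c w"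
  unfolding complemented_def
  using cell_space_restrict_bounded[OF assms, of c w]
  by (intro exI[of _ "\<lambda>x. x"] exI[of _ "\<lambda>x j. if j \<in> J then x j else 0"])
     (auto simp: fun_eq_iff dest!: cell_space_off)

lemma cell_space_split:
  assumes "1 \<le> p" "J \<inter> K = {}"
  shows "cell_space p (J \<union> K) c w \<cong>\<^sub>B cell_space p J c w \<oplus>\<^sub>B cell_space p K c w"
proof -
  have p: "0 < p" using assms by simp
  have d: "\<And>j. j \<in> K \<Longrightarrow> j \<notin> J" "\<And>j. j \<in> J \<Longrightarrow> j \<notin> K"
    using assms(2) by auto
  note n = normed_cell_space[OF assms(1)]
  note r = cell_space_restrict_bounded[OF p]
  show ?thesis
    by (rule lin_isoI[OF bounded_between_Pair[OF r(1)[of J] r(1)[of K] n]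
          bounded_between_add[OF bounded_between_compose[OF bounded_between_fst r(2) n]
            bounded_between_compose[OF bounded_between_snd r(2) n] n]])
       (auto simp: fun_eq_iff d dest!: cell_space_off)
qed

lemma cell_space_cong:
  assumes "0 < p" "\<And>j. j \<in> J \<Longrightarrow> w' j = w j" "\<And>j l. j \<in> J \<Longrightarrow> l \<in> J \<Longrightarrow> c' j = c' l \<longleftrightarrow> c j = c l"
  shows "cell_space p J c' w' \<cong>\<^sub>B cell_space p J c w"
  using cell_space_reindex[of p "\<lambda>j. j" J J w' w c' c] assms by (simp add: bij_betw_def)

section \<open>Block bases\<close>

lemma psum_UNION:
  assumes "finite G" "\<And>k. k \<in> G \<Longrightarrow> finite (Bl k)" "disjoint_family_on Bl G"
  shows "psum p (\<Union>k\<in>G. Bl k) y = (\<Sum>k\<in>G. psum p (Bl k) y)"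
  unfolding psum_def using assms by (intro sum.UNION_disjoint) (auto simp: disjoint_family_on_def)

lemma qsum_UNION:
  assumes "finite G" "\<And>k. k \<in> G \<Longrightarrow> finite (Bl k)" "disjoint_family_on Bl G"
    and cell: "\<And>k j. k \<in> G \<Longrightarrow> j \<in> Bl k \<Longrightarrow> c j = \<phi> (c' k)" and inj: "inj_on \<phi> (c' ` G)"
  shows "qsum p c w (\<Union>k\<in>G. Bl k) y =
    (\<Sum>i\<in>c' ` G. (\<Sum>k | k \<in> G \<and> c' k = i. \<Sum>j\<in>Bl k. (w j * y j)\<^sup>2) powr (p / 2))"
proof -
  have "qsum p c w (\<Union>k\<in>G. Bl k) y =
      (\<Sum>i\<in>\<phi> ` c' ` G. (\<Sum>j | j \<in> (\<Union>k\<in>G. Bl k) \<and> c j = i. (w j * y j)\<^sup>2) powr (p / 2))"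
    using assms by (intro qsum_superset) auto
  also have "\<dots> = (\<Sum>i\<in>c' ` G. (\<Sum>j | j \<in> (\<Union>k\<in>G. Bl k) \<and> c j = \<phi> i. (w j * y j)\<^sup>2) powr (p / 2))"
    by (simp add: sum.reindex[OF inj])
  also have "\<dots> = (\<Sum>i\<in>c' ` G. (\<Sum>k | k \<in> G \<and> c' k = i. \<Sum>j\<in>Bl k. (w j * y j)\<^sup>2) powr (p / 2))"
  proof (rule sum.cong[OF refl])
    fix i assume i: "i \<in> c' ` G"
    have "{j. j \<in> (\<Union>k\<in>G. Bl k) \<and> c j = \<phi> i} = (\<Union>k\<in>{k. k \<in> G \<and> c' k = i}. Bl k)"
      using cell inj i by (auto simp: inj_on_def)
    moreover have "(\<Sum>j\<in>(\<Union>k\<in>{k. k \<in> G \<and> c' k = i}. Bl k). (w j * y j)\<^sup>2) =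
        (\<Sum>k | k \<in> G \<and> c' k = i. \<Sum>j\<in>Bl k. (w j * y j)\<^sup>2)"
      using assms(1-3) by (intro sum.UNION_disjoint) (auto simp: disjoint_family_on_def)
    ultimately show "(\<Sum>j | j \<in> (\<Union>k\<in>G. Bl k) \<and> c j = \<phi> i. (w j * y j)\<^sup>2) powr (p / 2) =
        (\<Sum>k | k \<in> G \<and> c' k = i. \<Sum>j\<in>Bl k. (w j * y j)\<^sup>2) powr (p / 2)"
      by simp
  qed
  finally show ?thesis .
qed

text \<open>
  Rosenthal's exponent.  On a block of coordinates of one cell, the vector with entries
  \<open>b\<^sub>j = w\<^sub>j\<^bsup>2/(p-2)\<^esup>\<close> satisfies \<open>b\<^sub>j\<^sup>p = w\<^sub>j\<^sup>2 b\<^sub>j\<^sup>2 = w\<^sub>j\<^sup>r\<close>, so a block with \<open>\<Sum>w\<^sub>j\<^sup>r = s\<close> has \<open>p\<close>-th power sum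
  and weighted square sum equal to \<open>s\<close>.  Normalised in \<open>\<ell>\<^sub>p\<close> it behaves like one coordinate of weight
  \<open>s\<^bsup>1/2-1/p\<^esup> = s\<^bsup>1/r\<^esup>\<close>.
\<close>

definition rexp :: "real \<Rightarrow> real" where
  "rexp p = 2 * p / (p - 2)"

lemma rexp_pos: "2 < p \<Longrightarrow> 0 < rexp p"
  by (simp add: rexp_def)

lemma rexp_mult: "2 < p \<Longrightarrow> rexp p * (1 - 2 / p) = 2"
  by (simp add: rexp_def field_simps)

lemma block_weight_powers:
  fixes w :: real
  assumes p: "2 < p" and w: "0 < w"
  defines "b \<equiv> w powr (2 / (p - 2))"
  shows "b powr p = w powr rexp p" "(w * b)\<^sup>2 = w powr rexp p" "w\<^sup>2 * b * b = w powr rexp p"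
    and "(w\<^sup>2 * b) powr (p / (p - 1)) = w powr rexp p"
proof -
  show "b powr p = w powr rexp p"
    using p by (simp add: b_def powr_powr rexp_def)
  have b2: "b\<^sup>2 = w powr (4 / (p - 2))" and w2: "w\<^sup>2 = w powr 2"
    using w by (simp_all add: b_def powr_power)
  show 1: "(w * b)\<^sup>2 = w powr rexp p"
  proof -
    have "(w * b)\<^sup>2 = w powr (2 + 4 / (p - 2))"
      unfolding power_mult_distrib b2 w2 powr_add ..
    also have "2 + 4 / (p - 2) = rexp p"
      using p by (simp add: rexp_def field_simps)
    finally show ?thesis .
  qed
  then show "w\<^sup>2 * b * b = w powr rexp p"
    by (simp add: power2_eq_square algebra_simps)
  have "w\<^sup>2 * b = w powr (2 + 2 / (p - 2))"
    unfolding w2 b_def powr_add ..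
  also have "2 + 2 / (p - 2) = rexp p * ((p - 1) / p)"
    using p by (simp add: rexp_def field_simps)
  finally have "(w\<^sup>2 * b) powr (p / (p - 1)) = w powr (rexp p * ((p - 1) / p) * (p / (p - 1)))"
    by (simp only: powr_powr)
  also have "rexp p * ((p - 1) / p) * (p / (p - 1)) = rexp p"
    using p by simp
  finally show "(w\<^sup>2 * b) powr (p / (p - 1)) = w powr rexp p" .
qed

text \<open>
  The orthogonal projection, with respect to the weights, onto the span of the normalised block
  vectors is bounded for both parts of the norm.
\<close>

lemma blocks_complemented:
  assumes p: "2 < p"
    and Bl: "\<And>k. k \<in> K \<Longrightarrow> finite (Bl k)" "\<And>k. k \<in> K \<Longrightarrow> Bl k \<subseteq> J"
    and disj: "disjoint_family_on Bl K"
    and w: "\<And>j. j \<in> J \<Longrightarrow> 0 < w j" and u: "\<And>k. k \<in> K \<Longrightarrow> 0 < u k"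
    and cell: "\<And>k j. k \<in> K \<Longrightarrow> j \<in> Bl k \<Longrightarrow> c j = \<phi> (c' k)" and inj: "inj_on \<phi> (c' ` K)"
    and lower: "\<And>k. k \<in> K \<Longrightarrow> u k powr rexp p \<le> (\<Sum>j\<in>Bl k. w j powr rexp p)"
    and upper: "\<And>k. k \<in> K \<Longrightarrow> (\<Sum>j\<in>Bl k. w j powr rexp p) \<le> 2 * u k powr rexp p"
  shows "cell_space p K c' u \<unlhd>\<^sub>B cell_space p J c w"
proof -
  define b where "b j = w j powr (2 / (p - 2))" for j
  define s where "s k = (\<Sum>j\<in>Bl k. w j powr rexp p)" for k
  define \<kappa> where "\<kappa> j = (SOME k. k \<in> K \<and> j \<in> Bl k)" for j
  define i where "i x j = (if j \<in> (\<Union>k\<in>K. Bl k) then x (\<kappa> j) * b j * s (\<kappa> j) powr (- (1 / p)) else 0)"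
    for x and j
  define q where "q y k = (if k \<in> K then s k powr (1 / p - 1) * (\<Sum>j\<in>Bl k. (w j)\<^sup>2 * b j * y j) else 0)"
    for y and k
  have p0: "0 < p" "1 \<le> p" and r0: "0 < rexp p"
    using p rexp_pos by auto
  have \<kappa>: "\<kappa> j = k" if "k \<in> K" "j \<in> Bl k" for k j
  proof -
    have "\<kappa> j \<in> K \<and> j \<in> Bl (\<kappa> j)"
      unfolding \<kappa>_def using that by (intro someI_ex[of "\<lambda>k. k \<in> K \<and> j \<in> Bl k"]) auto
    then show ?thesis
      using that disj by (auto simp: disjoint_family_on_def)
  qed
  have ix: "i x j = x k * b j * s k powr (- (1 / p))" if "k \<in> K" "j \<in> Bl k" for x k j
    using that \<kappa>[OF that] by (auto simp: i_def)
  have s0: "0 < s k" if "k \<in> K" for k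
  proof -
    have "0 < u k powr rexp p"
      using u[OF that] by simp
    then show ?thesis
      using lower[OF that] unfolding s_def by linarith
  qed
  have wB: "0 < w j" if "k \<in> K" "j \<in> Bl k" for k j
    using that Bl(2) w by blast
  note bw = block_weight_powers[OF p wB, folded b_def]
  have b0: "0 < b j" if "k \<in> K" "j \<in> Bl k" for k j
    using wB[OF that] by (simp add: b_def)
  have disjG: "disjoint_family_on Bl G" if "G \<subseteq> K" for G
    using disj that by (auto simp: disjoint_family_on_def)
  \<comment> \<open>As \<open>r (1 - 2/p) = 2\<close>, the bounds for the block sums compare \<open>u\<^sup>2\<close> with \<open>s\<^bsup>1-2/p\<^esup>\<close>.\<close>
  have us: "(u k)\<^sup>2 \<le> s k powr (1 - 2 / p)" and su: "s k powr (1 - 2 / p) \<le> 2 * (u k)\<^sup>2" if k: "k \<in> K" for k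
  proof -
    have e: "(u k powr rexp p) powr (1 - 2 / p) = (u k)\<^sup>2"
      using u[OF k] by (simp add: powr_powr rexp_mult[OF p])
    have "(u k powr rexp p) powr (1 - 2 / p) \<le> s k powr (1 - 2 / p)"
      using lower[OF k] p unfolding s_def by (intro powr_mono2) auto
    then show "(u k)\<^sup>2 \<le> s k powr (1 - 2 / p)"
      by (simp only: e)
    have "s k powr (1 - 2 / p) \<le> (2 * u k powr rexp p) powr (1 - 2 / p)"
      using upper[OF k] p s0[OF k] unfolding s_def by (intro powr_mono2) auto
    also have "\<dots> = 2 powr (1 - 2 / p) * (u k)\<^sup>2"
      unfolding powr_mult e ..
    also have "\<dots> \<le> 2 powr 1 * (u k)\<^sup>2"
      using p by (intro mult_right_mono powr_mono) auto
    finally show "s k powr (1 - 2 / p) \<le> 2 * (u k)\<^sup>2"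
      by simp
  qed
  have i: "bounded_between (cell_space p K c' u) (cell_space p J c w) i"
  proof (rule cell_space_bounded[OF p0(1), of "2 powr (p / 2)"])
    fix F assume F: "F \<in> Fpow J"
    define G where "G = {k \<in> K. Bl k \<inter> F \<noteq> {}}"
    let ?U = "\<Union>k\<in>G. Bl k"
    have "G \<subseteq> \<kappa> ` F"
      using \<kappa> by (force simp: G_def)
    then have G: "finite G" "G \<subseteq> K"
      using F by (auto simp: Fpow_def G_def finite_subset)
    have fB: "finite (Bl k)" if "k \<in> G" for k
      using that G Bl by auto
    have "secn p c w F (i x) \<le> 2 powr (p / 2) * secn p c' u G x" for x
    proof -
      have "secn p c w F (i x) \<le> secn p c w ?U (i x)"
        using F p0 G fB by (intro secn_mono) (auto simp: Fpow_def i_def G_def)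
      moreover have "psum p ?U (i x) \<le> 2 powr (p / 2) * psum p G x"
      proof -
        have "psum p (Bl k) (i x) = \<bar>x k\<bar> powr p" if "k \<in> G" for k
        proof -
          have k: "k \<in> K" using that G by auto
          have "psum p (Bl k) (i x) = (\<Sum>j\<in>Bl k. \<bar>x k\<bar> powr p * inverse (s k) * w j powr rexp p)"
            unfolding psum_def
          proof (rule sum.cong[OF refl])
            fix j assume j: "j \<in> Bl k"
            have "\<bar>i x j\<bar> powr p = \<bar>x k\<bar> powr p * (s k powr (- (1 / p))) powr p * b j powr p"
              using b0[OF k j] by (simp add: ix[OF k j] abs_mult powr_mult)
            also have "(s k powr (- (1 / p))) powr p = inverse (s k)"
              using p0 s0[OF k] by (simp add: powr_powr inverse_eq_divide)
            finally show "\<bar>i x j\<bar> powr p = \<bar>x k\<bar> powr p * inverse (s k) * w j powr rexp p"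
              by (simp only: bw(1)[OF k j])
          qed
          also have "\<dots> = \<bar>x k\<bar> powr p * inverse (s k) * s k"
            by (simp add: sum_distrib_left s_def)
          finally show ?thesis
            using s0[OF k] by simp
        qed
        then have "psum p ?U (i x) = psum p G x"
          by (subst psum_UNION[OF G(1) fB disjG[OF G(2)]]) (auto simp: psum_def)
        also have "\<dots> \<le> 2 powr (p / 2) * psum p G x"
          using mult_right_mono[of 1 "2 powr (p / 2)" "psum p G x"] ge_one_powr_ge_zero[of 2 "p / 2"] p0
          by simp
        finally show ?thesis .
      qed
      moreover have "qsum p c w ?U (i x) \<le> 2 powr (p / 2) * qsum p c' u G x"
      proof -
        have bl: "(\<Sum>j\<in>Bl k. (w j * i x j)\<^sup>2) \<le> 2 * (u k * x k)\<^sup>2" if "k \<in> G" for k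
        proof -
          have k: "k \<in> K" using that G by auto
          have e: "(s k powr (- (1 / p)))\<^sup>2 * s k = s k powr (1 - 2 / p)"
          proof -
            have "(s k powr (- (1 / p)))\<^sup>2 * s k = s k powr (- (2 / p)) * s k powr 1"
              using s0[OF k] by (simp add: powr_power)
            also have "\<dots> = s k powr (- (2 / p) + 1)"
              by (simp only: powr_add)
            finally show ?thesis
              by simp
          qed
          have "(\<Sum>j\<in>Bl k. (w j * i x j)\<^sup>2) = (\<Sum>j\<in>Bl k. (x k)\<^sup>2 * (s k powr (- (1 / p)))\<^sup>2 * w j powr rexp p)"
          proof (rule sum.cong[OF refl])
            fix j assume j: "j \<in> Bl k"
            have "(w j * i x j)\<^sup>2 = (x k)\<^sup>2 * (s k powr (- (1 / p)))\<^sup>2 * (w j * b j)\<^sup>2"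
              by (simp add: ix[OF k j] power_mult_distrib)
            then show "(w j * i x j)\<^sup>2 = (x k)\<^sup>2 * (s k powr (- (1 / p)))\<^sup>2 * w j powr rexp p"
              by (simp only: bw(2)[OF k j])
          qed
          also have "\<dots> = (x k)\<^sup>2 * ((s k powr (- (1 / p)))\<^sup>2 * s k)"
            by (simp add: sum_distrib_left[symmetric] s_def)
          also have "\<dots> \<le> (x k)\<^sup>2 * (2 * (u k)\<^sup>2)"
            unfolding e by (intro mult_left_mono su k) auto
          finally show ?thesis
            by (simp add: power_mult_distrib algebra_simps)
        qed
        have "qsum p c w ?U (i x) =
            (\<Sum>i'\<in>c' ` G. (\<Sum>k | k \<in> G \<and> c' k = i'. \<Sum>j\<in>Bl k. (w j * i x j)\<^sup>2) powr (p / 2))"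
          using G cell inj by (intro qsum_UNION fB disjG) (auto intro: inj_on_subset)
        also have "\<dots> \<le> (\<Sum>i'\<in>c' ` G. (\<Sum>k | k \<in> G \<and> c' k = i'. 2 * (u k * x k)\<^sup>2) powr (p / 2))"
          using p0 by (intro sum_mono powr_mono2) (auto intro!: sum_nonneg sum_mono bl)
        also have "\<dots> = 2 powr (p / 2) * qsum p c' u G x"
          by (simp only: qsum_def sum_distrib_left[symmetric] powr_mult)
        finally show ?thesis .
      qed
      ultimately show ?thesis
        unfolding secn_def by (auto simp: max_mult_distrib_left)
    qed
    then show "\<exists>G\<in>Fpow K. \<forall>x. secn p c w F (i x) \<le> 2 powr (p / 2) * secn p c' u G x"
      using G by (intro bexI[of _ G]) (auto simp: Fpow_def)
  next
    fix x j assume "j \<notin> J"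
    then show "i x j = 0"
      using Bl(2) by (auto simp: i_def)
  qed (auto simp: i_def fun_eq_iff scaleR_fun_def algebra_simps)
  have q: "bounded_between (cell_space p J c w) (cell_space p K c' u) q"
  proof (rule cell_space_bounded[OF p0(1) zero_le_one])
    fix F assume F: "F \<in> Fpow K"
    let ?U = "\<Union>k\<in>F. Bl k"
    have F': "finite F" "F \<subseteq> K" and fB: "\<And>k. k \<in> F \<Longrightarrow> finite (Bl k)"
      using F Bl by (auto simp: Fpow_def)
    have "secn p c' u F (q y) \<le> 1 * secn p c w ?U y" for y
    proof -
      have "\<bar>q y k\<bar> powr p \<le> psum p (Bl k) y" if "k \<in> F" for k
      proof -
        have k: "k \<in> K" using that F' by auto
        have "\<bar>\<Sum>j\<in>Bl k. (w j)\<^sup>2 * b j * y j\<bar> \<le> (\<Sum>j\<in>Bl k. \<bar>((w j)\<^sup>2 * b j) * y j\<bar>)"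
          by (rule sum_abs)
        also have "\<dots> \<le> (\<Sum>j\<in>Bl k. \<bar>(w j)\<^sup>2 * b j\<bar> powr (p / (p - 1))) powr (1 / (p / (p - 1))) *
            (\<Sum>j\<in>Bl k. \<bar>y j\<bar> powr p) powr (1 / p)"
          using p Bl(1)[OF k] by (intro Hoelder_sum) (auto simp: field_simps)
        also have "(\<Sum>j\<in>Bl k. \<bar>(w j)\<^sup>2 * b j\<bar> powr (p / (p - 1))) = s k"
          unfolding s_def
        proof (rule sum.cong[OF refl])
          fix j assume j: "j \<in> Bl k"
          show "\<bar>(w j)\<^sup>2 * b j\<bar> powr (p / (p - 1)) = w j powr rexp p"
            using bw(4)[OF k j] b0[OF k j] by simp
        qed
        also have "1 / (p / (p - 1)) = 1 - 1 / p"
          using p by (simp add: field_simps)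
        finally have "\<bar>q y k\<bar> \<le> s k powr (1 / p - 1) * (s k powr (1 - 1 / p) * psum p (Bl k) y powr (1 / p))"
          using k by (auto simp: q_def abs_mult psum_def intro!: mult_left_mono)
        also have "\<dots> = psum p (Bl k) y powr (1 / p)"
          using s0[OF k] by (simp add: powr_add[symmetric] mult.assoc[symmetric])
        finally have "\<bar>q y k\<bar> powr p \<le> (psum p (Bl k) y powr (1 / p)) powr p"
          using p0 by (intro powr_mono2) auto
        then show ?thesis
          using p0 by (simp add: powr_powr)
      qed
      then have "psum p F (q y) \<le> (\<Sum>k\<in>F. psum p (Bl k) y)"
        unfolding psum_def[of p F] by (intro sum_mono)
      also have "\<dots> = psum p ?U y"
        by (rule psum_UNION[OF F'(1) fB disjG[OF F'(2)], symmetric])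
      finally have "psum p F (q y) \<le> psum p ?U y" .
      moreover have "qsum p c' u F (q y) \<le> qsum p c w ?U y"
      proof -
        have bl: "(u k * q y k)\<^sup>2 \<le> (\<Sum>j\<in>Bl k. (w j * y j)\<^sup>2)" if "k \<in> F" for k
        proof -
          have k: "k \<in> K" using that F' by auto
          have e: "(s k powr (1 / p - 1))\<^sup>2 * (s k powr (1 - 2 / p) * s k) = 1"
          proof -
            have "(s k powr (1 / p - 1))\<^sup>2 * (s k powr (1 - 2 / p) * s k) =
                s k powr (2 / p - 2) * (s k powr (1 - 2 / p) * s k powr 1)"
              using s0[OF k] by (simp add: powr_power left_diff_distrib)
            also have "\<dots> = s k powr (2 / p - 2 + (1 - 2 / p + 1))"
              by (simp only: powr_add)
            finally show ?thesis
              using s0[OF k] by simp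
          qed
          have "(\<Sum>j\<in>Bl k. (w j)\<^sup>2 * b j * y j)\<^sup>2 = (\<Sum>j\<in>Bl k. (w j * b j) * (w j * y j))\<^sup>2"
            by (simp add: power2_eq_square algebra_simps)
          also have "\<dots> \<le> (\<Sum>j\<in>Bl k. (w j * b j)\<^sup>2) * (\<Sum>j\<in>Bl k. (w j * y j)\<^sup>2)"
            by (rule Cauchy_Schwarz_ineq_sum)
          also have "(\<Sum>j\<in>Bl k. (w j * b j)\<^sup>2) = s k"
            unfolding s_def by (intro sum.cong refl bw(2)[OF k])
          finally have cs: "(\<Sum>j\<in>Bl k. (w j)\<^sup>2 * b j * y j)\<^sup>2 \<le> s k * (\<Sum>j\<in>Bl k. (w j * y j)\<^sup>2)" .
          have "(u k * q y k)\<^sup>2 = (s k powr (1 / p - 1))\<^sup>2 * ((u k)\<^sup>2 * (\<Sum>j\<in>Bl k. (w j)\<^sup>2 * b j * y j)\<^sup>2)"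
            using k by (simp add: q_def power_mult_distrib)
          also have "\<dots> \<le> (s k powr (1 / p - 1))\<^sup>2 * (s k powr (1 - 2 / p) * (s k * (\<Sum>j\<in>Bl k. (w j * y j)\<^sup>2)))"
            using cs us[OF k] by (intro mult_left_mono mult_mono) auto
          also have "\<dots> = (s k powr (1 / p - 1))\<^sup>2 * (s k powr (1 - 2 / p) * s k) * (\<Sum>j\<in>Bl k. (w j * y j)\<^sup>2)"
            by (simp only: mult.assoc)
          finally show ?thesis
            unfolding e by simp
        qed
        have "qsum p c' u F (q y) \<le>
            (\<Sum>i'\<in>c' ` F. (\<Sum>k | k \<in> F \<and> c' k = i'. \<Sum>j\<in>Bl k. (w j * y j)\<^sup>2) powr (p / 2))"
          unfolding qsum_def using p0
          by (intro sum_mono powr_mono2) (auto intro!: sum_nonneg sum_mono bl)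
        also have "\<dots> = qsum p c w ?U y"
          using F' cell inj by (intro qsum_UNION[symmetric] fB disjG) (auto intro: inj_on_subset)
        finally show ?thesis .
      qed
      ultimately show ?thesis
        by (auto simp: secn_def)
    qed
    then show "\<exists>G\<in>Fpow J. \<forall>y. secn p c' u F (q y) \<le> 1 * secn p c w G y"
    proof (intro bexI[of _ ?U])
      show "?U \<in> Fpow J"
        using F' fB Bl(2) unfolding Fpow_def by blast
    qed blast
  qed (auto simp: q_def fun_eq_iff scaleR_fun_def algebra_simps sum.distrib sum_distrib_left)
  have "q (i x) = x" if x: "x \<in> vecs (cell_space p K c' u)" for x
  proof
    fix k
    show "q (i x) k = x k"
    proof (cases "k \<in> K")
      case True
      have "(\<Sum>j\<in>Bl k. (w j)\<^sup>2 * b j * i x j) = (\<Sum>j\<in>Bl k. x k * s k powr (- (1 / p)) * w j powr rexp p)"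
      proof (rule sum.cong[OF refl])
        fix j assume j: "j \<in> Bl k"
        have "(w j)\<^sup>2 * b j * i x j = x k * s k powr (- (1 / p)) * ((w j)\<^sup>2 * b j * b j)"
          by (simp add: ix[OF True j])
        then show "(w j)\<^sup>2 * b j * i x j = x k * s k powr (- (1 / p)) * w j powr rexp p"
          by (simp only: bw(3)[OF True j])
      qed
      also have "\<dots> = x k * s k powr (- (1 / p)) * s k powr 1"
        using s0[OF True] by (simp add: sum_distrib_left[symmetric] s_def)
      finally have "q (i x) k = x k * (s k powr (1 / p - 1) * s k powr (- (1 / p)) * s k powr 1)"
        using True by (simp add: q_def)
      also have "s k powr (1 / p - 1) * s k powr (- (1 / p)) * s k powr 1 = 1"
        using s0[OF True] by (simp only: powr_add[symmetric]) simp
      finally show ?thesis by simp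
    qed (use x in \<open>auto simp: q_def dest!: cell_space_off\<close>)
  qed
  with i q show ?thesis
    unfolding complemented_def by blast
qed

text \<open>The sets are chosen one after the other; those already chosen occupy the finite set \<open>Z\<close>.\<close>

lemma disjoint_choice:
  fixes P :: "'k \<Rightarrow> 'a set \<Rightarrow> bool"
  assumes "countable K"
    and ex: "\<And>k Z. k \<in> K \<Longrightarrow> finite Z \<Longrightarrow> \<exists>F. finite F \<and> F \<inter> Z = {} \<and> P k F"
  obtains Bl where "\<And>k. k \<in> K \<Longrightarrow> finite (Bl k)" "\<And>k. k \<in> K \<Longrightarrow> P k (Bl k)" "disjoint_family_on Bl K"
proof -
  let ?k = "from_nat_into K" and ?N = "to_nat_on K ` K"
  have kK: "?k n \<in> K" if "n \<in> ?N" for n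
    using that by (metis assms(1) from_nat_into_to_nat_on imageE)
  have "\<exists>f. \<forall>n. (finite (fst (f n)) \<and> finite (snd (f n)) \<and> fst (f n) \<subseteq> snd (f n) \<and>
                 (n \<in> ?N \<longrightarrow> P (?k n) (fst (f n)))) \<and>
                (fst (f (Suc n)) \<inter> snd (f n) = {} \<and> snd (f n) \<subseteq> snd (f (Suc n)))"
  proof (rule dependent_nat_choice)
    show "\<exists>x. finite (fst x) \<and> finite (snd x) \<and> fst x \<subseteq> snd x \<and> (0 \<in> ?N \<longrightarrow> P (?k 0) (fst x))"
    proof (cases "0 \<in> ?N")
      case True
      then have "?k 0 \<in> K"
        by (rule kK)
      then obtain F where "finite F" "P (?k 0) F"
        using ex[of "?k 0" "{}"] by auto
      then show ?thesis
        by (intro exI[of _ "(F, F)"]) auto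
    next
      case False
      then show ?thesis
        by (intro exI[of _ "({}, {})"]) auto
    qed
  next
    fix x :: "'a set \<times> 'a set" and n
    assume x: "finite (fst x) \<and> finite (snd x) \<and> fst x \<subseteq> snd x \<and> (n \<in> ?N \<longrightarrow> P (?k n) (fst x))"
    show "\<exists>y. (finite (fst y) \<and> finite (snd y) \<and> fst y \<subseteq> snd y \<and>
               (Suc n \<in> ?N \<longrightarrow> P (?k (Suc n)) (fst y))) \<and>
              fst y \<inter> snd x = {} \<and> snd x \<subseteq> snd y"
    proof (cases "Suc n \<in> ?N")
      case True
      then have "?k (Suc n) \<in> K"
        by (rule kK)
      then obtain F where "finite F" "F \<inter> snd x = {}" "P (?k (Suc n)) F"
        using ex[of "?k (Suc n)" "snd x"] x by auto
      then show ?thesis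
        using x by (intro exI[of _ "(F, snd x \<union> F)"]) auto
    next
      case False
      then show ?thesis
        using x by (intro exI[of _ "({}, snd x)"]) auto
    qed
  qed
  then obtain f where f: "\<And>n. finite (fst (f n))" "\<And>n. fst (f n) \<subseteq> snd (f n)"
    "\<And>n. n \<in> ?N \<Longrightarrow> P (?k n) (fst (f n))"
    "\<And>n. fst (f (Suc n)) \<inter> snd (f n) = {}" "\<And>n. snd (f n) \<subseteq> snd (f (Suc n))"
    by blast
  have mono: "snd (f m) \<subseteq> snd (f n)" if "m \<le> n" for m n
    using lift_Suc_mono_le[of "\<lambda>n. snd (f n)", OF f(5) that] .
  have dis: "fst (f m) \<inter> fst (f n) = {}" if mn: "m < n" for m n
  proof -
    obtain l where l: "n = Suc l" "m \<le> l"
      using mn by (cases n) auto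
    show ?thesis
      using f(2)[of m] mono[OF l(2)] f(4)[of l] unfolding l(1) by blast
  qed
  show thesis
  proof (rule that[of "\<lambda>k. fst (f (to_nat_on K k))"])
    show "P k (fst (f (to_nat_on K k)))" if "k \<in> K" for k
      using f(3)[of "to_nat_on K k"] that assms(1) by auto
    have "fst (f (to_nat_on K k)) \<inter> fst (f (to_nat_on K l)) = {}" if "k \<in> K" "l \<in> K" "k \<noteq> l" for k l
    proof -
      have "to_nat_on K k \<noteq> to_nat_on K l"
        using that inj_on_to_nat_on[OF assms(1)] by (auto simp: inj_on_def)
      then show ?thesis
        using dis[of "to_nat_on K k" "to_nat_on K l"] dis[of "to_nat_on K l" "to_nat_on K k"] by (metis Int_commute linorder_neqE_nat)
    qed
    then show "disjoint_family_on (\<lambda>k. fst (f (to_nat_on K k))) K"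
      unfolding disjoint_family_on_def by blast
  qed (rule f(1))
qed

text \<open>
  From a cell that is rich at level \<open>s\<close>, infinitely many disjoint blocks can be cut out that behave,
  up to a factor 2, like a coordinate with \<open>w\<^sup>r = s\<close>.
\<close>

definition rich :: "real \<Rightarrow> 'a set \<Rightarrow> ('a \<Rightarrow> 'b) \<Rightarrow> ('a \<Rightarrow> real) \<Rightarrow> 'b \<Rightarrow> real \<Rightarrow> bool" where
  "rich p J c w i s \<longleftrightarrow>
     \<not> (\<lambda>j. w j powr rexp p) summable_on {j. j \<in> J \<and> c j = i \<and> w j powr rexp p \<le> s}"

lemma rich_block:
  assumes "rich p J c w i s" "0 < s" "finite Z"
  shows "\<exists>F. finite F \<and> F \<inter> Z = {} \<and> F \<subseteq> J \<and> (\<forall>j\<in>F. c j = i) \<and>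
             s \<le> (\<Sum>j\<in>F. w j powr rexp p) \<and> (\<Sum>j\<in>F. w j powr rexp p) \<le> 2 * s"
proof -
  let ?f = "\<lambda>j. w j powr rexp p"
  define E where "E = {j. j \<in> J \<and> c j = i \<and> ?f j \<le> s} - Z"
  have E: "\<not> ?f summable_on E"
  proof
    assume "?f summable_on E"
    moreover have "?f summable_on ({j. j \<in> J \<and> c j = i \<and> ?f j \<le> s} \<inter> Z)"
      using assms(3) by (intro summable_on_finite) auto
    ultimately have "?f summable_on (E \<union> ({j. j \<in> J \<and> c j = i \<and> ?f j \<le> s} \<inter> Z))"
      by (rule summable_on_Un_disjoint) (auto simp: E_def)
    also have "E \<union> ({j. j \<in> J \<and> c j = i \<and> ?f j \<le> s} \<inter> Z) = {j. j \<in> J \<and> c j = i \<and> ?f j \<le> s}"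
      by (auto simp: E_def)
    finally show False
      using assms(1) by (simp add: rich_def)
  qed
  have ex: "\<exists>F. finite F \<and> F \<subseteq> E \<and> s \<le> sum ?f F"
  proof (rule ccontr)
    assume "\<not> ?thesis"
    then have "sum ?f F \<le> s" if "finite F" "F \<subseteq> E" for F
      using that by (meson linear)
    then have "?f summable_on E"
      by (intro nonneg_bdd_above_summable_on) (auto intro!: bdd_aboveI2)
    with E show False ..
  qed
  \<comment> \<open>A block of least cardinality falls below \<open>s\<close> when one of its points, worth at most \<open>s\<close>, is removed.\<close>
  define m where "m = (LEAST m. \<exists>F. finite F \<and> F \<subseteq> E \<and> s \<le> sum ?f F \<and> card F = m)"
  have "\<exists>F. finite F \<and> F \<subseteq> E \<and> s \<le> sum ?f F \<and> card F = m"
    unfolding m_def by (rule LeastI_ex) (use ex in blast)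
  then obtain F where F: "finite F" "F \<subseteq> E" "s \<le> sum ?f F" "card F = m"
    by blast
  have "F \<noteq> {}"
    using F(3) assms(2) by auto
  then obtain a where a: "a \<in> F" by blast
  have "sum ?f (F - {a}) < s"
  proof (rule ccontr)
    assume "\<not> ?thesis"
    then have "m \<le> card (F - {a})"
      unfolding m_def by (intro Least_le exI[of _ "F - {a}"]) (use F in auto)
    then show False
      using F(1,4) a card_Diff1_less[of F a] by simp
  qed
  moreover have "?f a \<le> s"
    using a F(2) by (auto simp: E_def)
  moreover have "sum ?f F = ?f a + sum ?f (F - {a})"
    using F(1) a by (rule sum.remove)
  ultimately show ?thesis
    using F by (intro exI[of _ F]) (auto simp: E_def)
qed

lemma rich_complemented:
  fixes J :: "'j set"
  assumes p: "2 < p" and K: "countable K" and inj: "inj_on \<phi> (c' ` K)"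
    and w: "\<And>j. j \<in> J \<Longrightarrow> 0 < w j" and u: "\<And>k. k \<in> K \<Longrightarrow> 0 < u k"
    and rich: "\<And>k. k \<in> K \<Longrightarrow> rich p J c w (\<phi> (c' k)) (u k powr rexp p)"
  shows "cell_space p K c' u \<unlhd>\<^sub>B cell_space p J c w"
proof -
  let ?P = "\<lambda>k F. F \<subseteq> J \<and> (\<forall>j\<in>F. c j = \<phi> (c' k)) \<and> u k powr rexp p \<le> (\<Sum>j\<in>F. w j powr rexp p) \<and>
      (\<Sum>j\<in>F. w j powr rexp p) \<le> 2 * u k powr rexp p"
  obtain Bl where Bl: "\<And>k. k \<in> K \<Longrightarrow> finite (Bl k)" "\<And>k. k \<in> K \<Longrightarrow> ?P k (Bl k)" "disjoint_family_on Bl K"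
  proof (rule disjoint_choice[OF K, of ?P])
    fix k and Z :: "'j set" assume k: "k \<in> K" and Z: "finite Z"
    have "0 < u k powr rexp p"
      using u[OF k] by simp
    from rich_block[OF rich[OF k] this Z] show "\<exists>F. finite F \<and> F \<inter> Z = {} \<and> ?P k F" .
  qed blast
  show ?thesis
    by (rule blocks_complemented[OF p Bl(1) _ Bl(3) w u _ inj]) (use Bl(2) in blast)+
qed

text \<open>Among the copies of a space numbered by \<open>\<nat>\<close>, number 0 splits off and the others are renumbered.\<close>

lemma cell_space_times_nat:
  assumes p: "1 \<le> p"
    and d0: "\<And>k l. k \<in> K \<Longrightarrow> l \<in> K \<Longrightarrow> d (k, 0::nat) = d (l, 0) \<longleftrightarrow> c k = c l"
    and dS: "\<And>k l m n. k \<in> K \<Longrightarrow> l \<in> K \<Longrightarrow> d (k, Suc m) = d (l, Suc n) \<longleftrightarrow> d (k, m) = d (l, n)"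
  shows "cell_space p (K \<times> UNIV) d (\<lambda>z. u (fst z)) \<cong>\<^sub>B
         cell_space p (K \<times> UNIV) d (\<lambda>z. u (fst z)) \<oplus>\<^sub>B cell_space p K c u"
proof -
  let ?C = "\<lambda>J. cell_space p J d (\<lambda>z. u (fst z))"
  have p0: "0 < p" using p by simp
  note n = normed_cell_space[OF p]
  have U: "K \<times> UNIV = K \<times> range Suc \<union> K \<times> {0}"
    using UNIV_nat_eq by (auto simp: Sigma_Un_distrib2[symmetric])
  have 1: "?C (K \<times> UNIV) \<cong>\<^sub>B ?C (K \<times> range Suc) \<oplus>\<^sub>B ?C (K \<times> {0})"
    by (subst U) (rule cell_space_split[OF p], auto)
  have 2: "?C (K \<times> UNIV) \<cong>\<^sub>B ?C (K \<times> range Suc)"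
    by (rule cell_space_reindex[OF p0, of "\<lambda>(k, n). (k, Suc n)"])
       (auto simp: bij_betw_def inj_on_def dS)
  have 3: "cell_space p K c u \<cong>\<^sub>B ?C (K \<times> {0})"
    by (rule cell_space_reindex[OF p0, of "\<lambda>k. (k, 0)"])
       (auto simp: bij_betw_def inj_on_def d0)
  show ?thesis
    by (rule lin_iso_trans[OF 1 lin_iso_sym[OF lin_iso_dsum_cong[OF 2 3 n n n n]] normed_dsum[OF n n]])
qed

text \<open>
  Both ways of forming countably many copies are needed: copies in separate cells give
  \<open>\<ell>\<^sub>p\<close>-sums, copies inside the same cell serve the spaces \<open>X\<^sub>p\<close>.
\<close>

lemma absorbs_separate:
  assumes "1 \<le> p" "normed W"
    and "cell_space p (K \<times> (UNIV::nat set)) (\<lambda>z. (c (fst z), snd z)) (\<lambda>z. u (fst z)) \<unlhd>\<^sub>B W"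
  shows "W \<cong>\<^sub>B W \<oplus>\<^sub>B cell_space p K c u"
  using assms(1,2)
  by (intro complemented_absorbs[OF assms(3)] cell_space_times_nat normed_cell_space) auto

lemma absorbs_same:
  assumes "1 \<le> p" "normed W"
    and "cell_space p (K \<times> (UNIV::nat set)) (\<lambda>z. c (fst z)) (\<lambda>z. u (fst z)) \<unlhd>\<^sub>B W"
  shows "W \<cong>\<^sub>B W \<oplus>\<^sub>B cell_space p K c u"
  using assms(1,2)
  by (intro complemented_absorbs[OF assms(3)] cell_space_times_nat normed_cell_space) auto

section \<open>Rosenthal's inequality for sums of independent three-valued variables\<close>

lemma powr_tangent:
  fixes x y p :: real
  assumes "1 \<le> p" "0 \<le> x" "x \<le> y"
  shows "y powr p - x powr p \<le> p * y powr (p - 1) * (y - x)"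
    and "p * x powr (p - 1) * (y - x) \<le> y powr p - x powr p"
proof -
  consider "x = y" | "x = 0" "0 < y" | "0 < x" "x < y"
    using assms by linarith
  then have "y powr p - x powr p \<le> p * y powr (p - 1) * (y - x) \<and>
      p * x powr (p - 1) * (y - x) \<le> y powr p - x powr p"
  proof cases
    case 2
    have "y powr p = y powr (p - 1) * y"
      using 2 by (simp add: powr_diff)
    then have "y powr p \<le> p * (y powr (p - 1) * y)"
      using assms(1) 2 mult_right_mono[of 1 p "y powr (p - 1) * y"] by simp
    then show ?thesis
      using 2 assms(1) by (simp add: mult.assoc)
  next
    case 3
    have "\<exists>z>x. z < y \<and> y powr p - x powr p = (y - x) * (p * z powr (p - 1))"
      using 3 by (intro MVT2) (auto intro!: has_real_derivative_powr)
    then obtain z where z: "x < z" "z < y" "y powr p - x powr p = (y - x) * (p * z powr (p - 1))"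
      by blast
    have "(y - x) * (p * z powr (p - 1)) \<le> (y - x) * (p * y powr (p - 1))"
      using 3 z assms(1) by (intro mult_left_mono powr_mono2) auto
    moreover have "(y - x) * (p * x powr (p - 1)) \<le> (y - x) * (p * z powr (p - 1))"
      using 3 z assms(1) by (intro mult_left_mono powr_mono2) auto
    ultimately show ?thesis
      by (simp add: z(3) mult_ac)
  qed auto
  then show "y powr p - x powr p \<le> p * y powr (p - 1) * (y - x)"
    and "p * x powr (p - 1) * (y - x) \<le> y powr p - x powr p"
    by auto
qed

lemma self_bound_powr:
  fixes A g \<theta> :: real
  assumes "0 \<le> A" "0 \<le> g" "A \<le> g * A powr (1 - \<theta>)"
  shows "A powr \<theta> \<le> g"
proof (cases "A = 0")
  case False
  then have "0 < A"
    using assms by simp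
  then have "A powr \<theta> * A powr (1 - \<theta>) \<le> g * A powr (1 - \<theta>)"
    using assms(3) by (simp add: powr_add[symmetric])
  then show ?thesis
    using \<open>0 < A\<close> by simp
qed (use assms in auto)

lemma abs_plus_minus_cases:
  fixes s a :: real
  obtains "\<bar>s + a\<bar> = \<bar>s\<bar> + \<bar>a\<bar>" "\<bar>s - a\<bar> = \<bar>\<bar>s\<bar> - \<bar>a\<bar>\<bar>"
  | "\<bar>s - a\<bar> = \<bar>s\<bar> + \<bar>a\<bar>" "\<bar>s + a\<bar> = \<bar>\<bar>s\<bar> - \<bar>a\<bar>\<bar>"
proof -
  have "\<bar>s + a\<bar> = \<bar>s\<bar> + \<bar>a\<bar> \<and> \<bar>s - a\<bar> = \<bar>\<bar>s\<bar> - \<bar>a\<bar>\<bar> \<or>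
        \<bar>s - a\<bar> = \<bar>s\<bar> + \<bar>a\<bar> \<and> \<bar>s + a\<bar> = \<bar>\<bar>s\<bar> - \<bar>a\<bar>\<bar>"
    by (simp add: abs_if)
  with that show thesis by blast
qed

text \<open>The second difference of \<open>\<bar>t\<bar>\<^sup>p\<close>: of second order for small steps, of order \<open>p\<close> for large ones.\<close>

lemma powr_second_difference:
  fixes s a p :: real
  assumes p: "2 < p"
  shows "\<bar>s + a\<bar> powr p + \<bar>s - a\<bar> powr p - 2 * \<bar>s\<bar> powr p \<le>
    2 * (p * (p - 1) * 2 powr p) * (a\<^sup>2 * \<bar>s\<bar> powr (p - 2) + \<bar>a\<bar> powr p)"
proof -
  let ?s = "\<bar>s\<bar>" and ?a = "\<bar>a\<bar>"
  let ?K = "p * (p - 1) * 2 powr p"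
  have K: "2 powr p \<le> ?K"
  proof -
    have "1 * 1 \<le> p * (p - 1)"
      using p by (intro mult_mono) auto
    then show ?thesis
      using mult_right_mono[of 1 "p * (p - 1)" "2 powr p"] by simp
  qed
  have eq: "\<bar>s + a\<bar> powr p + \<bar>s - a\<bar> powr p = (?s + ?a) powr p + \<bar>?s - ?a\<bar> powr p"
    by (rule abs_plus_minus_cases[of s a]) simp_all
  show ?thesis
  proof (cases "?a \<le> ?s")
    case True
    have "(?s + ?a) powr p - ?s powr p \<le> p * (?s + ?a) powr (p - 1) * ?a"
      using powr_tangent(1)[of p ?s "?s + ?a"] p by simp
    moreover have "p * (?s - ?a) powr (p - 1) * ?a \<le> ?s powr p - (?s - ?a) powr p"
      using powr_tangent(2)[of p "?s - ?a" ?s] p True by simp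
    ultimately have "(?s + ?a) powr p + (?s - ?a) powr p - 2 * ?s powr p \<le>
        p * ?a * ((?s + ?a) powr (p - 1) - (?s - ?a) powr (p - 1))"
      by (simp add: algebra_simps)
    also have "\<dots> \<le> p * ?a * ((p - 1) * (?s + ?a) powr (p - 1 - 1) * ((?s + ?a) - (?s - ?a)))"
      using p True by (intro mult_left_mono powr_tangent(1)) auto
    also have "(?s + ?a) - (?s - ?a) = 2 * ?a"
      by simp
    also have "p * ?a * ((p - 1) * (?s + ?a) powr (p - 1 - 1) * (2 * ?a)) =
        2 * (p * (p - 1)) * (?a * ?a) * (?s + ?a) powr (p - 1 - 1)"
      by (simp only: mult_ac)
    also have "?a * ?a = a\<^sup>2"
      by (simp add: power2_eq_square)
    also have "p - 1 - 1 = p - 2"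
      by simp
    also have "2 * (p * (p - 1)) * a\<^sup>2 * (?s + ?a) powr (p - 2) \<le>
        2 * (p * (p - 1)) * a\<^sup>2 * (2 powr p * ?s powr (p - 2))"
    proof -
      have "(?s + ?a) powr (p - 2) \<le> (2 * ?s) powr (p - 2)"
        using p True by (intro powr_mono2) auto
      also have "\<dots> = 2 powr (p - 2) * ?s powr (p - 2)"
        by (rule powr_mult)
      also have "\<dots> \<le> 2 powr p * ?s powr (p - 2)"
        by (intro mult_right_mono powr_mono) auto
      finally show ?thesis
        using p by (intro mult_left_mono) auto
    qed
    also have "\<dots> = 2 * ?K * (a\<^sup>2 * ?s powr (p - 2))"
      by (simp only: mult_ac)
    also have "\<dots> \<le> 2 * ?K * (a\<^sup>2 * ?s powr (p - 2) + ?a powr p)"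
      using p by (intro mult_left_mono) auto
    finally show ?thesis
      using True by (simp add: eq)
  next
    case False
    have "(?s + ?a) powr p \<le> (2 * ?a) powr p" "\<bar>?s - ?a\<bar> powr p \<le> (2 * ?a) powr p"
      using p False by (auto intro!: powr_mono2)
    then have "(?s + ?a) powr p + \<bar>?s - ?a\<bar> powr p - 2 * ?s powr p \<le> 2 * (2 powr p * ?a powr p)"
      using powr_ge_zero[of ?s p] unfolding powr_mult[symmetric] by linarith
    also have "\<dots> \<le> 2 * (?K * ?a powr p)"
      using K by (intro mult_left_mono mult_right_mono) auto
    also have "\<dots> = 2 * ?K * (?a powr p)"
      by (simp only: mult_ac)
    also have "\<dots> \<le> 2 * ?K * (a\<^sup>2 * ?s powr (p - 2) + ?a powr p)"
      using p by (intro mult_left_mono) auto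
    finally show ?thesis
      by (simp only: eq)
  qed
qed

lemma powr_add_subadditive:
  fixes x y \<theta> :: real
  assumes "0 \<le> x" "0 \<le> y" "0 < \<theta>" "\<theta> \<le> 1"
  shows "(x + y) powr \<theta> \<le> x powr \<theta> + y powr \<theta>"
proof (cases "x + y = 0")
  case False
  then have xy: "0 < x + y"
    using assms by simp
  have "z / (x + y) \<le> (z / (x + y)) powr \<theta>" if "0 \<le> z" "z \<le> x + y" for z
    using powr_mono'[of \<theta> 1 "z / (x + y)"] that xy assms by (simp add: divide_le_eq_1)
  from this[of x] this[of y] have "x / (x + y) + y / (x + y) \<le> (x / (x + y)) powr \<theta> + (y / (x + y)) powr \<theta>"
    using assms by (intro add_mono) auto
  moreover have "x / (x + y) + y / (x + y) = 1"
    using xy by (simp add: add_divide_distrib[symmetric])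
  ultimately have "1 \<le> (x powr \<theta> + y powr \<theta>) / (x + y) powr \<theta>"
    by (simp add: powr_divide add_divide_distrib)
  then show ?thesis
    using xy by (simp add: le_divide_eq)
qed simp

lemma powr_midpoint_le:
  fixes s a q :: real
  assumes "0 < q" "q \<le> 2"
  shows "\<bar>s + a\<bar> powr q + \<bar>s - a\<bar> powr q \<le> 2 * (\<bar>s\<bar> powr q + \<bar>a\<bar> powr q)"
proof -
  let ?u = "\<bar>s + a\<bar> powr q" and ?v = "\<bar>s - a\<bar> powr q"
  have sq: "\<bar>t\<bar> powr q = (t\<^sup>2) powr (q / 2)" for t :: real
    using powr_powr[of "\<bar>t\<bar>" 2 "q / 2"] by simp
  have q2: "(\<bar>t\<bar> powr q) powr (2 / q) = t\<^sup>2" for t :: real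
    using assms by (simp add: powr_powr)
  have "(1 / 2 * ?u + 1 / 2 * ?v) powr (2 / q) \<le> 1 / 2 * ?u powr (2 / q) + 1 / 2 * ?v powr (2 / q)"
    using assms by (intro powr_add_convex) auto
  also have "\<dots> = s\<^sup>2 + a\<^sup>2"
    unfolding q2 by (simp add: power2_eq_square algebra_simps)
  finally have "((1 / 2 * ?u + 1 / 2 * ?v) powr (2 / q)) powr (q / 2) \<le> (s\<^sup>2 + a\<^sup>2) powr (q / 2)"
    using assms by (intro powr_mono2) auto
  also have "\<dots> \<le> (s\<^sup>2) powr (q / 2) + (a\<^sup>2) powr (q / 2)"
    using assms by (intro powr_add_subadditive) auto
  finally have "1 / 2 * ?u + 1 / 2 * ?v \<le> \<bar>s\<bar> powr q + \<bar>a\<bar> powr q"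
    using assms by (simp add: powr_powr sq)
  then show ?thesis by simp
qed

lemma powr_midpoint_ge:
  fixes s a p :: real
  assumes "1 \<le> p"
  shows "2 * \<bar>s\<bar> powr p \<le> \<bar>s + a\<bar> powr p + \<bar>s - a\<bar> powr p"
proof -
  have "\<bar>s\<bar> \<le> 1 / 2 * \<bar>s + a\<bar> + 1 / 2 * \<bar>s - a\<bar>"
    using abs_triangle_ineq[of "s + a" "s - a"] by (simp add: abs_mult)
  then have "\<bar>s\<bar> powr p \<le> (1 / 2 * \<bar>s + a\<bar> + 1 / 2 * \<bar>s - a\<bar>) powr p"
    using assms by (intro powr_mono2) auto
  also have "\<dots> \<le> 1 / 2 * \<bar>s + a\<bar> powr p + 1 / 2 * \<bar>s - a\<bar> powr p"
    using assms by (intro powr_add_convex) auto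
  finally show ?thesis by simp
qed

text \<open>
  The probability space of independent variables \<open>\<xi>\<^sub>j\<close> that take the values \<open>1\<close> and \<open>-1\<close> with probability
  \<open>d\<^sub>j/2\<close> each and are \<open>0\<close> otherwise, is finite; \<open>expec\<close> is its expectation and \<open>tsum\<close> a linear combination of the
  variables.
\<close>

definition states :: "'a set \<Rightarrow> ('a \<Rightarrow> real) set" where
  "states F = (\<Pi>\<^sub>E j\<in>F. {-1, 0, 1})"

definition prob_of :: "('a \<Rightarrow> real) \<Rightarrow> 'a set \<Rightarrow> ('a \<Rightarrow> real) \<Rightarrow> real" where
  "prob_of d F \<xi> = (\<Prod>j\<in>F. if \<xi> j = 0 then 1 - d j else d j / 2)"

definition expec :: "('a \<Rightarrow> real) \<Rightarrow> 'a set \<Rightarrow> (('a \<Rightarrow> real) \<Rightarrow> real) \<Rightarrow> real" where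
  "expec d F h = (\<Sum>\<xi>\<in>states F. prob_of d F \<xi> * h \<xi>)"

definition tsum :: "'a set \<Rightarrow> ('a \<Rightarrow> real) \<Rightarrow> ('a \<Rightarrow> real) \<Rightarrow> real" where
  "tsum F a \<xi> = (\<Sum>j\<in>F. a j * \<xi> j)"

lemma finite_states: "finite F \<Longrightarrow> finite (states F)"
  by (simp add: states_def finite_PiE)

lemma prob_of_nonneg: "(\<And>j. j \<in> F \<Longrightarrow> 0 \<le> d j \<and> d j \<le> 1) \<Longrightarrow> 0 \<le> prob_of d F \<xi>"
  by (auto simp: prob_of_def intro!: prod_nonneg)

lemma expec_insert:
  assumes "finite F" "a \<notin> F"
  shows "expec d (insert a F) h =
    (1 - d a) * expec d F (\<lambda>\<xi>. h (\<xi>(a := 0))) +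
    d a / 2 * (expec d F (\<lambda>\<xi>. h (\<xi>(a := 1))) + expec d F (\<lambda>\<xi>. h (\<xi>(a := -1))))"
proof -
  let ?T = "{-1, 0, 1::real}"
  let ?m = "\<lambda>y. if y = 0 then 1 - d a else d a / 2"
  have inj: "inj_on (\<lambda>(y, g). g(a := y)) (?T \<times> states F)"
    unfolding states_def using inj_combinator[OF assms(2)] by fastforce
  have pr: "prob_of d (insert a F) (\<xi>(a := y)) = ?m y * prob_of d F \<xi>" for y \<xi>
  proof -
    have "(\<Prod>j\<in>F. if (\<xi>(a := y)) j = 0 then 1 - d j else d j / 2) = prob_of d F \<xi>"
      unfolding prob_of_def using assms(2) by (intro prod.cong) auto
    then show ?thesis
      using assms by (simp add: prob_of_def)
  qed
  have st: "states (insert a F) = (\<lambda>(y, g). g(a := y)) ` (?T \<times> states F)"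
    unfolding states_def PiE_insert_eq ..
  have "expec d (insert a F) h = (\<Sum>(y, \<xi>)\<in>?T \<times> states F. ?m y * (prob_of d F \<xi> * h (\<xi>(a := y))))"
    unfolding expec_def st sum.reindex[OF inj]
    by (intro sum.cong refl) (auto simp: pr simp del: fun_upd_apply)
  also have "\<dots> = (\<Sum>y\<in>?T. ?m y * expec d F (\<lambda>\<xi>. h (\<xi>(a := y))))"
    by (simp only: sum.cartesian_product[symmetric] expec_def sum_distrib_left)
  finally show ?thesis
    by (simp add: algebra_simps)
qed

lemma expec_add: "expec d F (\<lambda>\<xi>. f \<xi> + g \<xi>) = expec d F f + expec d F g"
  by (simp add: expec_def sum.distrib distrib_left)

lemma expec_scale: "expec d F (\<lambda>\<xi>. b * f \<xi>) = b * expec d F f"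
  by (simp add: expec_def sum_distrib_left mult_ac)

lemma expec_mono:
  assumes "\<And>j. j \<in> F \<Longrightarrow> 0 \<le> d j \<and> d j \<le> 1" "\<And>\<xi>. f \<xi> \<le> g \<xi>"
  shows "expec d F f \<le> expec d F g"
  unfolding expec_def using assms by (intro sum_mono mult_left_mono prob_of_nonneg) auto

lemma expec_nonneg:
  assumes "\<And>j. j \<in> F \<Longrightarrow> 0 \<le> d j \<and> d j \<le> 1" "\<And>\<xi>. 0 \<le> f \<xi>"
  shows "0 \<le> expec d F f"
  unfolding expec_def using assms by (intro sum_nonneg mult_nonneg_nonneg prob_of_nonneg) auto

lemma expec_1: "finite F \<Longrightarrow> expec d F (\<lambda>_. 1) = 1"
proof (induction F rule: finite_induct)
  case empty
  then show ?case
    by (simp add: expec_def states_def prob_of_def)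
next
  case (insert a F)
  then show ?case
    by (simp add: expec_insert)
qed

lemma tsum_insert:
  assumes "finite F" "a \<notin> F"
  shows "tsum (insert a F) x (\<xi>(a := y)) = tsum F x \<xi> + x a * y"
proof -
  have "tsum F x (\<xi>(a := y)) = tsum F x \<xi>"
    unfolding tsum_def using assms(2) by (intro sum.cong) auto
  then show ?thesis
    using assms by (simp add: tsum_def)
qed

lemma expec_powr_Jensen:
  assumes F: "finite F" "\<And>j. j \<in> F \<Longrightarrow> 0 \<le> d j \<and> d j \<le> 1" and ab: "0 < \<alpha>" "\<alpha> < \<beta>"
  shows "expec d F (\<lambda>\<xi>. \<bar>h \<xi>\<bar> powr \<alpha>) \<le> expec d F (\<lambda>\<xi>. \<bar>h \<xi>\<bar> powr \<beta>) powr (\<alpha> / \<beta>)"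
proof -
  let ?P = "\<beta> / \<alpha>" and ?Q = "\<beta> / (\<beta> - \<alpha>)"
  let ?\<mu> = "prob_of d F"
  have \<mu>: "0 \<le> ?\<mu> \<xi>" for \<xi>
    by (rule prob_of_nonneg) (rule F(2))
  have PQ: "1 < ?P" "1 < ?Q" "1 / ?P + 1 / ?Q = 1"
    using ab by (auto simp: field_simps)
  have "expec d F (\<lambda>\<xi>. \<bar>h \<xi>\<bar> powr \<alpha>) =
      (\<Sum>\<xi>\<in>states F. \<bar>(?\<mu> \<xi> powr (1 / ?P) * \<bar>h \<xi>\<bar> powr \<alpha>) * ?\<mu> \<xi> powr (1 / ?Q)\<bar>)"
    unfolding expec_def
  proof (rule sum.cong[OF refl])
    fix \<xi>
    have "?\<mu> \<xi> powr (1 / ?P) * ?\<mu> \<xi> powr (1 / ?Q) = ?\<mu> \<xi>"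
      using \<mu> by (simp only: powr_add[symmetric] PQ(3)) simp
    with \<mu>[of \<xi>] show "?\<mu> \<xi> * \<bar>h \<xi>\<bar> powr \<alpha> = \<bar>(?\<mu> \<xi> powr (1 / ?P) * \<bar>h \<xi>\<bar> powr \<alpha>) * ?\<mu> \<xi> powr (1 / ?Q)\<bar>"
      by (simp add: abs_mult mult.commute mult.left_commute)
  qed
  also have "\<dots> \<le> (\<Sum>\<xi>\<in>states F. \<bar>?\<mu> \<xi> powr (1 / ?P) * \<bar>h \<xi>\<bar> powr \<alpha>\<bar> powr ?P) powr (1 / ?P) *
      (\<Sum>\<xi>\<in>states F. \<bar>?\<mu> \<xi> powr (1 / ?Q)\<bar> powr ?Q) powr (1 / ?Q)"
    by (intro Hoelder_sum PQ finite_states F(1))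
  also have "(\<Sum>\<xi>\<in>states F. \<bar>?\<mu> \<xi> powr (1 / ?P) * \<bar>h \<xi>\<bar> powr \<alpha>\<bar> powr ?P) = expec d F (\<lambda>\<xi>. \<bar>h \<xi>\<bar> powr \<beta>)"
    unfolding expec_def
  proof (rule sum.cong[OF refl])
    fix \<xi>
    have "(?\<mu> \<xi> powr (1 / ?P)) powr ?P = ?\<mu> \<xi>" "(\<bar>h \<xi>\<bar> powr \<alpha>) powr ?P = \<bar>h \<xi>\<bar> powr \<beta>"
      using ab \<mu> by (simp_all add: powr_powr)
    moreover have "\<bar>?\<mu> \<xi> powr (1 / ?P) * \<bar>h \<xi>\<bar> powr \<alpha>\<bar> = ?\<mu> \<xi> powr (1 / ?P) * \<bar>h \<xi>\<bar> powr \<alpha>"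
      by (rule abs_of_nonneg) simp
    ultimately show "\<bar>?\<mu> \<xi> powr (1 / ?P) * \<bar>h \<xi>\<bar> powr \<alpha>\<bar> powr ?P = ?\<mu> \<xi> * \<bar>h \<xi>\<bar> powr \<beta>"
      by (simp only: powr_mult)
  qed
  also have "(\<Sum>\<xi>\<in>states F. \<bar>?\<mu> \<xi> powr (1 / ?Q)\<bar> powr ?Q) = expec d F (\<lambda>_. 1)"
    unfolding expec_def
  proof (rule sum.cong[OF refl])
    fix \<xi>
    have "(?\<mu> \<xi> powr (1 / ?Q)) powr ?Q = ?\<mu> \<xi>"
      using ab \<mu> by (simp add: powr_powr)
    then show "\<bar>?\<mu> \<xi> powr (1 / ?Q)\<bar> powr ?Q = ?\<mu> \<xi> * 1"
      by simp
  qed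
  finally show ?thesis
    by (simp add: expec_1[OF F(1)])
qed

lemma expec_tsum_mult:
  assumes "finite F"
  shows "expec d F (\<lambda>\<xi>. tsum F x \<xi> * tsum F y \<xi>) = (\<Sum>j\<in>F. d j * (x j * y j))"
  using assms
proof (induction F rule: finite_induct)
  case empty
  then show ?case
    by (simp add: expec_def tsum_def)
next
  case (insert a F)
  have "expec d F (\<lambda>\<xi>. (tsum F x \<xi> + x a) * (tsum F y \<xi> + y a)) +
      expec d F (\<lambda>\<xi>. (tsum F x \<xi> - x a) * (tsum F y \<xi> - y a)) =
      expec d F (\<lambda>\<xi>. 2 * (tsum F x \<xi> * tsum F y \<xi>) + 2 * (x a * y a) * 1)"
    unfolding expec_add[symmetric] by (simp add: algebra_simps)
  also have "\<dots> = 2 * (\<Sum>j\<in>F. d j * (x j * y j)) + 2 * (x a * y a)"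
    unfolding expec_add expec_scale insert.IH expec_1[OF insert.hyps(1)] by simp
  finally show ?case
    using insert.hyps insert.IH by (simp add: expec_insert tsum_insert field_simps)
qed

text \<open>The upper \<open>q\<close>-estimate of von Bahr and Esseen for symmetric independent variables.\<close>

lemma expec_tsum_le_2:
  assumes "finite F" "\<And>j. j \<in> F \<Longrightarrow> 0 \<le> d j \<and> d j \<le> 1" and q: "0 < q" "q \<le> 2"
  shows "expec d F (\<lambda>\<xi>. \<bar>tsum F x \<xi>\<bar> powr q) \<le> (\<Sum>j\<in>F. d j * \<bar>x j\<bar> powr q)"
  using assms(1,2)
proof (induction F rule: finite_induct)
  case empty
  then show ?case
    by (simp add: expec_def tsum_def)
next
  case (insert a F)
  let ?E = "expec d F (\<lambda>\<xi>. \<bar>tsum F x \<xi>\<bar> powr q)"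
  have "expec d F (\<lambda>\<xi>. \<bar>tsum F x \<xi> + x a\<bar> powr q) + expec d F (\<lambda>\<xi>. \<bar>tsum F x \<xi> - x a\<bar> powr q) \<le>
      expec d F (\<lambda>\<xi>. 2 * \<bar>tsum F x \<xi>\<bar> powr q + 2 * \<bar>x a\<bar> powr q * 1)"
    unfolding expec_add[symmetric]
  proof (rule expec_mono)
    fix \<xi> :: "'a \<Rightarrow> real"
    show "\<bar>tsum F x \<xi> + x a\<bar> powr q + \<bar>tsum F x \<xi> - x a\<bar> powr q \<le>
        2 * \<bar>tsum F x \<xi>\<bar> powr q + 2 * \<bar>x a\<bar> powr q * 1"
      using powr_midpoint_le[OF q, of "tsum F x \<xi>" "x a"] by simp
  qed (use insert.prems in auto)
  also have "\<dots> = 2 * (?E + \<bar>x a\<bar> powr q)"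
    unfolding expec_add expec_scale expec_1[OF insert.hyps(1)] by simp
  finally have "d a / 2 * (expec d F (\<lambda>\<xi>. \<bar>tsum F x \<xi> + x a\<bar> powr q) +
        expec d F (\<lambda>\<xi>. \<bar>tsum F x \<xi> - x a\<bar> powr q)) \<le> d a / 2 * (2 * (?E + \<bar>x a\<bar> powr q))"
    using insert.prems by (intro mult_left_mono) auto
  then have "expec d (insert a F) (\<lambda>\<xi>. \<bar>tsum (insert a F) x \<xi>\<bar> powr q) \<le> ?E + d a * \<bar>x a\<bar> powr q"
    using insert.hyps by (simp add: expec_insert tsum_insert algebra_simps)
  moreover have "?E \<le> (\<Sum>j\<in>F. d j * \<bar>x j\<bar> powr q)"
    using insert by auto
  ultimately show ?case
    using insert.hyps by simp
qed

text \<open>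
  Rosenthal's inequality.  Adding one variable increases the \<open>p\<close>-th moment by the second
  difference of \<open>\<bar>t\<bar>\<^sup>p\<close>; the moment of order \<open>p - 2\<close> that appears is bounded by a power of the
  final \<open>p\<close>-th moment \<open>M\<close>, and the resulting inequality \<open>M \<le> K (A M\<^bsup>1-2/p\<^esup> + B)\<close> is solved for \<open>M\<close>.
\<close>

lemma Rosenthal_inequality:
  assumes p: "2 < p" and F: "finite F" "\<And>j. j \<in> F \<Longrightarrow> 0 \<le> d j \<and> d j \<le> 1"
  shows "expec d F (\<lambda>\<xi>. \<bar>tsum F x \<xi>\<bar> powr p) \<le>
    (2 * (p * (p - 1) * 2 powr p)) powr (p / 2) *
    max (\<Sum>j\<in>F. d j * \<bar>x j\<bar> powr p) ((\<Sum>j\<in>F. d j * (x j)\<^sup>2) powr (p / 2))"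
proof -
  define K where "K = p * (p - 1) * 2 powr p"
  have K: "1 \<le> K"
  proof -
    have "1 * 1 * 1 \<le> p * (p - 1) * 2 powr p"
      using p by (intro mult_mono ge_one_powr_ge_zero) auto
    then show ?thesis by (simp add: K_def)
  qed
  have rec: "expec d F (\<lambda>\<xi>. \<bar>tsum F x \<xi>\<bar> powr p) \<le>
      K * ((\<Sum>j\<in>F. d j * (x j)\<^sup>2) * M powr ((p - 2) / p) + (\<Sum>j\<in>F. d j * \<bar>x j\<bar> powr p))"
    if "finite F" "\<And>j. j \<in> F \<Longrightarrow> 0 \<le> d j \<and> d j \<le> 1" "expec d F (\<lambda>\<xi>. \<bar>tsum F x \<xi>\<bar> powr p) \<le> M" for F M
    using that
  proof (induction F rule: finite_induct)
    case empty
    then show ?case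
      using p by (simp add: expec_def tsum_def)
  next
    case (insert a F)
    let ?E = "\<lambda>h. expec d F (\<lambda>\<xi>. h (tsum F x \<xi>))"
    have dF: "0 \<le> d j \<and> d j \<le> 1" if "j \<in> F" for j
      using insert.prems that by auto
    have da: "0 \<le> d a" "d a \<le> 1"
      using insert.prems by auto
    have eq: "expec d (insert a F) (\<lambda>\<xi>. \<bar>tsum (insert a F) x \<xi>\<bar> powr p) =
        ?E (\<lambda>s. \<bar>s\<bar> powr p) + d a / 2 *
          (?E (\<lambda>s. \<bar>s + x a\<bar> powr p) + ?E (\<lambda>s. \<bar>s - x a\<bar> powr p) - 2 * ?E (\<lambda>s. \<bar>s\<bar> powr p))"
      using insert.hyps by (simp add: expec_insert tsum_insert field_simps)
    have "?E (\<lambda>s. 2 * \<bar>s\<bar> powr p) \<le> ?E (\<lambda>s. \<bar>s + x a\<bar> powr p + \<bar>s - x a\<bar> powr p)"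
      using p by (intro expec_mono dF powr_midpoint_ge) auto
    then have "0 \<le> d a / 2 *
          (?E (\<lambda>s. \<bar>s + x a\<bar> powr p) + ?E (\<lambda>s. \<bar>s - x a\<bar> powr p) - 2 * ?E (\<lambda>s. \<bar>s\<bar> powr p))"
      using da unfolding expec_add expec_scale by (intro mult_nonneg_nonneg) auto
    then have M: "?E (\<lambda>s. \<bar>s\<bar> powr p) \<le> M"
      using insert.prems(2) unfolding eq by linarith
    have J: "?E (\<lambda>s. \<bar>s\<bar> powr (p - 2)) \<le> M powr ((p - 2) / p)"
    proof -
      have "?E (\<lambda>s. \<bar>s\<bar> powr (p - 2)) \<le> ?E (\<lambda>s. \<bar>s\<bar> powr p) powr ((p - 2) / p)"
        using p by (intro expec_powr_Jensen dF insert.hyps) auto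
      also have "\<dots> \<le> M powr ((p - 2) / p)"
        using p M by (intro powr_mono2 expec_nonneg dF) auto
      finally show ?thesis .
    qed
    have "?E (\<lambda>s. \<bar>s + x a\<bar> powr p + \<bar>s - x a\<bar> powr p) \<le>
        ?E (\<lambda>s. 2 * \<bar>s\<bar> powr p + (2 * K * (x a)\<^sup>2 * \<bar>s\<bar> powr (p - 2) + 2 * K * \<bar>x a\<bar> powr p * 1))"
    proof (intro expec_mono dF)
      fix \<xi> :: "'a \<Rightarrow> real"
      show "\<bar>tsum F x \<xi> + x a\<bar> powr p + \<bar>tsum F x \<xi> - x a\<bar> powr p \<le>
          2 * \<bar>tsum F x \<xi>\<bar> powr p + (2 * K * (x a)\<^sup>2 * \<bar>tsum F x \<xi>\<bar> powr (p - 2) + 2 * K * \<bar>x a\<bar> powr p * 1)"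
        using powr_second_difference[OF p, of "tsum F x \<xi>" "x a", folded K_def]
        by (simp add: algebra_simps)
    qed
    then have "?E (\<lambda>s. \<bar>s + x a\<bar> powr p) + ?E (\<lambda>s. \<bar>s - x a\<bar> powr p) - 2 * ?E (\<lambda>s. \<bar>s\<bar> powr p) \<le>
        2 * K * ((x a)\<^sup>2 * ?E (\<lambda>s. \<bar>s\<bar> powr (p - 2)) + \<bar>x a\<bar> powr p)"
      unfolding expec_add expec_scale expec_1[OF insert.hyps(1)] by (simp add: algebra_simps)
    also have "\<dots> \<le> 2 * K * ((x a)\<^sup>2 * M powr ((p - 2) / p) + \<bar>x a\<bar> powr p)"
      using J K by (intro mult_left_mono add_right_mono) auto
    finally have "d a / 2 * (?E (\<lambda>s. \<bar>s + x a\<bar> powr p) + ?E (\<lambda>s. \<bar>s - x a\<bar> powr p) - 2 * ?E (\<lambda>s. \<bar>s\<bar> powr p)) \<le>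
        d a / 2 * (2 * K * ((x a)\<^sup>2 * M powr ((p - 2) / p) + \<bar>x a\<bar> powr p))"
      using da by (intro mult_left_mono) auto
    moreover have "?E (\<lambda>s. \<bar>s\<bar> powr p) \<le>
        K * ((\<Sum>j\<in>F. d j * (x j)\<^sup>2) * M powr ((p - 2) / p) + (\<Sum>j\<in>F. d j * \<bar>x j\<bar> powr p))"
      by (rule insert.IH[OF dF M])
    ultimately show ?case
      using insert.hyps unfolding eq by (simp add: algebra_simps)
  qed
  define M where "M = expec d F (\<lambda>\<xi>. \<bar>tsum F x \<xi>\<bar> powr p)"
  define A where "A = (\<Sum>j\<in>F. d j * (x j)\<^sup>2)"
  define B where "B = (\<Sum>j\<in>F. d j * \<bar>x j\<bar> powr p)"
  have nonneg: "0 \<le> M" "0 \<le> A" "0 \<le> B"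
    using F by (auto simp: M_def A_def B_def intro!: expec_nonneg sum_nonneg)
  have M: "M \<le> K * (A * M powr ((p - 2) / p) + B)"
    using rec[OF F, of M] unfolding M_def A_def B_def by auto
  have "M \<le> (2 * K) powr (p / 2) * max B (A powr (p / 2))"
  proof (cases "A * M powr ((p - 2) / p) \<le> B")
    case True
    have "K * (A * M powr ((p - 2) / p) + B) \<le> K * (B + B)"
      using True K by (intro mult_left_mono) auto
    with M have "M \<le> 2 * K * B"
      by simp
    also have "\<dots> \<le> (2 * K) powr (p / 2) * max B (A powr (p / 2))"
    proof (intro mult_mono)
      show "2 * K \<le> (2 * K) powr (p / 2)"
        using powr_mono[of 1 "p / 2" "2 * K"] p K by simp
    qed (use nonneg in auto)
    finally show ?thesis .
  next
    case False
    then have "K * (A * M powr ((p - 2) / p) + B) \<le> K * (A * M powr ((p - 2) / p) + A * M powr ((p - 2) / p))"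
      using K by (intro mult_left_mono) auto
    with M have M': "M \<le> 2 * K * A * M powr ((p - 2) / p)"
      by simp
    moreover have "(p - 2) / p = 1 - 2 / p"
      using p by (simp add: diff_divide_distrib)
    ultimately have "M powr (2 / p) \<le> 2 * K * A"
      using nonneg K by (intro self_bound_powr) simp_all
    then have "(M powr (2 / p)) powr (p / 2) \<le> (2 * K * A) powr (p / 2)"
      using p by (intro powr_mono2) auto
    also have "\<dots> = (2 * K) powr (p / 2) * A powr (p / 2)"
      by (rule powr_mult)
    also have "\<dots> \<le> (2 * K) powr (p / 2) * max B (A powr (p / 2))"
      by (intro mult_left_mono) auto
    finally show ?thesis
      using p nonneg by (simp add: powr_powr)
  qed
  then show ?thesis
    by (simp add: M_def A_def B_def K_def)
qed

section \<open>Cells with summable weights\<close>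

text \<open>
  A finite cell is embedded into \<open>\<ell>\<^sub>p\<close> by sending its coordinates to independent three-valued variables
  with \<open>E\<bar>f\<^sub>j\<bar>\<^sup>p = 1\<close> and \<open>E f\<^sub>j\<^sup>2 = w\<^sub>j\<^sup>2\<close>; the norm in \<open>L\<^sub>p\<close> is described by Rosenthal's inequality.  The
  orthogonal projection onto their span is bounded by duality, with a constant that depends on \<open>p\<close> only.
\<close>

definition var_embed :: "real \<Rightarrow> ('a \<Rightarrow> real) \<Rightarrow> 'a set \<Rightarrow> ('a \<Rightarrow> real) \<Rightarrow> ('a \<Rightarrow> real) \<Rightarrow> real" where
  "var_embed p w E x \<xi> = prob_of (\<lambda>j. w j powr rexp p) E \<xi> powr (1 / p) *
     tsum E (\<lambda>j. x j / w j powr (2 / (p - 2))) \<xi>"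

definition var_project :: "real \<Rightarrow> ('a \<Rightarrow> real) \<Rightarrow> 'a set \<Rightarrow> (('a \<Rightarrow> real) \<Rightarrow> real) \<Rightarrow> 'a \<Rightarrow> real" where
  "var_project p w E g j =
     (\<Sum>\<xi>\<in>states E. prob_of (\<lambda>j. w j powr rexp p) E \<xi> powr (1 - 1 / p) * g \<xi> * \<xi> j) /
     ((w j)\<^sup>2 * w j powr (2 / (p - 2)))"

context
  fixes p :: real and w :: "'a \<Rightarrow> real" and E :: "'a set"
  assumes p: "2 < p" and E: "finite E" and w: "\<And>j. j \<in> E \<Longrightarrow> 0 < w j \<and> w j \<le> 1"
begin

private abbreviation "d \<equiv> \<lambda>j. w j powr rexp p"
private abbreviation "b \<equiv> \<lambda>j. w j powr (2 / (p - 2))"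

private lemma d: "j \<in> E \<Longrightarrow> 0 \<le> d j \<and> d j \<le> 1"
  using w[of j] rexp_pos[OF p] powr_mono2[of "rexp p" "w j" 1] by auto

private lemma bw:
  assumes "j \<in> E"
  shows "b j powr p = d j" "(w j * b j)\<^sup>2 = d j" "(w j)\<^sup>2 * b j * b j = d j"
    "((w j)\<^sup>2 * b j) powr (p / (p - 1)) = d j" "0 < b j" "0 < w j"
  using block_weight_powers[OF p, of "w j"] w[OF assms] by auto

private lemma prob_nonneg: "0 \<le> prob_of d E \<xi>"
  by (rule prob_of_nonneg) (rule d)

lemma var_embed_bound:
  "(\<Sum>\<xi>\<in>states E. \<bar>var_embed p w E x \<xi>\<bar> powr p) \<le> (2 * (p * (p - 1) * 2 powr p)) powr (p / 2) *
     max (\<Sum>j\<in>E. \<bar>x j\<bar> powr p) ((\<Sum>j\<in>E. (w j * x j)\<^sup>2) powr (p / 2))"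
proof -
  have "(\<Sum>\<xi>\<in>states E. \<bar>var_embed p w E x \<xi>\<bar> powr p) = expec d E (\<lambda>\<xi>. \<bar>tsum E (\<lambda>j. x j / b j) \<xi>\<bar> powr p)"
    unfolding expec_def
  proof (rule sum.cong[OF refl])
    fix \<xi>
    have "(prob_of d E \<xi> powr (1 / p)) powr p = prob_of d E \<xi>"
      using p prob_nonneg by (simp add: powr_powr)
    then show "\<bar>var_embed p w E x \<xi>\<bar> powr p = prob_of d E \<xi> * \<bar>tsum E (\<lambda>j. x j / b j) \<xi>\<bar> powr p"
      unfolding var_embed_def by (simp add: abs_mult powr_mult)
  qed
  also have "\<dots> \<le> (2 * (p * (p - 1) * 2 powr p)) powr (p / 2) *
      max (\<Sum>j\<in>E. d j * \<bar>x j / b j\<bar> powr p) ((\<Sum>j\<in>E. d j * (x j / b j)\<^sup>2) powr (p / 2))"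
    by (rule Rosenthal_inequality[OF p E d])
  also have "(\<Sum>j\<in>E. d j * \<bar>x j / b j\<bar> powr p) = (\<Sum>j\<in>E. \<bar>x j\<bar> powr p)"
  proof (rule sum.cong[OF refl])
    fix j assume j: "j \<in> E"
    have "\<bar>x j / b j\<bar> powr p = \<bar>x j\<bar> powr p / d j"
      using bw(1,5)[OF j] by (simp add: abs_divide powr_divide)
    then show "d j * \<bar>x j / b j\<bar> powr p = \<bar>x j\<bar> powr p"
      using bw(6)[OF j] by simp
  qed
  also have "(\<Sum>j\<in>E. d j * (x j / b j)\<^sup>2) = (\<Sum>j\<in>E. (w j * x j)\<^sup>2)"
  proof (rule sum.cong[OF refl])
    fix j assume j: "j \<in> E"
    have "(w j * b j)\<^sup>2 * (x j / b j)\<^sup>2 = (w j * x j)\<^sup>2"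
      using bw(5)[OF j] by (simp add: power_mult_distrib power_divide)
    then show "d j * (x j / b j)\<^sup>2 = (w j * x j)\<^sup>2"
      by (simp only: bw(2)[OF j])
  qed
  finally show ?thesis .
qed

private lemma pairing:
  "(\<Sum>j\<in>E. t j * ((w j)\<^sup>2 * var_project p w E g j)) =
   (\<Sum>\<xi>\<in>states E. prob_of d E \<xi> powr (1 - 1 / p) * g \<xi> * tsum E (\<lambda>j. t j / b j) \<xi>)"
proof -
  have "(\<Sum>j\<in>E. t j * ((w j)\<^sup>2 * var_project p w E g j)) =
      (\<Sum>j\<in>E. \<Sum>\<xi>\<in>states E. prob_of d E \<xi> powr (1 - 1 / p) * g \<xi> * (t j / b j * \<xi> j))"
  proof (rule sum.cong[OF refl])
    fix j assume j: "j \<in> E"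
    have "t j * ((w j)\<^sup>2 * var_project p w E g j) =
        t j / b j * (\<Sum>\<xi>\<in>states E. prob_of d E \<xi> powr (1 - 1 / p) * g \<xi> * \<xi> j)"
      using bw(5,6)[OF j] by (simp add: var_project_def)
    then show "t j * ((w j)\<^sup>2 * var_project p w E g j) =
        (\<Sum>\<xi>\<in>states E. prob_of d E \<xi> powr (1 - 1 / p) * g \<xi> * (t j / b j * \<xi> j))"
      by (simp only: sum_distrib_left mult_ac)
  qed
  also have "\<dots> = (\<Sum>\<xi>\<in>states E. \<Sum>j\<in>E. prob_of d E \<xi> powr (1 - 1 / p) * g \<xi> * (t j / b j * \<xi> j))"
    by (rule sum.swap)
  finally show ?thesis
    by (simp only: tsum_def sum_distrib_left)
qed

private lemma pairing_le:
  "(\<Sum>\<xi>\<in>states E. prob_of d E \<xi> powr (1 - 1 / p) * g \<xi> * h \<xi>) \<le>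
   (\<Sum>\<xi>\<in>states E. \<bar>g \<xi>\<bar> powr p) powr (1 / p) *
   expec d E (\<lambda>\<xi>. \<bar>h \<xi>\<bar> powr (p / (p - 1))) powr (1 - 1 / p)"
proof -
  let ?q = "p / (p - 1)"
  have q: "1 / ?q = 1 - 1 / p"
    using p by (simp add: field_simps)
  have "(\<Sum>\<xi>\<in>states E. prob_of d E \<xi> powr (1 - 1 / p) * g \<xi> * h \<xi>) \<le>
      (\<Sum>\<xi>\<in>states E. \<bar>g \<xi> * (prob_of d E \<xi> powr (1 - 1 / p) * h \<xi>)\<bar>)"
  proof (rule sum_mono)
    fix \<xi>
    have "prob_of d E \<xi> powr (1 - 1 / p) * g \<xi> * h \<xi> = g \<xi> * (prob_of d E \<xi> powr (1 - 1 / p) * h \<xi>)"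
      by (simp only: mult_ac)
    then show "prob_of d E \<xi> powr (1 - 1 / p) * g \<xi> * h \<xi> \<le>
        \<bar>g \<xi> * (prob_of d E \<xi> powr (1 - 1 / p) * h \<xi>)\<bar>"
      by (simp only: abs_ge_self)
  qed
  also have "\<dots> \<le> (\<Sum>\<xi>\<in>states E. \<bar>g \<xi>\<bar> powr p) powr (1 / p) *
      (\<Sum>\<xi>\<in>states E. \<bar>prob_of d E \<xi> powr (1 - 1 / p) * h \<xi>\<bar> powr ?q) powr (1 / ?q)"
    using p q by (intro Hoelder_sum finite_states E) auto
  also have "(\<Sum>\<xi>\<in>states E. \<bar>prob_of d E \<xi> powr (1 - 1 / p) * h \<xi>\<bar> powr ?q) =
      expec d E (\<lambda>\<xi>. \<bar>h \<xi>\<bar> powr ?q)"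
    unfolding expec_def
  proof (rule sum.cong[OF refl])
    fix \<xi>
    have "(1 - 1 / p) * ?q = 1"
      using p by (simp add: field_simps)
    then have "(prob_of d E \<xi> powr (1 - 1 / p)) powr ?q = prob_of d E \<xi>"
      using prob_nonneg[of \<xi>] by (simp only: powr_powr) simp
    then show "\<bar>prob_of d E \<xi> powr (1 - 1 / p) * h \<xi>\<bar> powr ?q = prob_of d E \<xi> * \<bar>h \<xi>\<bar> powr ?q"
      by (simp add: abs_mult powr_mult)
  qed
  finally show ?thesis
    by (simp only: q)
qed

lemma var_project_bound_2:
  "(\<Sum>j\<in>E. (w j * var_project p w E g j)\<^sup>2) powr (p / 2) \<le> (\<Sum>\<xi>\<in>states E. \<bar>g \<xi>\<bar> powr p)"
proof -
  let ?c = "var_project p w E g" and ?q = "p / (p - 1)"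
  let ?G = "\<Sum>\<xi>\<in>states E. \<bar>g \<xi>\<bar> powr p"
  define A where "A = (\<Sum>j\<in>E. (w j * ?c j)\<^sup>2)"
  let ?h = "tsum E (\<lambda>j. ?c j / b j)"
  have A0: "0 \<le> A" and G0: "0 \<le> ?G"
    by (auto simp: A_def intro!: sum_nonneg)
  have h2: "expec d E (\<lambda>\<xi>. \<bar>?h \<xi>\<bar> powr 2) = A"
  proof -
    have "expec d E (\<lambda>\<xi>. \<bar>?h \<xi>\<bar> powr 2) = expec d E (\<lambda>\<xi>. ?h \<xi> * ?h \<xi>)"
      by (simp add: power2_eq_square)
    also have "\<dots> = (\<Sum>j\<in>E. d j * (?c j / b j * (?c j / b j)))"
      by (rule expec_tsum_mult[OF E])
    also have "\<dots> = A"
      unfolding A_def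
    proof (rule sum.cong[OF refl])
      fix j assume j: "j \<in> E"
      have "(w j * b j)\<^sup>2 * (?c j / b j * (?c j / b j)) = (w j * ?c j)\<^sup>2"
        using bw(5)[OF j] by (simp add: power2_eq_square)
      then show "d j * (?c j / b j * (?c j / b j)) = (w j * ?c j)\<^sup>2"
        by (simp only: bw(2)[OF j])
    qed
    finally show ?thesis .
  qed
  have "A = (\<Sum>j\<in>E. ?c j * ((w j)\<^sup>2 * ?c j))"
    unfolding A_def by (intro sum.cong) (auto simp: power2_eq_square)
  also have "\<dots> \<le> ?G powr (1 / p) * expec d E (\<lambda>\<xi>. \<bar>?h \<xi>\<bar> powr ?q) powr (1 - 1 / p)"
    unfolding pairing by (rule pairing_le)
  also have "\<dots> \<le> ?G powr (1 / p) * (A powr (?q / 2)) powr (1 - 1 / p)"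
  proof (intro mult_left_mono powr_mono2)
    have "?q < 2"
      using p by (simp add: field_simps)
    then have "expec d E (\<lambda>\<xi>. \<bar>?h \<xi>\<bar> powr ?q) \<le> expec d E (\<lambda>\<xi>. \<bar>?h \<xi>\<bar> powr 2) powr (?q / 2)"
      using p by (intro expec_powr_Jensen E d) auto
    then show "expec d E (\<lambda>\<xi>. \<bar>?h \<xi>\<bar> powr ?q) \<le> A powr (?q / 2)"
      by (simp only: h2)
  qed (use p in \<open>auto intro!: expec_nonneg d\<close>)
  also have "(A powr (?q / 2)) powr (1 - 1 / p) = A powr (1 - 1 / 2)"
  proof -
    have "1 - 1 / p = (p - 1) / p"
      using p by (simp add: diff_divide_distrib)
    then have "?q / 2 * (1 - 1 / p) = 1 - 1 / 2"
      using p by simp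
    then show ?thesis
      by (simp only: powr_powr)
  qed
  finally have "A powr (1 / 2) \<le> ?G powr (1 / p)"
    by (intro self_bound_powr A0) auto
  then have "(A powr (1 / 2)) powr p \<le> (?G powr (1 / p)) powr p"
    using p by (intro powr_mono2) auto
  then show ?thesis
    using p G0 by (simp add: powr_powr A_def)
qed

lemma var_project_bound_p:
  "(\<Sum>j\<in>E. \<bar>var_project p w E g j\<bar> powr p) \<le> (\<Sum>\<xi>\<in>states E. \<bar>g \<xi>\<bar> powr p)"
proof -
  let ?c = "var_project p w E g" and ?q = "p / (p - 1)"
  let ?G = "\<Sum>\<xi>\<in>states E. \<bar>g \<xi>\<bar> powr p"
  define P where "P = (\<Sum>j\<in>E. \<bar>?c j\<bar> powr p)"
  have P0: "0 \<le> P" and G0: "0 \<le> ?G"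
    by (auto simp: P_def intro!: sum_nonneg)
  \<comment> \<open>With the factor \<open>w\<^sub>j\<^sup>2\<close> of the pairing, this is the functional that norms the coefficients in \<open>\<ell>\<^sub>p\<close>.\<close>
  define t where "t j = sgn (?c j) * \<bar>?c j\<bar> powr (p - 1) / (w j)\<^sup>2" for j
  let ?h = "tsum E (\<lambda>j. t j / b j)"
  have "P = (\<Sum>j\<in>E. t j * ((w j)\<^sup>2 * ?c j))"
    unfolding P_def
  proof (rule sum.cong[OF refl])
    fix j assume j: "j \<in> E"
    have "t j * ((w j)\<^sup>2 * ?c j) = \<bar>?c j\<bar> * \<bar>?c j\<bar> powr (p - 1)"
      using bw(6)[OF j] by (simp add: t_def abs_sgn mult_ac)
    then show "\<bar>?c j\<bar> powr p = t j * ((w j)\<^sup>2 * ?c j)"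
      using powr_mult_base[of "\<bar>?c j\<bar>" "p - 1"] by simp
  qed
  also have "\<dots> \<le> ?G powr (1 / p) * expec d E (\<lambda>\<xi>. \<bar>?h \<xi>\<bar> powr ?q) powr (1 - 1 / p)"
    unfolding pairing by (rule pairing_le)
  also have "\<dots> \<le> ?G powr (1 / p) * P powr (1 - 1 / p)"
  proof (intro mult_left_mono powr_mono2)
    have "0 < ?q" "?q \<le> 2"
      using p by (auto simp: field_simps)
    then have "expec d E (\<lambda>\<xi>. \<bar>?h \<xi>\<bar> powr ?q) \<le> (\<Sum>j\<in>E. d j * \<bar>t j / b j\<bar> powr ?q)"
      by (intro expec_tsum_le_2 E d)
    also have "\<dots> = P"
      unfolding P_def
    proof (rule sum.cong[OF refl])
      fix j assume j: "j \<in> E"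
      have "\<bar>t j / b j\<bar> = \<bar>?c j\<bar> powr (p - 1) / ((w j)\<^sup>2 * b j)"
        using bw(5,6)[OF j] p by (cases "?c j = 0") (auto simp: t_def abs_mult abs_divide)
      then have "\<bar>t j / b j\<bar> powr ?q = (\<bar>?c j\<bar> powr (p - 1)) powr ?q / d j"
        by (simp only: powr_divide bw(4)[OF j])
      also have "(\<bar>?c j\<bar> powr (p - 1)) powr ?q = \<bar>?c j\<bar> powr p"
        using p by (simp add: powr_powr)
      finally show "d j * \<bar>t j / b j\<bar> powr ?q = \<bar>?c j\<bar> powr p"
        using bw(6)[OF j] by simp
    qed
    finally show "expec d E (\<lambda>\<xi>. \<bar>?h \<xi>\<bar> powr ?q) \<le> P" .
  qed (use p in \<open>auto intro!: expec_nonneg d\<close>)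
  finally have "P powr (1 / p) \<le> ?G powr (1 / p)"
    by (intro self_bound_powr P0) auto
  then have "(P powr (1 / p)) powr p \<le> (?G powr (1 / p)) powr p"
    by (rule powr_mono2[rotated 2]) (use p in auto)
  then have "P \<le> ?G"
    using p G0 P0 by (simp add: powr_powr)
  then show ?thesis
    by (simp only: P_def)
qed

lemma var_project_embed:
  assumes j: "j \<in> E"
  shows "var_project p w E (var_embed p w E x) j = x j"
proof -
  let ?\<delta> = "\<lambda>k. if k = j then 1 else 0 :: real"
  have "(\<Sum>\<xi>\<in>states E. prob_of d E \<xi> powr (1 - 1 / p) * var_embed p w E x \<xi> * \<xi> j) =
      expec d E (\<lambda>\<xi>. tsum E (\<lambda>j. x j / b j) \<xi> * tsum E ?\<delta> \<xi>)"
    unfolding expec_def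
  proof (rule sum.cong[OF refl])
    fix \<xi>
    have "prob_of d E \<xi> powr (1 - 1 / p) * prob_of d E \<xi> powr (1 / p) = prob_of d E \<xi>"
      using prob_nonneg[of \<xi>] by (simp only: powr_add[symmetric]) simp
    moreover have "tsum E ?\<delta> \<xi> = \<xi> j"
      using j E by (simp add: tsum_def if_distrib[of "\<lambda>t. t * _"] cong: if_cong)
    ultimately show "prob_of d E \<xi> powr (1 - 1 / p) * var_embed p w E x \<xi> * \<xi> j =
        prob_of d E \<xi> * (tsum E (\<lambda>j. x j / b j) \<xi> * tsum E ?\<delta> \<xi>)"
      unfolding var_embed_def by (simp only: mult.assoc[symmetric])
  qed
  also have "\<dots> = (\<Sum>k\<in>E. d k * (x k / b k * ?\<delta> k))"
    by (rule expec_tsum_mult[OF E])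
  also have "\<dots> = d j * (x j / b j)"
    using j E by (simp add: if_distrib[of "\<lambda>t. _ * t"] cong: if_cong)
  also have "\<dots> = (w j)\<^sup>2 * b j * b j * (x j / b j)"
    by (simp only: bw(3)[OF j])
  finally show ?thesis
    using bw(5,6)[OF j] by (simp add: var_project_def)
qed

end

text \<open>The space \<open>\<ell>\<^sub>p\<close> over an index set, as the space in which all cells are singletons.\<close>

abbreviation ell :: "real \<Rightarrow> 'a set \<Rightarrow> ('a \<Rightarrow> real) nspace" where
  "ell p J \<equiv> cell_space p J (\<lambda>j. j) (\<lambda>_. 1)"

lemma secn_singletons: "secn p (\<lambda>j. j) (\<lambda>_. 1) F x = psum p F x"
proof -
  have "qsum p (\<lambda>j. j) (\<lambda>_. 1) F x = psum p F x"
    unfolding qsum_def psum_def image_ident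
  proof (rule sum.cong[OF refl])
    fix i assume "i \<in> F"
    then have "{j. j \<in> F \<and> j = i} = {i}"
      by auto
    moreover have "((x i)\<^sup>2) powr (p / 2) = \<bar>x i\<bar> powr p"
      using powr_powr[of "\<bar>x i\<bar>" 2 "p / 2"] by simp
    ultimately show "(\<Sum>j | j \<in> F \<and> j = i. (1 * x j)\<^sup>2) powr (p / 2) = \<bar>x i\<bar> powr p"
      by simp
  qed
  then show ?thesis
    by (simp add: secn_def)
qed

lemma ell_reindex: "0 < p \<Longrightarrow> bij_betw f K J \<Longrightarrow> ell p K \<cong>\<^sub>B ell p J"
  by (rule cell_space_reindex) (auto simp: bij_betw_def inj_on_def)

lemma ell_infinite_iso:
  assumes "0 < p" "countable J" "infinite J"
  shows "ell p J \<cong>\<^sub>B ell p (UNIV :: nat set)"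
  using ell_reindex[OF assms(1) to_nat_on_infinite[OF assms(2,3)]] .

lemma psum_Sigma:
  assumes "finite I" "\<And>i. i \<in> I \<Longrightarrow> finite (S i)"
  shows "psum p (Sigma I S) g = (\<Sum>i\<in>I. \<Sum>\<xi>\<in>S i. \<bar>g (i, \<xi>)\<bar> powr p)"
  unfolding psum_def using assms by (subst sum.Sigma) (auto simp: case_prod_beta)

text \<open>
  The maps of the single cells are put side by side.  This works because their bounds depend neither
  on the size of the cell nor on the weights.
\<close>

lemma finite_cells_complemented:
  fixes Q :: "'a set" and c :: "'a \<Rightarrow> 'b"
  assumes p: "2 < p" and Q: "countable Q" and w: "\<And>j. j \<in> Q \<Longrightarrow> 0 < w j \<and> w j \<le> 1"
    and fin: "\<And>i. finite {j. j \<in> Q \<and> c j = i}"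
  shows "cell_space p Q c w \<unlhd>\<^sub>B ell p (UNIV :: nat set)"
proof -
  define cell where "cell i = {j. j \<in> Q \<and> c j = i}" for i
  define \<Omega> where "\<Omega> = (SIGMA i : c ` Q. states (cell i))"
  define e where "e x z = (if z \<in> \<Omega> then var_embed p w (cell (fst z)) x (snd z) else 0)" for x z
  define q where "q g j = (if j \<in> Q then var_project p w (cell (c j)) (\<lambda>\<xi>. g (c j, \<xi>)) j else 0)" for g j
  define C where "C = (2 * (p * (p - 1) * 2 powr p)) powr (p / 2)"
  have p0: "0 < p" "1 \<le> p" and C0: "0 \<le> C"
    using p by (auto simp: C_def)
  have fc: "finite (cell i)" for i
    using fin by (simp add: cell_def)
  note fs = finite_states[OF fc]
  have wc: "0 < w j \<and> w j \<le> 1" if "j \<in> cell i" for i j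
    using that w by (auto simp: cell_def)
  have disj: "disjoint_family_on cell I" for I
    by (auto simp: disjoint_family_on_def cell_def)
  have psum_cells: "psum p (\<Union>i\<in>I. cell i) x = (\<Sum>i\<in>I. \<Sum>j\<in>cell i. \<bar>x j\<bar> powr p)" if "finite I" for I x
    using psum_UNION[OF that fc disj, of p x] by (simp add: psum_def)
  have qsum_cells: "qsum p c w (\<Union>i\<in>I. cell i) x = (\<Sum>i\<in>I. (\<Sum>j\<in>cell i. (w j * x j)\<^sup>2) powr (p / 2))"
    if "finite I" for I x
  proof -
    have "{k. k \<in> I \<and> k = i} = {i}" if "i \<in> I" for i
      using that by auto
    then show ?thesis
      using qsum_UNION[OF that fc disj, where c = c and \<phi> = "\<lambda>i. i" and c' = "\<lambda>i. i" and p = p and w = w and y = x]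
      by (simp add: cell_def)
  qed
  have lin_e: "var_embed p w E (x + y) = var_embed p w E x + var_embed p w E y"
    "var_embed p w E (\<lambda>j. a * x j) \<xi> = a * var_embed p w E x \<xi>" for E x y a \<xi>
    by (auto simp: fun_eq_iff var_embed_def tsum_def add_divide_distrib
        distrib_left distrib_right sum.distrib sum_distrib_left mult_ac)
  have lin_q: "var_project p w E (\<lambda>\<xi>. g \<xi> + h \<xi>) j = var_project p w E g j + var_project p w E h j"
    "var_project p w E (\<lambda>\<xi>. a * g \<xi>) j = a * var_project p w E g j" for E g h a j
    by (simp_all add: var_project_def distrib_left distrib_right sum.distrib add_divide_distrib
        sum_distrib_left sum_divide_distrib mult_ac)
  have e: "bounded_between (cell_space p Q c w) (ell p \<Omega>) e"
  proof (rule cell_space_bounded[OF p0(1), of "C * 2"])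
    fix F assume F: "F \<in> Fpow \<Omega>"
    define I where "I = fst ` F"
    have I: "finite I" "I \<subseteq> c ` Q" "F \<subseteq> Sigma I (\<lambda>i. states (cell i))"
      using F by (auto simp: I_def Fpow_def \<Omega>_def rev_image_eqI)
    let ?G = "\<Union>i\<in>I. cell i"
    have "secn p (\<lambda>j. j) (\<lambda>_. 1) F (e x) \<le> C * 2 * secn p c w ?G x" for x
    proof -
      have "psum p F (e x) \<le> psum p (Sigma I (\<lambda>i. states (cell i))) (e x)"
        using F I fs by (intro psum_mono finite_SigmaI) (auto simp: Fpow_def)
      also have "\<dots> = (\<Sum>i\<in>I. \<Sum>\<xi>\<in>states (cell i). \<bar>e x (i, \<xi>)\<bar> powr p)"
        by (rule psum_Sigma[OF I(1) fs])
      also have "\<dots> = (\<Sum>i\<in>I. \<Sum>\<xi>\<in>states (cell i). \<bar>var_embed p w (cell i) x \<xi>\<bar> powr p)"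
        using I(2) by (intro sum.cong refl) (auto simp: e_def \<Omega>_def)
      also have "\<dots> \<le> (\<Sum>i\<in>I. C * max (\<Sum>j\<in>cell i. \<bar>x j\<bar> powr p) ((\<Sum>j\<in>cell i. (w j * x j)\<^sup>2) powr (p / 2)))"
        unfolding C_def by (intro sum_mono var_embed_bound p fc wc)
      also have "\<dots> \<le> (\<Sum>i\<in>I. C * ((\<Sum>j\<in>cell i. \<bar>x j\<bar> powr p) + (\<Sum>j\<in>cell i. (w j * x j)\<^sup>2) powr (p / 2)))"
        using C0 by (intro sum_mono mult_left_mono) (auto simp: max_def sum_nonneg)
      also have "\<dots> = C * (psum p ?G x + qsum p c w ?G x)"
        by (simp only: psum_cells[OF I(1)] qsum_cells[OF I(1)] sum.distrib sum_distrib_left[symmetric])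
      also have "\<dots> \<le> C * (2 * secn p c w ?G x)"
        using C0 by (intro mult_left_mono) (auto simp: secn_def)
      finally show ?thesis
        by (simp add: secn_singletons)
    qed
    moreover have "?G \<in> Fpow Q"
      using I(1) fc by (auto simp: Fpow_def cell_def)
    ultimately show "\<exists>G\<in>Fpow Q. \<forall>x. secn p (\<lambda>j. j) (\<lambda>_. 1) F (e x) \<le> C * 2 * secn p c w G x"
      by blast
  qed (use C0 in \<open>auto simp: e_def fun_eq_iff lin_e scaleR_fun_def\<close>)
  have q: "bounded_between (ell p \<Omega>) (cell_space p Q c w) q"
  proof (rule cell_space_bounded[OF p0(1) zero_le_one])
    fix F assume F: "F \<in> Fpow Q"
    define I where "I = c ` F"
    have I: "finite I" "I \<subseteq> c ` Q" "F \<subseteq> (\<Union>i\<in>I. cell i)"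
      using F by (auto simp: I_def Fpow_def cell_def)
    let ?G = "Sigma I (\<lambda>i. states (cell i))"
    have fU: "finite (\<Union>i\<in>I. cell i)"
      using I(1) fc by blast
    have "secn p c w F (q g) \<le> 1 * secn p (\<lambda>j. j) (\<lambda>_. 1) ?G g" for g
    proof -
      have qg: "q g j = var_project p w (cell i) (\<lambda>\<xi>. g (i, \<xi>)) j" if "j \<in> cell i" for i j
        using that by (auto simp: q_def cell_def)
      have G: "psum p ?G g = (\<Sum>i\<in>I. \<Sum>\<xi>\<in>states (cell i). \<bar>g (i, \<xi>)\<bar> powr p)"
        by (rule psum_Sigma[OF I(1) fs])
      have "psum p F (q g) \<le> psum p (\<Union>i\<in>I. cell i) (q g)"
        using F I fU by (intro psum_mono) (auto simp: Fpow_def)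
      also have "\<dots> = (\<Sum>i\<in>I. \<Sum>j\<in>cell i. \<bar>var_project p w (cell i) (\<lambda>\<xi>. g (i, \<xi>)) j\<bar> powr p)"
        unfolding psum_cells[OF I(1)] by (intro sum.cong refl) (simp add: qg)
      also have "\<dots> \<le> psum p ?G g"
        unfolding G by (intro sum_mono var_project_bound_p p fc wc)
      finally have 1: "psum p F (q g) \<le> psum p ?G g" .
      have "qsum p c w F (q g) \<le> qsum p c w (\<Union>i\<in>I. cell i) (q g)"
        using F I fU p0 by (intro qsum_mono) (auto simp: Fpow_def)
      also have "\<dots> = (\<Sum>i\<in>I. (\<Sum>j\<in>cell i. (w j * var_project p w (cell i) (\<lambda>\<xi>. g (i, \<xi>)) j)\<^sup>2) powr (p / 2))"
        unfolding qsum_cells[OF I(1)]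
        by (intro sum.cong refl arg_cong[where f = "\<lambda>t. t powr (p / 2)"]) (simp add: qg)
      also have "\<dots> \<le> psum p ?G g"
        unfolding G by (intro sum_mono var_project_bound_2 p fc wc)
      finally have 2: "qsum p c w F (q g) \<le> psum p ?G g" .
      from 1 2 show ?thesis
        unfolding secn_singletons by (simp add: secn_def)
    qed
    moreover have "?G \<in> Fpow \<Omega>"
      using I(1,2) fs by (auto simp: Fpow_def \<Omega>_def)
    ultimately show "\<exists>G\<in>Fpow \<Omega>. \<forall>g. secn p c w F (q g) \<le> 1 * secn p (\<lambda>j. j) (\<lambda>_. 1) G g"
      by blast
  qed (auto simp: q_def fun_eq_iff lin_q scaleR_fun_def)
  have "q (e x) = x" if x: "x \<in> vecs (cell_space p Q c w)" for x
  proof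
    fix j
    show "q (e x) j = x j"
    proof (cases "j \<in> Q")
      case True
      then have jc: "j \<in> cell (c j)"
        by (simp add: cell_def)
      have "var_project p w (cell (c j)) (\<lambda>\<xi>. e x (c j, \<xi>)) j =
          var_project p w (cell (c j)) (var_embed p w (cell (c j)) x) j"
        unfolding var_project_def using True by (simp add: e_def \<Omega>_def cong: sum.cong)
      then show ?thesis
        using True var_project_embed[OF p fc wc jc] by (simp add: q_def)
    qed (use cell_space_off[OF x] in \<open>simp add: q_def\<close>)
  qed
  with e q have 1: "cell_space p Q c w \<unlhd>\<^sub>B ell p \<Omega>"
    unfolding complemented_def by blast
  have "countable \<Omega>"
    unfolding \<Omega>_def using Q fs by (intro countable_SIGMA countable_image) (auto intro: countable_finite)
  then have "bij_betw (to_nat_on \<Omega>) \<Omega> (to_nat_on \<Omega> ` \<Omega>)"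
    by (auto simp: bij_betw_def)
  then have "ell p \<Omega> \<cong>\<^sub>B ell p (to_nat_on \<Omega> ` \<Omega>)"
    by (rule ell_reindex[OF p0(1)])
  then have "ell p \<Omega> \<unlhd>\<^sub>B ell p (to_nat_on \<Omega> ` \<Omega>)"
    by (rule lin_iso_imp_complemented)
  moreover have "ell p (to_nat_on \<Omega> ` \<Omega>) \<unlhd>\<^sub>B ell p (UNIV :: nat set)"
    by (rule cell_space_subset_complemented[OF p0(1)]) simp
  ultimately have "ell p \<Omega> \<unlhd>\<^sub>B ell p (UNIV :: nat set)"
    by (rule complemented_trans) (rule normed_cell_space[OF p0(2)])
  with 1 show ?thesis
    by (rule complemented_trans) (rule normed_cell_space[OF p0(2)])
qed

text \<open>
  This is Hoelder's inequality with exponents \<open>p/2\<close> and \<open>p/(p-2)\<close> on each cell; \<open>r\<close> is the exponent of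
  the weights that results.
\<close>

lemma qsum_le_psum:
  assumes p: "2 < p" and F: "finite F" and M: "0 \<le> M"
    and le: "\<And>i. (\<Sum>j | j \<in> F \<and> c j = i. w j powr rexp p) \<le> M"
  shows "qsum p c w F x \<le> M powr (p / 2 - 1) * psum p F x"
proof -
  have cell: "(\<Sum>j | j \<in> F \<and> c j = i. (w j * x j)\<^sup>2) powr (p / 2) \<le>
      M powr (p / 2 - 1) * (\<Sum>j | j \<in> F \<and> c j = i. \<bar>x j\<bar> powr p)" for i
  proof -
    let ?E = "{j. j \<in> F \<and> c j = i}" and ?Q = "p / (p - 2)"
    have Q: "1 / ?Q = 1 - 2 / p" "1 < ?Q" "1 / (p / 2) + 1 / ?Q = 1"
      using p by (auto simp: field_simps)
    have "\<bar>w j\<bar> powr rexp p = w j powr rexp p" for j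
      using uminus_powr_eq[of "w j" "rexp p"] by (simp add: abs_if)
    then have pow: "\<bar>(x j)\<^sup>2\<bar> powr (p / 2) = \<bar>x j\<bar> powr p" "\<bar>(w j)\<^sup>2\<bar> powr ?Q = w j powr rexp p" for j
      using powr_powr[of "\<bar>x j\<bar>" 2 "p / 2"] powr_powr[of "\<bar>w j\<bar>" 2 ?Q] by (simp_all add: rexp_def)
    have "(\<Sum>j\<in>?E. (w j * x j)\<^sup>2) = (\<Sum>j\<in>?E. \<bar>(x j)\<^sup>2 * (w j)\<^sup>2\<bar>)"
      by (simp add: power_mult_distrib mult.commute)
    also have "\<dots> \<le> (\<Sum>j\<in>?E. \<bar>(x j)\<^sup>2\<bar> powr (p / 2)) powr (1 / (p / 2)) *
        (\<Sum>j\<in>?E. \<bar>(w j)\<^sup>2\<bar> powr ?Q) powr (1 / ?Q)"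
      using p Q F by (intro Hoelder_sum) auto
    also have "\<dots> = (\<Sum>j\<in>?E. \<bar>x j\<bar> powr p) powr (2 / p) * (\<Sum>j\<in>?E. w j powr rexp p) powr (1 - 2 / p)"
      unfolding pow Q(1) by simp
    also have "\<dots> \<le> (\<Sum>j\<in>?E. \<bar>x j\<bar> powr p) powr (2 / p) * M powr (1 - 2 / p)"
      using p le by (intro mult_left_mono powr_mono2) (auto intro!: sum_nonneg)
    finally have "(\<Sum>j\<in>?E. (w j * x j)\<^sup>2) powr (p / 2) \<le>
        ((\<Sum>j\<in>?E. \<bar>x j\<bar> powr p) powr (2 / p) * M powr (1 - 2 / p)) powr (p / 2)"
      using p by (intro powr_mono2) (auto intro!: sum_nonneg)
    also have "\<dots> = (\<Sum>j\<in>?E. \<bar>x j\<bar> powr p) powr (2 / p * (p / 2)) * M powr ((1 - 2 / p) * (p / 2))"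
      by (simp only: powr_mult powr_powr)
    also have "(1 - 2 / p) * (p / 2) = p / 2 - 1"
      using p by (simp add: field_simps)
    also have "2 / p * (p / 2) = 1"
      using p by simp
    finally show ?thesis
      by (simp add: mult.commute sum_nonneg)
  qed
  have "qsum p c w F x \<le> (\<Sum>i\<in>c ` F. M powr (p / 2 - 1) * (\<Sum>j | j \<in> F \<and> c j = i. \<bar>x j\<bar> powr p))"
    unfolding qsum_def by (intro sum_mono cell)
  also have "\<dots> = M powr (p / 2 - 1) * psum p F x"
    unfolding psum_def by (simp only: sum_distrib_left[symmetric] sum.image_gen[OF F, of _ c])
  finally show ?thesis .
qed

lemma small_cells_iso_ell:
  assumes p: "2 < p" and M: "0 \<le> M"
    and le: "\<And>F i. F \<in> Fpow J \<Longrightarrow> (\<Sum>j | j \<in> F \<and> c j = i. w j powr rexp p) \<le> M"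
  shows "cell_space p J c w \<cong>\<^sub>B ell p J"
proof (rule cell_space_iso_same)
  fix F :: "'a set" and x assume F: "F \<in> Fpow J"
  then show "secn p (\<lambda>j. j) (\<lambda>_. 1) F x \<le> 1 * secn p c w F x"
    by (simp add: secn_singletons) (simp add: secn_def)
  have "qsum p c w F x \<le> M powr (p / 2 - 1) * psum p F x"
    using F by (intro qsum_le_psum p M le) (auto simp: Fpow_def)
  also have "\<dots> \<le> (1 + M powr (p / 2 - 1)) * psum p F x"
    by (intro mult_right_mono) auto
  finally have "qsum p c w F x \<le> (1 + M powr (p / 2 - 1)) * psum p F x" .
  moreover have "psum p F x \<le> (1 + M powr (p / 2 - 1)) * psum p F x"
    using mult_right_mono[of 1 "1 + M powr (p / 2 - 1)" "psum p F x"] by simp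
  ultimately show "secn p c w F x \<le> (1 + M powr (p / 2 - 1)) * secn p (\<lambda>j. j) (\<lambda>_. 1) F x"
    by (simp add: secn_singletons) (simp add: secn_def)
qed (use p in \<open>auto intro!: add_nonneg_nonneg\<close>)

lemma injective_cells_iso_ell:
  assumes p: "2 < p" and inj: "inj_on c J" and w: "\<And>j. j \<in> J \<Longrightarrow> 0 < w j \<and> w j \<le> 1"
  shows "cell_space p J c w \<cong>\<^sub>B ell p J"
proof (rule small_cells_iso_ell[OF p zero_le_one])
  fix F i assume F: "F \<in> Fpow J"
  show "(\<Sum>j | j \<in> F \<and> c j = i. w j powr rexp p) \<le> 1"
  proof (cases "\<exists>j\<in>F. c j = i")
    case True
    then obtain j where j: "j \<in> F" "c j = i" by blast
    then have "{j. j \<in> F \<and> c j = i} = {j}"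
      using F inj by (auto simp: Fpow_def inj_on_def)
    moreover have "w j powr rexp p \<le> 1"
      using w[of j] F j rexp_pos[OF p] by (intro powr_le1) (auto simp: Fpow_def)
    ultimately show ?thesis by simp
  next
    case False
    then have "{j. j \<in> F \<and> c j = i} = {}" by auto
    then show ?thesis by (simp only:) simp
  qed
qed

text \<open>
  The space is complemented in \<open>\<ell>\<^sub>p\<close>, even when repeated countably often, and hence absorbed by \<open>\<ell>\<^sub>p\<close>.  If
  it has infinitely many cells, then it also contains \<open>\<ell>\<^sub>p\<close> as a complemented subspace and absorbs it.
\<close>

lemma finite_cells_iso_ell:
  fixes Q :: "'a set" and c :: "'a \<Rightarrow> 'b"
  assumes p: "2 < p" and Q: "countable Q" and w: "\<And>j. j \<in> Q \<Longrightarrow> 0 < w j \<and> w j \<le> 1"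
    and fin: "\<And>i. finite {j. j \<in> Q \<and> c j = i}"
  shows "cell_space p Q c w \<cong>\<^sub>B ell p Q"
proof (cases "finite Q")
  case True
  have "(\<Sum>j | j \<in> F \<and> c j = i. w j powr rexp p) \<le> (\<Sum>j\<in>Q. w j powr rexp p)" if "F \<in> Fpow Q" for F i
    using that True by (intro sum_mono2) (auto simp: Fpow_def)
  then show ?thesis
    by (intro small_cells_iso_ell[OF p, where M = "\<Sum>j\<in>Q. w j powr rexp p"]) (auto intro!: sum_nonneg)
next
  case False
  let ?N = "UNIV :: nat set"
  have p0: "0 < p" "1 \<le> p" using p by auto
  note n = normed_cell_space[OF p0(2)]
  have "cell_space p (Q \<times> ?N) (\<lambda>z. (c (fst z), snd z)) (\<lambda>z. w (fst z)) \<unlhd>\<^sub>B ell p ?N"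
  proof (rule finite_cells_complemented[OF p])
    fix i :: "'b \<times> nat"
    have "{z. z \<in> Q \<times> ?N \<and> (c (fst z), snd z) = i} \<subseteq> {j. j \<in> Q \<and> c j = fst i} \<times> {snd i}"
      by auto
    then show "finite {z. z \<in> Q \<times> ?N \<and> (c (fst z), snd z) = i}"
      by (rule finite_subset) (use fin in auto)
  qed (use Q w in auto)
  then have 1: "ell p ?N \<cong>\<^sub>B ell p ?N \<oplus>\<^sub>B cell_space p Q c w"
    by (rule absorbs_separate[OF p0(2) n])
  \<comment> \<open>Conversely, one coordinate from each of the infinitely many cells spans a copy of \<open>\<ell>\<^sub>p\<close>.\<close>
  have "\<forall>i\<in>c ` Q. \<exists>j. j \<in> Q \<and> c j = i"
    by auto
  from bchoice[OF this] obtain s where s: "\<forall>i\<in>c ` Q. s i \<in> Q \<and> c (s i) = i"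
    by (rule exE)
  define R where "R = s ` c ` Q"
  have "\<forall>j\<in>R. j \<in> Q \<and> s (c j) = j"
    using s by (simp add: R_def)
  then have R: "R \<subseteq> Q" "inj_on c R"
    by (auto intro: inj_on_inverseI)
  have "infinite R"
  proof
    assume "finite R"
    moreover have "c ` R = c ` Q"
      unfolding R_def image_image using s by (intro image_cong[where g = "\<lambda>j. c j"]) auto
    ultimately have "finite (c ` Q)"
      using finite_imageI[of R c] by simp
    then have "finite (\<Union>i\<in>c ` Q. {j. j \<in> Q \<and> c j = i})"
      using fin by (intro finite_UN_I) auto
    also have "(\<Union>i\<in>c ` Q. {j. j \<in> Q \<and> c j = i}) = Q"
      by auto
    finally show False
      using False by simp
  qed
  have "cell_space p R c w \<cong>\<^sub>B ell p R"
    by (rule injective_cells_iso_ell[OF p R(2)]) (use R(1) w in auto)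
  then have R_ell: "cell_space p R c w \<cong>\<^sub>B ell p ?N"
    by (rule lin_iso_trans[OF _ ell_infinite_iso[OF p0(1) countable_subset[OF R(1) Q] \<open>infinite R\<close>] n])
  have "ell p (?N \<times> ?N) \<cong>\<^sub>B ell p ?N"
    by (intro ell_infinite_iso p0) (auto simp: finite_prod)
  then have "ell p (?N \<times> ?N) \<cong>\<^sub>B cell_space p R c w"
    by (rule lin_iso_trans[OF _ lin_iso_sym[OF R_ell] n])
  then have "ell p (?N \<times> ?N) \<unlhd>\<^sub>B cell_space p Q c w"
    by (intro complemented_trans[OF lin_iso_imp_complemented cell_space_subset_complemented[OF p0(1) R(1)] n])
  then have "cell_space p Q c w \<cong>\<^sub>B cell_space p Q c w \<oplus>\<^sub>B ell p ?N"
    by (intro absorbs_separate[OF p0(2) n]) simp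
  then have "cell_space p Q c w \<cong>\<^sub>B ell p ?N"
    by (rule mutual_absorption[OF _ 1 n n])
  then show ?thesis
    by (rule lin_iso_trans[OF _ lin_iso_sym[OF ell_infinite_iso[OF p0(1) Q False]] n])
qed

text \<open>
  In a cell with \<open>\<Sum>w\<^sup>r < \<infinity>\<close>, all but finitely many coordinates have \<open>\<Sum>w\<^sup>r \<le> 1\<close>, and there the
  weighted \<open>\<ell>\<^sub>2\<close>-norm is dominated by the \<open>\<ell>\<^sub>p\<close>-norm.  The finite sets that remain need not have bounded
  size; their \<open>\<ell>\<^sub>p\<close>-sum is nevertheless \<open>\<ell>\<^sub>p\<close>, by Rosenthal's inequality.
\<close>

lemma summable_cells_iso_ell:
  fixes Q :: "'a set" and c :: "'a \<Rightarrow> 'b"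
  assumes p: "2 < p" and Q: "countable Q" and w: "\<And>j. j \<in> Q \<Longrightarrow> 0 < w j \<and> w j \<le> 1"
    and sm: "\<And>i. (\<lambda>j. w j powr rexp p) summable_on {j. j \<in> Q \<and> c j = i}"
  shows "cell_space p Q c w \<cong>\<^sub>B ell p Q"
proof -
  have p0: "0 < p" "1 \<le> p" using p by auto
  note n = normed_cell_space[OF p0(2)]
  let ?f = "\<lambda>j. w j powr rexp p"
  have "\<forall>i. \<exists>E. finite E \<and> E \<subseteq> {j. j \<in> Q \<and> c j = i} \<and>
      (\<forall>F. finite F \<longrightarrow> F \<subseteq> {j. j \<in> Q \<and> c j = i} - E \<longrightarrow> sum ?f F \<le> 1)"
  proof
    fix i
    let ?C = "{j. j \<in> Q \<and> c j = i}"
    have "\<exists>E. finite E \<and> E \<subseteq> ?C \<and> infsum ?f ?C - 1 \<le> sum ?f E"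
    proof (rule ccontr)
      assume "\<not> ?thesis"
      then have "infsum ?f ?C \<le> infsum ?f ?C - 1"
        by (intro infsum_le_finite_sums sm) (meson linear)
      then show False by simp
    qed
    then obtain E where E: "finite E" "E \<subseteq> ?C" "infsum ?f ?C - 1 \<le> sum ?f E"
      by blast
    have "sum ?f F \<le> 1" if F: "finite F" "F \<subseteq> ?C - E" for F
    proof -
      have "sum ?f E + sum ?f F = sum ?f (E \<union> F)"
        using E F by (intro sum.union_disjoint[symmetric]) auto
      also have "\<dots> \<le> infsum ?f ?C"
        using E F by (intro finite_sum_le_infsum sm) auto
      finally show ?thesis
        using E(3) by simp
    qed
    with E show "\<exists>E. finite E \<and> E \<subseteq> ?C \<and> (\<forall>F. finite F \<longrightarrow> F \<subseteq> ?C - E \<longrightarrow> sum ?f F \<le> 1)"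
      by (intro exI[of _ E]) simp
  qed
  from choice[OF this] obtain E where E': "\<forall>i. finite (E i) \<and> E i \<subseteq> {j. j \<in> Q \<and> c j = i} \<and>
      (\<forall>F. finite F \<longrightarrow> F \<subseteq> {j. j \<in> Q \<and> c j = i} - E i \<longrightarrow> sum ?f F \<le> 1)"
    by (rule exE)
  then have E: "finite (E i)" "E i \<subseteq> {j. j \<in> Q \<and> c j = i}"
    "finite F \<Longrightarrow> F \<subseteq> {j. j \<in> Q \<and> c j = i} - E i \<Longrightarrow> sum ?f F \<le> 1" for i F
    by blast+
  define H where "H = {j \<in> Q. j \<in> E (c j)}"
  have QH: "Q = H \<union> (Q - H)" "H \<inter> (Q - H) = {}"
    by (auto simp: H_def)
  have "cell_space p H c w \<cong>\<^sub>B ell p H"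
  proof (rule finite_cells_iso_ell[OF p])
    show "finite {j. j \<in> H \<and> c j = i}" for i
      by (rule finite_subset[OF _ E(1)[of i]]) (auto simp: H_def)
  qed (use w countable_subset[OF _ Q] in \<open>auto simp: H_def\<close>)
  moreover have "cell_space p (Q - H) c w \<cong>\<^sub>B ell p (Q - H)"
  proof (rule small_cells_iso_ell[OF p zero_le_one])
    show "(\<Sum>j | j \<in> F \<and> c j = i. ?f j) \<le> 1" if "F \<in> Fpow (Q - H)" for F i
      using that by (intro E(3)[of _ i]) (auto simp: Fpow_def H_def)
  qed
  ultimately have 1: "cell_space p H c w \<oplus>\<^sub>B cell_space p (Q - H) c w \<cong>\<^sub>B ell p H \<oplus>\<^sub>B ell p (Q - H)"
    by (intro lin_iso_dsum_cong n)
  have 2: "cell_space p Q c w \<cong>\<^sub>B cell_space p H c w \<oplus>\<^sub>B cell_space p (Q - H) c w"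
    by (subst QH(1)) (rule cell_space_split[OF p0(2) QH(2)])
  have 3: "ell p Q \<cong>\<^sub>B ell p H \<oplus>\<^sub>B ell p (Q - H)"
    by (subst QH(1)) (rule cell_space_split[OF p0(2) QH(2)])
  show ?thesis
    by (rule lin_iso_trans[OF 2 lin_iso_trans[OF 1 lin_iso_sym[OF 3] normed_dsum[OF n n]] normed_dsum[OF n n]])
qed

section \<open>Rich cells\<close>

lemma rich_mono:
  assumes "rich p J c w i s" "s \<le> t" "J \<subseteq> J'"
  shows "rich p J' c w i t"
  unfolding rich_def
proof
  assume "(\<lambda>j. w j powr rexp p) summable_on {j. j \<in> J' \<and> c j = i \<and> w j powr rexp p \<le> t}"
  then have "(\<lambda>j. w j powr rexp p) summable_on {j. j \<in> J \<and> c j = i \<and> w j powr rexp p \<le> s}"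
    by (rule summable_on_subset_banach) (use assms in auto)
  with assms(1) show False
    by (simp add: rich_def)
qed

lemma not_rich_iff:
  "\<not> rich p J c w i s \<longleftrightarrow>
    (\<lambda>j. w j powr rexp p) summable_on {j. j \<in> J \<and> c j = i \<and> w j powr rexp p \<le> s}"
  by (simp add: rich_def)

lemma rich_infinite:
  assumes "rich p J c w i s"
  shows "infinite {j. j \<in> J \<and> c j = i}"
proof
  assume "finite {j. j \<in> J \<and> c j = i}"
  then have "finite {j. j \<in> J \<and> c j = i \<and> w j powr rexp p \<le> s}"
    by (rule finite_subset[rotated]) auto
  then show False
    using assms summable_on_finite by (auto simp: rich_def)
qed

lemma infinite_not_summable:
  fixes f :: "'a \<Rightarrow> real"
  assumes "infinite E" "0 < \<epsilon>" "\<And>j. j \<in> E \<Longrightarrow> \<epsilon> \<le> f j"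
  shows "\<not> f summable_on E"
proof
  assume sm: "f summable_on E"
  obtain n :: nat where n: "infsum f E < real n * \<epsilon>"
    using reals_Archimedean3[OF assms(2)] by blast
  obtain F where F: "F \<subseteq> E" "finite F" "card F = n"
    using infinite_arbitrarily_large[OF assms(1)] by blast
  have "real n * \<epsilon> = (\<Sum>j\<in>F. \<epsilon>)"
    using F by simp
  also have "\<dots> \<le> sum f F"
    using F assms(3) by (intro sum_mono) auto
  also have "\<dots> \<le> infsum f E"
    using F assms(2,3) by (intro finite_sum_le_infsum sm) (auto intro: order_trans[OF less_imp_le])
  finally show False
    using n by simp
qed

lemma rich_bounded_below:
  assumes "infinite {j. j \<in> J \<and> c j = i}" "0 < \<epsilon>"
    and "\<And>j. j \<in> J \<Longrightarrow> c j = i \<Longrightarrow> \<epsilon> \<le> w j powr rexp p \<and> w j powr rexp p \<le> s"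
  shows "rich p J c w i s"
proof -
  have "{j. j \<in> J \<and> c j = i \<and> w j powr rexp p \<le> s} = {j. j \<in> J \<and> c j = i}"
    using assms(3) by auto
  moreover have "\<not> (\<lambda>j. w j powr rexp p) summable_on {j. j \<in> J \<and> c j = i}"
    by (rule infinite_not_summable[OF assms(1,2)]) (use assms(3) in auto)
  ultimately show ?thesis
    unfolding rich_def by simp
qed

lemma slow_weights_rich:
  assumes v: "slow_weights p v" and "0 < s" and p: "2 < p"
  shows "\<not> (\<lambda>n. v n powr rexp p) summable_on {n. v n powr rexp p \<le> s}"
proof
  assume sm: "(\<lambda>n. v n powr rexp p) summable_on {n. v n powr rexp p \<le> s}"
  have v0: "0 < v n" for n
    using v by (simp add: slow_weights_def)
  have lim: "v \<longlonglongrightarrow> 0"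
    using v by (simp add: slow_weights_def)
  have "eventually (\<lambda>n. v n < s powr (1 / rexp p)) sequentially"
    using lim assms(2) by (intro order_tendstoD(2)[OF lim]) auto
  then have ev: "eventually (\<lambda>n. v n powr rexp p \<le> s) sequentially"
  proof eventually_elim
    case (elim n)
    have "v n powr rexp p \<le> (s powr (1 / rexp p)) powr rexp p"
      using elim v0[of n] rexp_pos[OF p] by (intro powr_mono2) auto
    then show ?case
      using assms(2) rexp_pos[OF p] by (simp add: powr_powr)
  qed
  then have "finite {n. \<not> v n powr rexp p \<le> s}"
    by (simp add: eventually_cofinite[symmetric] cofinite_eq_sequentially)
  then have "(\<lambda>n. v n powr rexp p) summable_on {n. \<not> v n powr rexp p \<le> s}"
    by (rule summable_on_finite)
  with sm have "(\<lambda>n. v n powr rexp p) summable_on ({n. v n powr rexp p \<le> s} \<union> {n. \<not> v n powr rexp p \<le> s})"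
    by (rule summable_on_Un_disjoint) auto
  also have "{n. v n powr rexp p \<le> s} \<union> {n. \<not> v n powr rexp p \<le> s} = UNIV"
    by auto
  finally have "summable (\<lambda>n. v n powr rexp p)"
    by (simp add: summable_on_UNIV_nonneg_real_iff)
  then show False
    using v by (simp add: slow_weights_def rexp_def)
qed

lemma infinite_slice: "infinite {z :: nat \<times> nat. z \<in> UNIV \<and> fst z = n}"
proof -
  have "{z. z \<in> UNIV \<and> fst z = n} = Pair n ` (UNIV :: nat set)"
    by (auto simp: image_iff)
  then show ?thesis
    by (simp add: finite_image_iff inj_on_def)
qed

lemma rich_slice:
  assumes "\<not> (\<lambda>m. u m powr rexp p) summable_on {m. u m powr rexp p \<le> s}"
  shows "rich p UNIV fst (\<lambda>z. u (snd z)) n s"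
  unfolding rich_def
proof
  assume "(\<lambda>z. u (snd z) powr rexp p) summable_on
    {z. z \<in> UNIV \<and> fst z = n \<and> u (snd z) powr rexp p \<le> s}"
  moreover have "{z. z \<in> UNIV \<and> fst z = n \<and> u (snd z) powr rexp p \<le> s} = Pair n ` {m. u m powr rexp p \<le> s}"
    by (auto simp: image_iff)
  ultimately have "(\<lambda>z. u (snd z) powr rexp p) summable_on Pair n ` {m. u m powr rexp p \<le> s}"
    by simp
  then have "(\<lambda>m. u m powr rexp p) summable_on {m. u m powr rexp p \<le> s}"
    by (subst (asm) summable_on_reindex) (auto simp: o_def inj_on_def)
  with assms show False ..
qed

text \<open>
  If each of two spaces provides rich cells for countably many copies of the other one, then each
  of them absorbs the other and they are isomorphic.
\<close>

lemma mutual_rich_separate: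
  assumes p: "2 < p" and J: "countable J" "countable J'"
    and w: "\<And>j. j \<in> J \<Longrightarrow> 0 < w j" "\<And>j. j \<in> J' \<Longrightarrow> 0 < w' j"
    and \<phi>: "inj_on \<phi> (c ` J \<times> (UNIV :: nat set))"
      "\<And>j n. j \<in> J \<Longrightarrow> rich p J' c' w' (\<phi> (c j, n)) (w j powr rexp p)"
    and \<psi>: "inj_on \<psi> (c' ` J' \<times> (UNIV :: nat set))"
      "\<And>j n. j \<in> J' \<Longrightarrow> rich p J c w (\<psi> (c' j, n)) (w' j powr rexp p)"
  shows "cell_space p J c w \<cong>\<^sub>B cell_space p J' c' w'"
proof -
  have p1: "1 \<le> p" using p by simp
  note n = normed_cell_space[OF p1]
  have "cell_space p (J \<times> (UNIV :: nat set)) (\<lambda>z. (c (fst z), snd z)) (\<lambda>z. w (fst z)) \<unlhd>\<^sub>B cell_space p J' c' w'"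
    by (rule rich_complemented[OF p, of _ \<phi>])
       (use J w in \<open>auto simp: \<phi>(2) intro!: inj_on_subset[OF \<phi>(1)]\<close>)
  then have 1: "cell_space p J' c' w' \<cong>\<^sub>B cell_space p J' c' w' \<oplus>\<^sub>B cell_space p J c w"
    by (rule absorbs_separate[OF p1 n])
  have "cell_space p (J' \<times> (UNIV :: nat set)) (\<lambda>z. (c' (fst z), snd z)) (\<lambda>z. w' (fst z)) \<unlhd>\<^sub>B cell_space p J c w"
    by (rule rich_complemented[OF p, of _ \<psi>])
       (use J w in \<open>auto simp: \<psi>(2) intro!: inj_on_subset[OF \<psi>(1)]\<close>)
  then have 2: "cell_space p J c w \<cong>\<^sub>B cell_space p J c w \<oplus>\<^sub>B cell_space p J' c' w'"
    by (rule absorbs_separate[OF p1 n])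
  show ?thesis
    by (rule mutual_absorption[OF 2 1 n n])
qed

lemma mutual_rich_single:
  fixes J :: "'a set" and J' :: "'b set"
  assumes p: "2 < p" and J: "countable J" "countable J'"
    and w: "\<And>j. j \<in> J \<Longrightarrow> 0 < w j" "\<And>j. j \<in> J' \<Longrightarrow> 0 < w' j"
    and rich: "\<And>t. 0 < t \<Longrightarrow> rich p J (\<lambda>_. ()) w () t" "\<And>t. 0 < t \<Longrightarrow> rich p J' (\<lambda>_. ()) w' () t"
  shows "cell_space p J (\<lambda>_. ()) w \<cong>\<^sub>B cell_space p J' (\<lambda>_. ()) w'"
proof -
  have p1: "1 \<le> p" using p by simp
  note n = normed_cell_space[OF p1]
  have r: "rich p J' (\<lambda>_. ()) w' () (w j powr rexp p)" if "j \<in> J" for j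
    using w(1)[OF that] by (intro rich(2)) simp
  have r': "rich p J (\<lambda>_. ()) w () (w' j powr rexp p)" if "j \<in> J'" for j
    using w(2)[OF that] by (intro rich(1)) simp
  have "cell_space p (J \<times> (UNIV :: nat set)) (\<lambda>z. ()) (\<lambda>z. w (fst z)) \<unlhd>\<^sub>B cell_space p J' (\<lambda>_. ()) w'"
  proof (rule rich_complemented[OF p, where \<phi> = "\<lambda>i. i"])
    fix k :: "'a \<times> nat" assume "k \<in> J \<times> UNIV"
    then have "fst k \<in> J" by auto
    then show "0 < w (fst k)" "rich p J' (\<lambda>_. ()) w' () (w (fst k) powr rexp p)"
      by (rule w(1), rule r)
  qed (use J in \<open>auto intro: w(2) inj_onI\<close>)
  then have 1: "cell_space p J' (\<lambda>_. ()) w' \<cong>\<^sub>B cell_space p J' (\<lambda>_. ()) w' \<oplus>\<^sub>B cell_space p J (\<lambda>_. ()) w"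
    by (rule absorbs_same[OF p1 n])
  have "cell_space p (J' \<times> (UNIV :: nat set)) (\<lambda>z. ()) (\<lambda>z. w' (fst z)) \<unlhd>\<^sub>B cell_space p J (\<lambda>_. ()) w"
  proof (rule rich_complemented[OF p, where \<phi> = "\<lambda>i. i"])
    fix k :: "'b \<times> nat" assume "k \<in> J' \<times> UNIV"
    then have "fst k \<in> J'" by auto
    then show "0 < w' (fst k)" "rich p J (\<lambda>_. ()) w () (w' (fst k) powr rexp p)"
      by (rule w(2), rule r')
  qed (use J in \<open>auto intro: w(1) inj_onI\<close>)
  then have 2: "cell_space p J (\<lambda>_. ()) w \<cong>\<^sub>B cell_space p J (\<lambda>_. ()) w \<oplus>\<^sub>B cell_space p J' (\<lambda>_. ()) w'"
    by (rule absorbs_same[OF p1 n])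
  show ?thesis
    by (rule mutual_absorption[OF 2 1 n n])
qed

section \<open>Equivalent partitions and weights\<close>

lemma qsum_weights_le:
  assumes "0 \<le> p" "0 \<le> C" "\<And>j. j \<in> F \<Longrightarrow> 0 \<le> w' j \<and> w' j \<le> C * w j"
  shows "qsum p c w' F x \<le> C powr p * qsum p c w F x"
proof -
  have "(\<Sum>j | j \<in> F \<and> c j = i. (w' j * x j)\<^sup>2) powr (p / 2) \<le>
      C powr p * (\<Sum>j | j \<in> F \<and> c j = i. (w j * x j)\<^sup>2) powr (p / 2)" for i
  proof -
    have "(\<Sum>j | j \<in> F \<and> c j = i. (w' j * x j)\<^sup>2) \<le> (\<Sum>j | j \<in> F \<and> c j = i. C\<^sup>2 * (w j * x j)\<^sup>2)"
    proof (rule sum_mono)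
      fix j assume "j \<in> {j. j \<in> F \<and> c j = i}"
      then have "(w' j)\<^sup>2 \<le> (C * w j)\<^sup>2"
        using assms(3)[of j] by (intro power_mono) auto
      then show "(w' j * x j)\<^sup>2 \<le> C\<^sup>2 * (w j * x j)\<^sup>2"
        using mult_right_mono[of "(w' j)\<^sup>2" "(C * w j)\<^sup>2" "(x j)\<^sup>2"] by (simp add: power_mult_distrib mult_ac)
    qed
    then have "(\<Sum>j | j \<in> F \<and> c j = i. (w' j * x j)\<^sup>2) powr (p / 2) \<le>
        (C\<^sup>2 * (\<Sum>j | j \<in> F \<and> c j = i. (w j * x j)\<^sup>2)) powr (p / 2)"
      unfolding sum_distrib_left[symmetric] using assms(1) by (intro powr_mono2) (auto intro: sum_nonneg)
    also have "\<dots> = C powr p * (\<Sum>j | j \<in> F \<and> c j = i. (w j * x j)\<^sup>2) powr (p / 2)"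
      using powr_powr[of C 2 "p / 2"] assms(2) by (simp add: powr_mult)
    finally show ?thesis .
  qed
  then show ?thesis
    unfolding qsum_def sum_distrib_left by (intro sum_mono)
qed

lemma cell_space_weights_iso:
  assumes p: "0 < p" and C: "0 \<le> C"
    and w: "\<And>j. j \<in> J \<Longrightarrow> 0 \<le> w j \<and> 0 \<le> w' j \<and> w' j \<le> C * w j \<and> w j \<le> C * w' j"
  shows "cell_space p J c w \<cong>\<^sub>B cell_space p J c w'"
proof (rule cell_space_iso_same[OF p, of "1 + C powr p" "1 + C powr p"])
  have *: "secn p c w' F x \<le> (1 + C powr p) * secn p c w F x"
    if "\<And>j. j \<in> F \<Longrightarrow> 0 \<le> w' j \<and> w' j \<le> C * w j" for F w w' and x :: "'a \<Rightarrow> real"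
  proof -
    have "qsum p c w' F x \<le> C powr p * qsum p c w F x"
      using p C that by (intro qsum_weights_le) auto
    also have "\<dots> \<le> C powr p * secn p c w F x"
      by (intro mult_left_mono) (auto simp: secn_def)
    also have "\<dots> \<le> (1 + C powr p) * secn p c w F x"
      by (intro mult_right_mono) auto
    finally have "qsum p c w' F x \<le> (1 + C powr p) * secn p c w F x" .
    moreover have "psum p F x \<le> (1 + C powr p) * secn p c w F x"
    proof -
      have "psum p F x \<le> 1 * secn p c w F x"
        by (simp add: secn_def)
      also have "\<dots> \<le> (1 + C powr p) * secn p c w F x"
        by (intro mult_right_mono) auto
      finally show ?thesis .
    qed
    ultimately show ?thesis
      unfolding secn_def[of p c w'] by simp
  qed
  show "secn p c w' F x \<le> (1 + C powr p) * secn p c w F x" if "F \<in> Fpow J" for F and x :: "'a \<Rightarrow> real"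
    using that w by (intro *) (auto simp: Fpow_def)
  show "secn p c w F x \<le> (1 + C powr p) * secn p c w' F x" if "F \<in> Fpow J" for F and x :: "'a \<Rightarrow> real"
    using that w by (intro *) (auto simp: Fpow_def)
qed auto

lemma bounded_below_weights_iso:
  assumes p: "0 < p" and a: "0 < a" and w: "\<And>j. j \<in> J \<Longrightarrow> a \<le> w j \<and> w j \<le> 1"
  shows "cell_space p J c w \<cong>\<^sub>B cell_space p J c (\<lambda>_. 1)"
proof (rule cell_space_weights_iso[OF p])
  show "0 \<le> 1 + 1 / a"
    using a by simp
  fix j assume j: "j \<in> J"
  have "1 = 1 / a * a"
    using a by simp
  also have "\<dots> \<le> (1 + 1 / a) * w j"
    using w[OF j] a by (intro mult_mono) auto
  finally have "1 \<le> (1 + 1 / a) * w j" .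
  moreover have "w j \<le> (1 + 1 / a) * 1"
    using w[OF j] a by (auto intro: order_trans[of _ 1])
  ultimately show "0 \<le> w j \<and> 0 \<le> (1::real) \<and> 1 \<le> (1 + 1 / a) * w j \<and> w j \<le> (1 + 1 / a) * 1"
    using w[OF j] a by simp
qed

text \<open>
  For finitely many numbers the norms of \<open>\<ell>\<^sub>p\<close> and \<open>\<ell>\<^sub>2\<close> are equivalent, with a constant that depends
  on how many there are.
\<close>

lemma cell_space_merge:
  fixes J :: "'a set"
  assumes p: "2 < p" and fin: "finite (c ` J)"
  shows "cell_space p J c w \<cong>\<^sub>B cell_space p J (\<lambda>_. ()) w"
proof -
  define N where "N = real (card (c ` J)) + 1"
  have N: "1 \<le> N" by (simp add: N_def)
  have p0: "0 < p" using p by simp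
  have NN: "N \<le> N powr (p / 2) * N"
    using mult_right_mono[of 1 "N powr (p / 2)" N] ge_one_powr_ge_zero[of N "p / 2"] N p by simp
  have NN': "N powr (p / 2) \<le> N powr (p / 2) * N" "1 \<le> N powr (p / 2) * N"
    using mult_left_mono[of 1 N "N powr (p / 2)"] order_trans[OF N NN] N by simp_all
  let ?K = "N powr (p / 2) * N"
  have main: "qsum p c w F x \<le> ?K * qsum p (\<lambda>_. ()) w F x \<and> qsum p (\<lambda>_. ()) w F x \<le> ?K * qsum p c w F x"
    if F: "F \<in> Fpow J" for F x
  proof (cases "F = {}")
    case True
    then show ?thesis by (simp add: qsum_def)
  next
    case False
    have F': "finite F" "c ` F \<subseteq> c ` J"
      using F by (auto simp: Fpow_def)
    define S where "S i = (\<Sum>j | j \<in> F \<and> c j = i. (w j * x j)\<^sup>2)" for i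
    have S0: "0 \<le> S i" for i
      by (simp add: S_def sum_nonneg)
    have q1: "qsum p c w F x = (\<Sum>i\<in>c ` F. S i powr (p / 2))"
      by (simp add: qsum_def S_def)
    have "(\<Sum>j\<in>F. (w j * x j)\<^sup>2) = (\<Sum>i\<in>c ` F. S i)"
      unfolding S_def by (rule sum.image_gen[OF F'(1)])
    moreover have "(\<lambda>_. ()) ` F = {()}"
      using False by auto
    ultimately have q2: "qsum p (\<lambda>_. ()) w F x = (\<Sum>i\<in>c ` F. S i) powr (p / 2)"
      unfolding qsum_def by (simp only:) simp
    have cardN: "real (card (c ` F)) \<le> N"
      using card_mono[OF fin F'(2)] by (simp add: N_def)
    have "qsum p c w F x \<le> (\<Sum>i\<in>c ` F. qsum p (\<lambda>_. ()) w F x)"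
      unfolding q1 q2
    proof (rule sum_mono)
      fix i assume "i \<in> c ` F"
      then have "S i \<le> (\<Sum>i\<in>c ` F. S i)"
        using F' S0 by (intro member_le_sum) auto
      then show "S i powr (p / 2) \<le> (\<Sum>i\<in>c ` F. S i) powr (p / 2)"
        using p S0 by (intro powr_mono2) auto
    qed
    also have "\<dots> \<le> N * qsum p (\<lambda>_. ()) w F x"
      using cardN by (simp add: mult_right_mono)
    also have "\<dots> \<le> ?K * qsum p (\<lambda>_. ()) w F x"
      by (intro mult_right_mono NN) auto
    finally have 1: "qsum p c w F x \<le> ?K * qsum p (\<lambda>_. ()) w F x" .
    have "Max (S ` c ` F) \<in> S ` c ` F"
      using F' False by (intro Max_in) auto
    then obtain i where i: "Max (S ` c ` F) = S i" "i \<in> c ` F"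
      by (rule imageE)
    have "S k \<le> S i" if "k \<in> c ` F" for k
      unfolding i(1)[symmetric] using F' that by (intro Max_ge) auto
    then have "(\<Sum>k\<in>c ` F. S k) \<le> (\<Sum>k\<in>c ` F. S i)"
      by (intro sum_mono)
    also have "\<dots> \<le> N * S i"
      using cardN S0 by (simp add: mult_right_mono)
    finally have "qsum p (\<lambda>_. ()) w F x \<le> (N * S i) powr (p / 2)"
      unfolding q2 using p S0 by (intro powr_mono2) (auto intro: sum_nonneg)
    also have "\<dots> = N powr (p / 2) * S i powr (p / 2)"
      by (rule powr_mult)
    also have "\<dots> \<le> N powr (p / 2) * qsum p c w F x"
      unfolding q1 using F' i(2) by (intro mult_left_mono member_le_sum) auto
    also have "\<dots> \<le> ?K * qsum p c w F x"
      by (intro mult_right_mono NN') auto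
    finally show ?thesis
      using 1 by blast
  qed
  have P: "psum p F x \<le> ?K * psum p F x" for F and x :: "'a \<Rightarrow> real"
    using mult_right_mono[OF NN'(2), of "psum p F x"] by simp
  have K0: "0 \<le> ?K" using NN'(2) by simp

  show ?thesis
  proof (rule cell_space_iso_same[OF p0 K0 K0])
    fix F :: "'a set" and x assume F: "F \<in> Fpow J"
    have "?K * psum p F x \<le> ?K * secn p c w F x" "?K * qsum p c w F x \<le> ?K * secn p c w F x"
      "?K * psum p F x \<le> ?K * secn p (\<lambda>_. ()) w F x"
      "?K * qsum p (\<lambda>_. ()) w F x \<le> ?K * secn p (\<lambda>_. ()) w F x"
      by (intro mult_left_mono K0, simp add: secn_def)+
    note le = this main[OF F, of x] P[of F x]
    have "psum p F x \<le> ?K * secn p c w F x" "qsum p (\<lambda>_. ()) w F x \<le> ?K * secn p c w F x"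
      using le by linarith+
    then show "secn p (\<lambda>_. ()) w F x \<le> ?K * secn p c w F x"
      unfolding secn_def[of p "\<lambda>_. ()"] by (rule max.boundedI)
    have "psum p F x \<le> ?K * secn p (\<lambda>_. ()) w F x" "qsum p c w F x \<le> ?K * secn p (\<lambda>_. ()) w F x"
      using le by linarith+
    then show "secn p c w F x \<le> ?K * secn p (\<lambda>_. ()) w F x"
      unfolding secn_def[of p c] by (rule max.boundedI)
  qed
qed

section \<open>The isomorphism types\<close>

abbreviation "Xp_cell p v \<equiv> cell_space p (UNIV :: nat set) (\<lambda>_. ()) v"
abbreviation "l2_cell p \<equiv> cell_space p (UNIV :: nat set) (\<lambda>_. ()) (\<lambda>_. 1)"
abbreviation "Bp_cell p \<equiv>
  cell_space p (UNIV :: (nat \<times> nat) set) fst (\<lambda>z. real (Suc (fst z)) powr (- (1 / rexp p)))"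
abbreviation "sum_l2_cell p \<equiv> cell_space p (UNIV :: (nat \<times> nat) set) fst (\<lambda>_. 1)"
abbreviation "sum_Xp_cell p v \<equiv> cell_space p (UNIV :: (nat \<times> nat) set) fst (\<lambda>z. v (snd z))"

lemma l2_case:
  assumes p: "2 < p" and J: "countable J" "infinite J" and fin: "finite (c ` J)"
    and a: "0 < a" and w: "\<And>j. j \<in> J \<Longrightarrow> a \<le> w j \<and> w j \<le> 1"
  shows "cell_space p J c w \<cong>\<^sub>B l2_cell p"
proof -
  have p0: "0 < p" "1 \<le> p" using p by auto
  note n = normed_cell_space[OF p0(2)]
  have 1: "cell_space p J c w \<cong>\<^sub>B cell_space p J (\<lambda>_. ()) w"
    by (rule cell_space_merge[OF p fin])
  have 2: "cell_space p J (\<lambda>_. ()) w \<cong>\<^sub>B cell_space p J (\<lambda>_. ()) (\<lambda>_. 1)"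
    by (rule bounded_below_weights_iso[OF p0(1) a w])
  have 3: "cell_space p J (\<lambda>_. ()) (\<lambda>_. 1) \<cong>\<^sub>B l2_cell p"
    by (rule cell_space_reindex[OF p0(1) to_nat_on_infinite[OF J]]) auto
  show ?thesis
    by (rule lin_iso_trans[OF 1 lin_iso_trans[OF 2 3 n] n])
qed

text \<open>
  Singleton cells, collected in \<open>Q\<close>, may be put into one cell with summable values of \<open>w\<^sup>r\<close>, since both
  arrangements give \<open>\<ell>\<^sub>p\<close>.  With finitely many further cells the whole space can thus be merged into a
  single cell, and it is isomorphic to \<open>X\<^sub>p\<close> because that cell is rich at all levels.
\<close>

lemma Xp_case:
  assumes p: "2 < p" and J: "countable J" and QJ: "Q \<subseteq> J" and inj: "inj_on c Q"
    and w: "\<And>j. j \<in> J \<Longrightarrow> 0 < w j \<and> w j \<le> 1" and fin: "finite (c ` (J - Q))"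
    and rich: "\<And>t. 0 < t \<Longrightarrow> rich p (J - Q) c w i t" and v: "slow_weights p v"
  shows "cell_space p J c w \<cong>\<^sub>B Xp_cell p v"
proof -
  have p0: "0 < p" "1 \<le> p" using p by auto
  note n = normed_cell_space[OF p0(2)]
  have r: "0 < rexp p" by (rule rexp_pos[OF p])
  have Q: "countable Q"
    using countable_subset[OF QJ J] .
  have JQ: "J = (J - Q) \<union> Q" "(J - Q) \<inter> Q = {}"
    using QJ by auto
  define g where "g j = ((1 / 2) ^ to_nat_on Q j) powr (1 / rexp p)" for j
  define w' where "w' j = (if j \<in> Q then g j else w j)" for j
  have gr: "g j powr rexp p = (1 / 2) ^ to_nat_on Q j" for j
    using r by (simp add: g_def powr_powr)
  have Qell: "cell_space p Q c w \<cong>\<^sub>B ell p Q"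
    by (rule injective_cells_iso_ell[OF p inj]) (use QJ w in auto)
  have Qell': "cell_space p Q (\<lambda>_. ()) w' \<cong>\<^sub>B ell p Q"
  proof (rule small_cells_iso_ell[OF p, of 2])
    fix F and k :: unit assume F: "F \<in> Fpow Q"
    have inj: "inj_on (to_nat_on Q) F"
      using F inj_on_to_nat_on[OF Q] by (auto simp: Fpow_def intro: inj_on_subset)
    have "(\<Sum>j | j \<in> F \<and> () = k. w' j powr rexp p) = (\<Sum>j\<in>F. (1 / 2) ^ to_nat_on Q j)"
      using F by (intro sum.cong) (auto simp: w'_def gr Fpow_def)
    also have "\<dots> = (\<Sum>n\<in>to_nat_on Q ` F. (1 / 2) ^ n)"
      by (simp add: sum.reindex[OF inj])
    also have "\<dots> \<le> (\<Sum>n. (1 / 2) ^ n)"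
      using F by (intro sum_le_suminf) (auto simp: Fpow_def)
    also have "\<dots> = (2::real)"
      by (simp add: suminf_geometric)
    finally show "(\<Sum>j | j \<in> F \<and> () = k. w' j powr rexp p) \<le> 2" .
  qed simp
  have "cell_space p (J - Q) (\<lambda>_. ()) w \<cong>\<^sub>B cell_space p (J - Q) (\<lambda>_. ()) w'"
    by (rule cell_space_cong[OF p0(1)]) (auto simp: w'_def)
  with cell_space_merge[OF p fin]
  have A: "cell_space p (J - Q) c w \<cong>\<^sub>B cell_space p (J - Q) (\<lambda>_. ()) w'"
    by (rule lin_iso_trans) (rule n)
  have B: "cell_space p Q c w \<cong>\<^sub>B cell_space p Q (\<lambda>_. ()) w'"
    by (rule lin_iso_trans[OF Qell lin_iso_sym[OF Qell'] n])
  have 1: "cell_space p J c w \<cong>\<^sub>B cell_space p (J - Q) c w \<oplus>\<^sub>B cell_space p Q c w"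
    by (subst JQ(1)) (rule cell_space_split[OF p0(2) JQ(2)])
  have 2: "cell_space p J (\<lambda>_. ()) w' \<cong>\<^sub>B cell_space p (J - Q) (\<lambda>_. ()) w' \<oplus>\<^sub>B cell_space p Q (\<lambda>_. ()) w'"
    by (subst JQ(1)) (rule cell_space_split[OF p0(2) JQ(2)])
  have 3: "cell_space p (J - Q) c w \<oplus>\<^sub>B cell_space p Q c w \<cong>\<^sub>B
      cell_space p (J - Q) (\<lambda>_. ()) w' \<oplus>\<^sub>B cell_space p Q (\<lambda>_. ()) w'"
    by (rule lin_iso_dsum_cong[OF A B n n n n])
  have 4: "cell_space p J c w \<cong>\<^sub>B cell_space p J (\<lambda>_. ()) w'"
    by (rule lin_iso_trans[OF 1 lin_iso_trans[OF 3 lin_iso_sym[OF 2] normed_dsum[OF n n]] normed_dsum[OF n n]])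
  have "cell_space p J (\<lambda>_. ()) w' \<cong>\<^sub>B Xp_cell p v"
  proof (rule mutual_rich_single[OF p J])
    show "0 < w' j" if "j \<in> J" for j
      using w[OF that] by (simp add: w'_def g_def)
    show "0 < v n" for n
      using v by (simp add: slow_weights_def)
    show "rich p UNIV (\<lambda>_. ()) v () t" if "0 < t" for t
      using slow_weights_rich[OF v that p] by (simp add: rich_def)
    show "rich p J (\<lambda>_. ()) w' () t" if t: "0 < t" for t
      unfolding rich_def
    proof
      assume "(\<lambda>j. w' j powr rexp p) summable_on {j. j \<in> J \<and> () = () \<and> w' j powr rexp p \<le> t}"
      then have "(\<lambda>j. w' j powr rexp p) summable_on {j. j \<in> J - Q \<and> c j = i \<and> w j powr rexp p \<le> t}"
        by (rule summable_on_subset_banach) (auto simp: w'_def)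
      then have "(\<lambda>j. w j powr rexp p) summable_on {j. j \<in> J - Q \<and> c j = i \<and> w j powr rexp p \<le> t}"
        by (rule summable_on_cong[THEN iffD1, rotated]) (auto simp: w'_def)
      with rich[OF t] show False
        by (simp add: rich_def)
    qed
  qed simp
  with 4 show ?thesis
    by (rule lin_iso_trans) (rule n)
qed

section \<open>The classification\<close>

lemma inj_choice:
  assumes "countable Z" "\<And>z. z \<in> Z \<Longrightarrow> infinite (S z)"
  obtains \<phi> where "inj_on \<phi> Z" "\<And>z. z \<in> Z \<Longrightarrow> \<phi> z \<in> S z"
proof -
  let ?P = "\<lambda>z F. \<exists>a. F = {a} \<and> a \<in> S z"
  obtain Bl where Bl: "\<And>z. z \<in> Z \<Longrightarrow> ?P z (Bl z)" "disjoint_family_on Bl Z"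
  proof (rule disjoint_choice[OF assms(1), of ?P])
    fix z and V :: "'b set" assume "z \<in> Z" "finite V"
    then have "S z - V \<noteq> {}"
      using assms(2)[of z] Diff_infinite_finite[of V "S z"] by (metis finite.emptyI)
    then obtain a where "a \<in> S z" "a \<notin> V"
      by blast
    then show "\<exists>F. finite F \<and> F \<inter> V = {} \<and> ?P z F"
      by (intro exI[of _ "{a}"]) auto
  qed blast
  have "\<forall>z\<in>Z. \<exists>a. Bl z = {a} \<and> a \<in> S z"
    using Bl(1) by blast
  from bchoice[OF this] obtain \<phi> where \<phi>: "\<forall>z\<in>Z. Bl z = {\<phi> z} \<and> \<phi> z \<in> S z"
    by (rule exE)
  show thesis
  proof (rule that[of \<phi>])
    show "inj_on \<phi> Z"
    proof (rule inj_onI, rule ccontr)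
      fix x y assume xy: "x \<in> Z" "y \<in> Z" "\<phi> x = \<phi> y" "x \<noteq> y"
      then have "Bl x \<inter> Bl y = {}"
        using Bl(2) by (auto simp: disjoint_family_on_def)
      with \<phi> xy show False by simp
    qed
  qed (use \<phi> in blast)
qed

lemma Bp_weight_powr:
  assumes "2 < p"
  shows "(real (Suc n) powr (- (1 / rexp p))) powr rexp p = 1 / real (Suc n)"
proof -
  have "- (1 / rexp p) * rexp p = - 1"
    using rexp_pos[OF assms] by simp
  then show ?thesis
    by (simp only: powr_powr) simp
qed

lemma Bp_rich:
  assumes p: "2 < p" and "1 / real (Suc n) \<le> s"
  shows "rich p (UNIV :: (nat \<times> nat) set) fst (\<lambda>z. real (Suc (fst z)) powr (- (1 / rexp p))) n s"
  by (rule rich_bounded_below[OF infinite_slice, where \<epsilon> = "1 / real (Suc n)"])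
     (use assms in \<open>auto simp: Bp_weight_powr[OF p] simp del: of_nat_Suc\<close>)

text \<open>
  The case in which every cell has its weights bounded away from zero: \<open>\<sigma>\<close> is a lower bound for \<open>w\<^sup>r\<close> on
  each cell, attained up to a factor 2 infinitely often in the cells of \<open>E\<close>.  If the bounds \<open>\<sigma>\<close> stay
  away from zero, all weights can be replaced by \<open>1\<close>; otherwise the cells have arbitrarily small
  essential levels, exactly as in \<open>B\<^sub>p\<close>.
\<close>

lemma bounded_below_cells_case:
  assumes p: "2 < p" and J: "countable J" and w: "\<And>j. j \<in> J \<Longrightarrow> 0 < w j \<and> w j \<le> 1"
    and low: "\<And>j. j \<in> J \<Longrightarrow> 0 < \<sigma> (c j) \<and> \<sigma> (c j) \<le> w j powr rexp p"
    and E: "E \<subseteq> c ` J" "infinite E" and rest: "\<And>i. i \<in> c ` J - E \<Longrightarrow> 1 \<le> \<sigma> i"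
    and rich: "\<And>i. i \<in> E \<Longrightarrow> rich p J c w i (2 * \<sigma> i)"
  shows "cell_space p J c w \<cong>\<^sub>B Bp_cell p \<or> cell_space p J c w \<cong>\<^sub>B sum_l2_cell p"
proof (cases "\<exists>\<delta>>0. \<forall>i\<in>E. \<delta> \<le> \<sigma> i")
  case True
  have p0: "0 < p" "1 \<le> p" using p by auto
  have r: "0 < rexp p" by (rule rexp_pos[OF p])
  obtain \<delta>' where \<delta>': "0 < \<delta>'" "\<And>i. i \<in> E \<Longrightarrow> \<delta>' \<le> \<sigma> i"
    using True by blast
  define \<delta> where "\<delta> = min 1 \<delta>'"
  define a where "a = \<delta> powr (1 / rexp p)"
  have a: "0 < a"
    using \<delta>' by (simp add: a_def \<delta>_def)
  have aw: "a \<le> w j" if j: "j \<in> J" for j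
  proof -
    have "\<delta> \<le> \<sigma> (c j)"
    proof (cases "c j \<in> E")
      case True
      then show ?thesis
        using \<delta>'(2) by (auto simp: \<delta>_def intro: order_trans[OF min.cobounded2])
    next
      case False
      then have "1 \<le> \<sigma> (c j)"
        using j by (intro rest) auto
      then show ?thesis
        by (simp add: \<delta>_def)
    qed
    then have "\<delta> \<le> w j powr rexp p"
      using low[OF j] by linarith
    then have "a \<le> (w j powr rexp p) powr (1 / rexp p)"
      using r \<delta>'(1) unfolding a_def by (intro powr_mono2) (auto simp: \<delta>_def)
    then show ?thesis
      using r w[OF j] by (simp add: powr_powr)
  qed
  have 1: "cell_space p J c w \<cong>\<^sub>B cell_space p J c (\<lambda>_. 1)"
    by (rule bounded_below_weights_iso[OF p0(1) a]) (use aw w in blast)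
  have rich1: "rich p J c (\<lambda>_. 1) i 1" if "i \<in> E" for i
    by (rule rich_bounded_below[OF rich_infinite[OF rich[OF that]], where \<epsilon> = 1]) auto
  have rich2: "rich p (UNIV :: (nat \<times> nat) set) fst (\<lambda>_. 1) n 1" for n
    by (rule rich_bounded_below[OF infinite_slice, where \<epsilon> = 1]) auto
  obtain f :: "nat \<Rightarrow> 'b" where f: "inj f" "range f \<subseteq> E"
    using infinite_countable_subset[OF E(2)] by blast
  have "inj_on (to_nat_on (c ` J \<times> UNIV)) (c ` J \<times> (UNIV :: nat set))"
    using J by (intro inj_on_to_nat_on) auto
  moreover have "inj_on (\<lambda>z. f (prod_encode z)) (fst ` (UNIV :: (nat \<times> nat) set) \<times> UNIV)"
    by (auto intro!: inj_onI dest!: injD[OF f(1)] simp: prod_encode_eq)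
  moreover have "rich p J c (\<lambda>_. 1) (f k) 1" for k
    using f(2) by (intro rich1) auto
  ultimately have "cell_space p J c (\<lambda>_. 1) \<cong>\<^sub>B sum_l2_cell p"
    using rich2 by (intro mutual_rich_separate[OF p J]) auto
  with 1 have "cell_space p J c w \<cong>\<^sub>B sum_l2_cell p"
    by (rule lin_iso_trans) (rule normed_cell_space[OF p0(2)])
  then show ?thesis ..
next
  case False
  have small: "infinite {i \<in> E. 2 * \<sigma> i \<le> 1 / real (Suc n)}" for n
  proof
    assume fin: "finite {i \<in> E. 2 * \<sigma> i \<le> 1 / real (Suc n)}" (is "finite ?S")
    have pos: "0 < \<sigma> i" if "i \<in> E" for i
      using that E(1) low by auto
    define \<delta> where "\<delta> = Min (insert (1 / (2 * real (Suc n))) (\<sigma> ` ?S))"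
    have "0 < \<delta>"
      using fin pos by (auto simp: \<delta>_def)
    moreover have "\<delta> \<le> \<sigma> i" if "i \<in> E" for i
    proof (cases "i \<in> ?S")
      case True
      then show ?thesis
        using fin by (auto simp: \<delta>_def intro: Min_le)
    next
      case False
      have "\<delta> \<le> 1 / (2 * real (Suc n))"
        using fin by (auto simp: \<delta>_def intro: Min_le)
      also have "\<dots> \<le> \<sigma> i"
        using False that by (simp add: field_simps)
      finally show ?thesis .
    qed
    ultimately show False
      using False by blast
  qed
  let ?Z = "fst ` (UNIV :: (nat \<times> nat) set) \<times> (UNIV :: nat set)"
  obtain \<psi> where \<psi>: "inj_on \<psi> ?Z" "\<And>z. z \<in> ?Z \<Longrightarrow> \<psi> z \<in> {i \<in> E. 2 * \<sigma> i \<le> 1 / real (Suc (fst z))}"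
    by (rule inj_choice[of ?Z "\<lambda>z. {i \<in> E. 2 * \<sigma> i \<le> 1 / real (Suc (fst z))}"]) (use small in auto)
  have large: "infinite {n. 1 / real (Suc n) \<le> s}" if s: "0 < s" for s :: real
  proof -
    obtain m where m: "1 / real (Suc m) < s"
      using nat_approx_posE[OF s] by blast
    have "{m..} \<subseteq> {n. 1 / real (Suc n) \<le> s}"
    proof
      fix n assume "n \<in> {m..}"
      then have "1 / real (Suc n) \<le> 1 / real (Suc m)"
        by (intro divide_left_mono) auto
      with m show "n \<in> {n. 1 / real (Suc n) \<le> s}"
        by simp
    qed
    then show ?thesis
      using infinite_Ici[of m] finite_subset by blast
  qed
  have Z': "countable (c ` J \<times> (UNIV :: nat set))"
    using J by auto
  obtain \<phi> :: "'b \<times> nat \<Rightarrow> nat" where \<phi>: "inj_on \<phi> (c ` J \<times> UNIV)"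
    "\<And>z. z \<in> c ` J \<times> UNIV \<Longrightarrow> \<phi> z \<in> {n. 1 / real (Suc n) \<le> \<sigma> (fst z)}"
    by (rule inj_choice[OF Z', of "\<lambda>z. {n. 1 / real (Suc n) \<le> \<sigma> (fst z)}"]) (use large low in auto)
  have "cell_space p J c w \<cong>\<^sub>B Bp_cell p"
  proof (rule mutual_rich_separate[OF p J _ _ _ \<phi>(1) _ \<psi>(1)])
    fix j n assume j: "j \<in> J"
    have "1 / real (Suc (\<phi> (c j, n))) \<le> w j powr rexp p"
      using \<phi>(2)[of "(c j, n)"] low[OF j] j by auto
    then show "rich p (UNIV :: (nat \<times> nat) set) fst (\<lambda>z. real (Suc (fst z)) powr (- (1 / rexp p)))
        (\<phi> (c j, n)) (w j powr rexp p)"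
      by (rule Bp_rich[OF p])
  next
    fix j :: "nat \<times> nat" and n
    have "\<psi> (fst j, n) \<in> E" "2 * \<sigma> (\<psi> (fst j, n)) \<le> 1 / real (Suc (fst j))"
      using \<psi>(2)[of "(fst j, n)"] by auto
    then show "rich p J c w (\<psi> (fst j, n)) ((real (Suc (fst j)) powr (- (1 / rexp p))) powr rexp p)"
      unfolding Bp_weight_powr[OF p] by (intro rich_mono[OF rich]) auto
  qed (use w in auto)
  then show ?thesis ..
qed

text \<open>
  Every cell is of one of three kinds: rich at all levels, as in \<open>X\<^sub>p\<close>; rich at level \<open>2s\<close> but not at
  level \<open>s\<close>, for some \<open>s\<close>; or with \<open>\<Sum>w\<^sup>r < \<infinity>\<close>.
\<close>

lemma rich_threshold:
  assumes "rich p J c w i 1" "\<not> rich p J c w i t" "0 < t"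
  shows "\<exists>s>0. s \<le> 1 \<and> \<not> rich p J c w i s \<and> rich p J c w i (2 * s)"
proof -
  obtain n where n: "(1 / 2) ^ n < t"
    using real_arch_pow_inv[OF assms(3), of "1 / 2"] by auto
  have ex: "\<not> rich p J c w i ((1 / 2) ^ n)"
    using assms(2) n rich_mono[of p J c w i "(1 / 2) ^ n" t J] by auto
  define m where "m = (LEAST m. \<not> rich p J c w i ((1 / 2) ^ m))"
  have m: "\<not> rich p J c w i ((1 / 2) ^ m)"
    unfolding m_def by (rule LeastI[of _ n]) (rule ex)
  have "m \<noteq> 0"
    using m assms(1) by (intro notI) simp
  then obtain k where k: "m = Suc k"
    using not0_implies_Suc by blast
  have "rich p J c w i ((1 / 2) ^ k)"
    using not_less_Least[of k "\<lambda>m. \<not> rich p J c w i ((1 / 2) ^ m)"] k unfolding m_def by auto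
  moreover have "2 * (1 / 2 :: real) ^ m = (1 / 2) ^ k"
    by (simp add: k)
  moreover have "(1 / 2 :: real) ^ m \<le> 1"
    by (simp add: power_le_one)
  ultimately show ?thesis
    using m by (intro exI[of _ "(1 / 2) ^ m"]) auto
qed

lemma rich_Diff:
  assumes "rich p J c w i t" "(\<lambda>j. w j powr rexp p) summable_on {j. j \<in> Q \<and> c j = i}" "Q \<subseteq> J"
  shows "rich p (J - Q) c w i t"
  unfolding rich_def
proof
  let ?f = "\<lambda>j. w j powr rexp p"
  assume "?f summable_on {j. j \<in> J - Q \<and> c j = i \<and> ?f j \<le> t}"
  moreover have "?f summable_on {j. j \<in> Q \<and> c j = i \<and> ?f j \<le> t}"
    by (rule summable_on_subset_banach[OF assms(2)]) auto
  ultimately have "?f summable_on ({j. j \<in> J - Q \<and> c j = i \<and> ?f j \<le> t} \<union> {j. j \<in> Q \<and> c j = i \<and> ?f j \<le> t})"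
    by (rule summable_on_Un_disjoint) auto
  also have "{j. j \<in> J - Q \<and> c j = i \<and> ?f j \<le> t} \<union> {j. j \<in> Q \<and> c j = i \<and> ?f j \<le> t} =
      {j. j \<in> J \<and> c j = i \<and> ?f j \<le> t}"
    using assms(3) by auto
  finally show False
    using assms(1) by (simp add: rich_def)
qed

text \<open>
  The coordinates \<open>Q\<close> of the summable parts of all cells contribute \<open>\<ell>\<^sub>p\<close>, or a finite-dimensional
  space.  The rest consists of the cells \<open>D\<close> that are rich at all levels and the cells \<open>E\<close> with
  weights bounded below, and the isomorphism type depends on whether \<open>D\<close> and \<open>E\<close> are empty, finite or
  infinite.  An infinite \<open>D\<close> gives \<open>(\<Sum>X\<^sub>p)\<^sub>\<ell>\<^sub>p\<close>, which absorbs everything; a finite nonempty \<open>D\<close> gives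
  one summand \<open>X\<^sub>p\<close>, which absorbs \<open>Q\<close> and finitely many cells of \<open>E\<close>; an infinite \<open>E\<close> gives \<open>B\<^sub>p\<close> or
  \<open>(\<Sum>\<ell>\<^sub>2)\<^sub>\<ell>\<^sub>p\<close>, which absorb \<open>Q\<close>; a finite nonempty \<open>E\<close> gives \<open>\<ell>\<^sub>2\<close>.
\<close>

theorem cell_space_classification:
  fixes J :: "'a set" and c :: "'a \<Rightarrow> 'b"
  assumes p: "2 < p" and J: "countable J" "infinite J"
    and w: "\<And>j. j \<in> J \<Longrightarrow> 0 < w j \<and> w j \<le> 1" and v: "slow_weights p v"
  defines "X \<equiv> cell_space p J c w" and "I \<equiv> {i. infinite {j. j \<in> J \<and> c j = i}}"
  shows "X \<cong>\<^sub>B ell p (UNIV :: nat set) \<or> X \<cong>\<^sub>B Xp_cell p v \<or> X \<cong>\<^sub>B l2_cell p \<oplus>\<^sub>B ell p (UNIV :: nat set) \<or>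
    finite I \<and> X \<cong>\<^sub>B l2_cell p \<or>
    infinite I \<and> (X \<cong>\<^sub>B Bp_cell p \<or> X \<cong>\<^sub>B sum_l2_cell p \<or> X \<cong>\<^sub>B sum_l2_cell p \<oplus>\<^sub>B Xp_cell p v \<or>
      X \<cong>\<^sub>B Bp_cell p \<oplus>\<^sub>B Xp_cell p v \<or> X \<cong>\<^sub>B sum_Xp_cell p v)"
proof -
  have p0: "0 < p" "1 \<le> p" using p by auto
  have r: "0 < rexp p" by (rule rexp_pos[OF p])
  note n = normed_cell_space[OF p0(2)]
  let ?f = "\<lambda>j. w j powr rexp p"
  have f1: "?f j \<le> 1" if "j \<in> J" for j
    using w[OF that] r by (intro powr_le1) auto
  define D where "D = {i. \<forall>t>0. rich p J c w i t}"
  define E where "E = {i. i \<notin> D \<and> rich p J c w i 1}"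
  have "\<forall>i\<in>E. \<exists>s>0. s \<le> 1 \<and> \<not> rich p J c w i s \<and> rich p J c w i (2 * s)"
    using rich_threshold by (auto simp: E_def D_def)
  from bchoice[OF this[unfolded Bex_def]] obtain s where
    s: "\<forall>i\<in>E. 0 < s i \<and> s i \<le> 1 \<and> \<not> rich p J c w i (s i) \<and> rich p J c w i (2 * s i)"
    by (rule exE)
  define Q where "Q = {j \<in> J. c j \<notin> D \<and> (c j \<in> E \<longrightarrow> ?f j \<le> s (c j))}"
  have QJ: "Q \<subseteq> J" and DE: "D \<inter> E = {}"
    by (auto simp: Q_def E_def)
  have cQ: "c j \<in> D \<or> c j \<in> E" if "j \<in> J - Q" for j
    using that by (auto simp: Q_def)
  have sm: "?f summable_on {j. j \<in> Q \<and> c j = i}" for i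
  proof -
    consider "i \<in> D" | "i \<in> E" | "i \<notin> D" "i \<notin> E" by blast
    then show ?thesis
    proof cases
      case 1
      then have "{j. j \<in> Q \<and> c j = i} = {}"
        by (auto simp: Q_def)
      then show ?thesis by (simp only:) simp
    next
      case 2
      then have "?f summable_on {j. j \<in> J \<and> c j = i \<and> ?f j \<le> s i}"
        using s by (simp add: not_rich_iff[symmetric])
      then show ?thesis
        by (rule summable_on_subset_banach) (use 2 in \<open>auto simp: Q_def\<close>)
    next
      case 3
      then have "?f summable_on {j. j \<in> J \<and> c j = i \<and> ?f j \<le> 1}"
        by (simp add: E_def not_rich_iff[symmetric])
      then show ?thesis
        by (rule summable_on_subset_banach) (use f1 in \<open>auto simp: Q_def\<close>)
    qed
  qed
  have richD: "rich p (J - Q) c w i t" if "i \<in> D" "0 < t" for i t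
    using that by (intro rich_Diff sm QJ) (auto simp: D_def)
  have richE: "rich p (J - Q) c w i (2 * s i)" if "i \<in> E" for i
    using that s by (intro rich_Diff sm QJ) auto
  have DEI: "D \<union> E \<subseteq> I"
    using rich_infinite[of p J c w _ 1] by (auto simp: D_def E_def I_def)
  have IQ: "infinite Q" if "i \<in> I" "i \<notin> D \<union> E" for i
  proof -
    have "{j. j \<in> J \<and> c j = i} \<subseteq> Q"
      using that by (auto simp: Q_def)
    then show ?thesis
      using that(1) finite_subset by (auto simp: I_def)
  qed
  \<comment> \<open>The coordinates in \<open>Q\<close> become singleton cells of weight 1.\<close>
  define c' where "c' j = (if j \<in> Q then Inr j else Inl (c j))" for j
  define w' where "w' j = (if j \<in> Q then 1 else w j)" for j
  have split: "cell_space p (M \<union> R) c' w' \<cong>\<^sub>B cell_space p M c w \<oplus>\<^sub>B ell p R"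
    if "M \<subseteq> J - Q" "R \<subseteq> Q" for M R
  proof -
    have "cell_space p (M \<union> R) c' w' \<cong>\<^sub>B cell_space p M c' w' \<oplus>\<^sub>B cell_space p R c' w'"
      using that by (intro cell_space_split p0) auto
    moreover have "cell_space p M c' w' \<cong>\<^sub>B cell_space p M c w" "cell_space p R c' w' \<cong>\<^sub>B ell p R"
      using that by (intro cell_space_cong p0; auto simp: c'_def w'_def)+
    ultimately show ?thesis
      by (rule_tac lin_iso_trans[OF _ lin_iso_dsum_cong[OF _ _ n n n n] normed_dsum[OF n n]])
  qed
  have JQ: "J = (J - Q) \<union> Q" "(J - Q) \<inter> Q = {}"
    using QJ by auto
  have Qc: "countable Q"
    using countable_subset[OF QJ J(1)] .
  have Xsplit: "X \<cong>\<^sub>B cell_space p (J - Q) c w \<oplus>\<^sub>B ell p Q"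
  proof -
    have 1: "X \<cong>\<^sub>B cell_space p (J - Q) c w \<oplus>\<^sub>B cell_space p Q c w"
      unfolding X_def by (subst JQ(1)) (rule cell_space_split[OF p0(2) JQ(2)])
    have "cell_space p Q c w \<cong>\<^sub>B ell p Q"
      by (rule summable_cells_iso_ell[OF p Qc _ sm]) (use w QJ in auto)
    then have "cell_space p (J - Q) c w \<oplus>\<^sub>B cell_space p Q c w \<cong>\<^sub>B cell_space p (J - Q) c w \<oplus>\<^sub>B ell p Q"
      by (rule lin_iso_dsum_cong[OF lin_iso_refl _ n n n n])
    with 1 show ?thesis
      by (rule lin_iso_trans) (rule normed_dsum[OF n n])
  qed
  have X': "X \<cong>\<^sub>B cell_space p J c' w'"
  proof -
    have "cell_space p J c' w' \<cong>\<^sub>B cell_space p (J - Q) c w \<oplus>\<^sub>B ell p Q"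
      by (subst JQ(1)) (rule split, auto)
    from lin_iso_trans[OF Xsplit lin_iso_sym[OF this] normed_dsum[OF n n]] show ?thesis .
  qed
  have w': "0 < w' j \<and> w' j \<le> 1" if "j \<in> J" for j
    using w[OF that] by (simp add: w'_def)
  have rich': "rich p M c' w' (Inl i) t" if "rich p (J - Q) c w i t" "\<And>j. j \<in> J - Q \<Longrightarrow> c j = i \<Longrightarrow> j \<in> M" for M i t
  proof -
    have eq: "{j. j \<in> J - Q \<and> c j = i \<and> w j powr rexp p \<le> t} =
        {j. j \<in> J - Q \<and> c' j = Inl i \<and> w' j powr rexp p \<le> t}"
      by (auto simp: c'_def w'_def)
    have "w j powr rexp p = w' j powr rexp p" if "j \<in> J - Q" for j
      using that by (simp add: w'_def)
    then have "(\<lambda>j. w j powr rexp p) summable_on {j. j \<in> J - Q \<and> c' j = Inl i \<and> w' j powr rexp p \<le> t} \<longleftrightarrow>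
        (\<lambda>j. w' j powr rexp p) summable_on {j. j \<in> J - Q \<and> c' j = Inl i \<and> w' j powr rexp p \<le> t}"
      by (intro summable_on_cong) auto
    moreover have "\<not> (\<lambda>j. w j powr rexp p) summable_on {j. j \<in> J - Q \<and> c' j = Inl i \<and> w' j powr rexp p \<le> t}"
      using that(1) unfolding rich_def eq .
    ultimately have "rich p {j \<in> J - Q. c' j = Inl i} c' w' (Inl i) t"
      unfolding rich_def by (simp add: conj_assoc)
    then show ?thesis
      by (rule rich_mono) (use that(2) in \<open>auto simp: c'_def split: if_splits\<close>)
  qed
  have Xp: "cell_space p M c' w' \<cong>\<^sub>B Xp_cell p v"
    if M: "M \<subseteq> J" "Q \<subseteq> M" "finite (c ` (M - Q))" and i: "i \<in> D" "\<And>j. j \<in> J \<Longrightarrow> c j = i \<Longrightarrow> j \<in> M" for M i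
  proof (rule Xp_case[OF p countable_subset[OF M(1) J(1)] M(2) _ _ _ _ v])
    show "inj_on c' Q"
      by (auto simp: inj_on_def c'_def)
    show "0 < w' j \<and> w' j \<le> 1" if "j \<in> M" for j
      using w' that M(1) by auto
    have "c' ` (M - Q) \<subseteq> Inl ` c ` (M - Q)"
      by (auto simp: c'_def)
    then show "finite (c' ` (M - Q))"
      by (rule finite_subset) (use M(3) in auto)
    show "rich p (M - Q) c' w' (Inl i) t" if "0 < t" for t
      by (rule rich'[OF richD[OF i(1) that]]) (use i(2) in auto)
  qed
  have bb: "cell_space p M c' w' \<cong>\<^sub>B Bp_cell p \<or> cell_space p M c' w' \<cong>\<^sub>B sum_l2_cell p"
    if E': "infinite E" and M: "M \<subseteq> J" "\<And>j. j \<in> M \<Longrightarrow> j \<in> Q \<or> c j \<in> E" "\<And>j. j \<in> J - Q \<Longrightarrow> c j \<in> E \<Longrightarrow> j \<in> M" for M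
  proof (rule bounded_below_cells_case[OF p countable_subset[OF M(1) J(1)],
        where \<sigma> = "\<lambda>i. case i of Inl i \<Rightarrow> s i | Inr _ \<Rightarrow> 1" and E = "Inl ` E"])
    show "0 < w' j \<and> w' j \<le> 1" if "j \<in> M" for j
      using w' that M(1) by auto
    show "0 < (case c' j of Inl i \<Rightarrow> s i | Inr _ \<Rightarrow> 1) \<and> (case c' j of Inl i \<Rightarrow> s i | Inr _ \<Rightarrow> 1) \<le> w' j powr rexp p"
      if j: "j \<in> M" for j
    proof (cases "j \<in> Q")
      case False
      then have "c j \<in> E" "j \<in> J"
        using M(1,2) j by auto
      then have "s (c j) \<le> ?f j" "0 < s (c j)"
        using False s DE by (auto simp: Q_def)
      then show ?thesis
        using False by (simp add: c'_def w'_def)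
    qed (simp add: c'_def w'_def)
    show "Inl ` E \<subseteq> c' ` M"
    proof
      fix k :: "'b + 'a" assume "k \<in> Inl ` E"
      then obtain i where i: "k = Inl i" "i \<in> E" by blast
      then have "{j. j \<in> J - Q \<and> c j = i} \<noteq> {}"
        using rich_infinite[OF richE[of i]] by (metis finite.emptyI)
      then obtain j where "j \<in> J - Q" "c j = i" by blast
      then show "k \<in> c' ` M"
        using i M(3) by (intro image_eqI[of _ _ j]) (auto simp: c'_def)
    qed
    show "infinite (Inl ` E)"
      using E' by (simp add: finite_image_iff)
    show "1 \<le> (case k of Inl i \<Rightarrow> s i | Inr _ \<Rightarrow> 1)" if "k \<in> c' ` M - Inl ` E" for k
      using that M(2) by (auto simp: c'_def split: if_splits)
    show "rich p M c' w' k (2 * (case k of Inl i \<Rightarrow> s i | Inr _ \<Rightarrow> 1))" if "k \<in> Inl ` E" for k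
      using that M(3) by (auto intro!: rich' richE)
  qed
  consider "infinite D" | "D \<noteq> {}" "finite D" "finite E" | "D \<noteq> {}" "finite D" "infinite E"
    | "D = {}" "infinite E" | "D = {}" "finite E"
    by blast
  then show ?thesis
  proof cases
    case 1
    then obtain f :: "nat \<Rightarrow> 'b" where f: "inj f" "range f \<subseteq> D"
      using infinite_countable_subset by blast
    have 2: "inj_on (to_nat_on (c ` J \<times> UNIV)) (c ` J \<times> (UNIV :: nat set))"
      using J by (intro inj_on_to_nat_on) auto
    have 3: "inj_on (\<lambda>z. f (prod_encode z)) (fst ` (UNIV :: (nat \<times> nat) set) \<times> UNIV)"
      by (auto intro!: inj_onI dest!: injD[OF f(1)] simp: prod_encode_eq)
    have v0: "0 < v n" for n
      using v by (simp add: slow_weights_def)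
    have "X \<cong>\<^sub>B sum_Xp_cell p v"
      unfolding X_def
    proof (rule mutual_rich_separate[OF p J(1) _ _ _ 2 _ 3])
      fix j n assume "j \<in> J"
      then have "0 < ?f j"
        using w[of j] by simp
      then show "rich p (UNIV :: (nat \<times> nat) set) fst (\<lambda>z. v (snd z)) (to_nat_on (c ` J \<times> UNIV) (c j, n)) (?f j)"
        by (intro rich_slice slow_weights_rich[OF v _ p])
    next
      fix z :: "nat \<times> nat" and n
      have "f (prod_encode (fst z, n)) \<in> D"
        using f(2) by auto
      moreover have "0 < v (snd z) powr rexp p"
        using v0[of "snd z"] by simp
      ultimately show "rich p J c w (f (prod_encode (fst z, n))) (v (snd z) powr rexp p)"
        by (simp add: D_def)
    qed (use w v0 in auto)
    moreover have "infinite I"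
      using 1 DEI finite_subset by auto
    ultimately show ?thesis
      by blast
  next
    case 2
    then obtain i where i: "i \<in> D" by blast
    have "c ` (J - Q) \<subseteq> D \<union> E"
      using cQ by auto
    then have "finite (c ` (J - Q))"
      by (rule finite_subset) (use 2 in auto)
    then have "cell_space p J c' w' \<cong>\<^sub>B Xp_cell p v"
      by (intro Xp[OF _ QJ _ i]) auto
    with X' have "X \<cong>\<^sub>B Xp_cell p v"
      by (rule lin_iso_trans) (rule n)
    then show ?thesis
      by blast
  next
    case 3
    then obtain i where i: "i \<in> D" by blast
    let ?M = "{j \<in> J - Q. c j \<in> E}" and ?R = "{j \<in> J. c j \<in> D} \<union> Q"
    have M: "J = ?M \<union> ?R" "?M \<inter> ?R = {}"
      using cQ QJ DE by auto
    have s1: "cell_space p J c' w' \<cong>\<^sub>B cell_space p ?M c' w' \<oplus>\<^sub>B cell_space p ?R c' w'"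
      by (subst (1) M(1)) (rule cell_space_split[OF p0(2) M(2)])
    have R: "cell_space p ?R c' w' \<cong>\<^sub>B Xp_cell p v"
    proof (rule Xp[OF _ _ _ i])
      have "c ` (?R - Q) \<subseteq> D"
        by auto
      then show "finite (c ` (?R - Q))"
        by (rule finite_subset) (use 3 in auto)
    qed (use QJ i in auto)
    have two: "X \<cong>\<^sub>B Y \<oplus>\<^sub>B Xp_cell p v" if "cell_space p ?M c' w' \<cong>\<^sub>B Y" "normed Y"
      for Y :: "(nat \<times> nat \<Rightarrow> real) nspace"
      by (rule lin_iso_trans[OF X' lin_iso_trans[OF s1 lin_iso_dsum_cong[OF that(1) R n n that(2) n]
              normed_dsum[OF n n]] n])
    have "cell_space p ?M c' w' \<cong>\<^sub>B Bp_cell p \<or> cell_space p ?M c' w' \<cong>\<^sub>B sum_l2_cell p"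
      by (rule bb) (use 3 in auto)
    then have "X \<cong>\<^sub>B Bp_cell p \<oplus>\<^sub>B Xp_cell p v \<or> X \<cong>\<^sub>B sum_l2_cell p \<oplus>\<^sub>B Xp_cell p v"
      using two[OF _ n] by blast
    moreover have "infinite I"
      using 3 DEI finite_subset by auto
    ultimately show ?thesis
      by blast
  next
    case 4
    have "cell_space p J c' w' \<cong>\<^sub>B Bp_cell p \<or> cell_space p J c' w' \<cong>\<^sub>B sum_l2_cell p"
      by (rule bb) (use 4 cQ in auto)
    then have "X \<cong>\<^sub>B Bp_cell p \<or> X \<cong>\<^sub>B sum_l2_cell p"
      using lin_iso_trans[OF X' _ n] by blast
    moreover have "infinite I"
      using 4 DEI finite_subset by auto
    ultimately show ?thesis
      by blast
  next
    case 5
    show ?thesis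
    proof (cases "E = {}")
      case True
      then have "J = Q"
        using cQ 5 QJ by blast
      have "X \<cong>\<^sub>B ell p J"
        unfolding X_def by (rule summable_cells_iso_ell[OF p J(1) w]) (use sm \<open>J = Q\<close> in auto)
      then have "X \<cong>\<^sub>B ell p (UNIV :: nat set)"
        by (rule lin_iso_trans[OF _ ell_infinite_iso[OF p0(1) J] n])
      then show ?thesis
        by blast
    next
      case False
      \<comment> \<open>As \<open>E\<close> is finite, the lower bounds for the weights of its cells have a positive minimum.\<close>
      define a where "a = (Min (s ` E)) powr (1 / rexp p)"
      have Min0: "0 < Min (s ` E)" and Min1: "Min (s ` E) \<le> 1"
        using 5 False s by (auto simp: Min_le_iff)
      have a: "0 < a" "a \<le> 1"
        using Min0 Min1 r unfolding a_def by (auto intro!: powr_le1)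
      have aw: "a \<le> w j" if "j \<in> J - Q" for j
      proof -
        have "c j \<in> E" "j \<in> J"
          using cQ[OF that] that 5 by auto
        then have "s (c j) \<le> ?f j"
          using that 5 by (auto simp: Q_def)
        moreover have "Min (s ` E) \<le> s (c j)"
          using 5 \<open>c j \<in> E\<close> by (intro Min_le) auto
        ultimately have "a \<le> (?f j) powr (1 / rexp p)"
          using Min0 r unfolding a_def by (intro powr_mono2) auto
        then show ?thesis
          using r w[OF \<open>j \<in> J\<close>] by (simp add: powr_powr)
      qed
      have fin: "finite (c ` (J - Q))"
        by (rule finite_subset[of _ E]) (use cQ 5 in auto)
      show ?thesis
      proof (cases "finite Q")
        case True
        have "finite (c' ` J)"
        proof (rule finite_subset)
          show "c' ` J \<subseteq> Inr ` Q \<union> Inl ` c ` (J - Q)"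
            by (auto simp: c'_def)
        qed (use True fin in auto)
        then have "cell_space p J c' w' \<cong>\<^sub>B l2_cell p"
          by (rule l2_case[OF p J _ a(1)]) (use aw a w' in \<open>auto simp: w'_def\<close>)
        with X' have "X \<cong>\<^sub>B l2_cell p"
          by (rule lin_iso_trans) (rule n)
        moreover have "I \<subseteq> D \<union> E"
          using IQ True by blast
        then have "finite I"
          by (rule finite_subset) (use 5 in auto)
        ultimately show ?thesis
          by blast
      next
        case False
        have "infinite (J - Q)"
        proof -
          obtain i where "i \<in> E"
            using \<open>E \<noteq> {}\<close> by blast
          then show ?thesis
            using rich_infinite[OF richE] finite_subset[of "{j. j \<in> J - Q \<and> c j = i}" "J - Q"] by auto
        qed
        then have 1: "cell_space p (J - Q) c w \<cong>\<^sub>B l2_cell p"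
          by (intro l2_case[OF p _ _ fin a(1)]) (use J(1) aw w in auto)
        have "X \<cong>\<^sub>B l2_cell p \<oplus>\<^sub>B ell p (UNIV :: nat set)"
          by (rule lin_iso_trans[OF Xsplit lin_iso_dsum_cong[OF 1 ell_infinite_iso[OF p0(1) Qc False] n n n n]
                normed_dsum[OF n n]])
        then show ?thesis
          by blast
      qed
    qed
  qed
qed

section \<open>From bounded isomorphisms to homeomorphisms\<close>

text \<open>
  The metric of a space has to be symmetric and nonnegative on the whole ambient vector space,
  also where the norm is not meant to be evaluated.
\<close>

definition metric_nspace :: "'v::real_vector nspace \<Rightarrow> bool" where
  "metric_nspace X \<longleftrightarrow> normed X \<and> (\<forall>x. 0 \<le> nrm X x \<and> nrm X (- x) = nrm X x)"

lemma metric_nspace_Metric_space: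
  assumes "metric_nspace X"
  shows "Metric_space (vecs X) (\<lambda>x y. nrm X (x - y))"
proof -
  have n: "normed X" and sym: "\<And>x. nrm X (- x) = nrm X x" and nonneg: "\<And>x. 0 \<le> nrm X x"
    using assms by (auto simp: metric_nspace_def)
  show ?thesis
  proof
    show "nrm X (x - y) = nrm X (y - x)" for x y
      using sym[of "x - y"] by simp
    show "nrm X (x - y) = 0 \<longleftrightarrow> x = y" if "x \<in> vecs X" "y \<in> vecs X" for x y
      using normedD(7)[OF n normedD(3)[OF n that]] normedD(8)[OF n] by auto
    show "nrm X (x - z) \<le> nrm X (x - y) + nrm X (y - z)"
      if "x \<in> vecs X" "y \<in> vecs X" "z \<in> vecs X" for x y z
      using normedD(5)[OF n normedD(3)[OF n that(1,2)] normedD(3)[OF n that(2,3)]] by simp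
  qed (rule nonneg)
qed

lemma bounded_between_continuous:
  assumes X: "metric_nspace X" and Y: "metric_nspace Y" and T: "bounded_between X Y T"
  shows "continuous_map (ntopology X) (ntopology Y) T"
proof -
  interpret X: Metric_space "vecs X" "\<lambda>x y. nrm X (x - y)"
    by (rule metric_nspace_Metric_space[OF X])
  interpret Y: Metric_space "vecs Y" "\<lambda>x y. nrm Y (x - y)"
    by (rule metric_nspace_Metric_space[OF Y])
  have n: "normed X"
    using X by (simp add: metric_nspace_def)
  obtain C where C: "\<And>x. x \<in> vecs X \<Longrightarrow> nrm Y (T x) \<le> C * nrm X x"
    using bounded_between_bound[OF T n] by metis
  have "nrm Y (T x - T y) \<le> C * nrm X (x - y)" if "x \<in> vecs X" "y \<in> vecs X" for x y
    using C[OF normedD(3)[OF n that]] bounded_between_diff_arg[OF T n that] by simp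
  then have "Lipschitz_continuous_map X.Self Y.Self T"
    unfolding Lipschitz_continuous_map_def using bounded_betweenD(1)[OF T] by auto
  then have "continuous_map (mtopology_of X.Self) (mtopology_of Y.Self) T"
    by (rule Lipschitz_continuous_imp_continuous_map)
  then show ?thesis
    by (simp add: ntopology_def X.Self_def Y.Self_def)
qed

lemma lin_iso_imp_isomorphic:
  assumes X: "metric_nspace X" and Y: "metric_nspace Y" and "X \<cong>\<^sub>B Y"
  shows "X \<simeq>\<^sub>B Y"
proof -
  obtain T S where T: "bounded_between X Y T" and S: "bounded_between Y X S"
    and ST: "\<forall>x\<in>vecs X. S (T x) = x" and TS: "\<forall>y\<in>vecs Y. T (S y) = y"
    using assms(3) unfolding lin_iso_def by blast
  have top: "topspace (ntopology X) = vecs X" "topspace (ntopology Y) = vecs Y"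
    using Metric_space.topspace_mtopology[OF metric_nspace_Metric_space[OF X]]
      Metric_space.topspace_mtopology[OF metric_nspace_Metric_space[OF Y]] by (simp_all add: ntopology_def)
  have "homeomorphic_maps (ntopology X) (ntopology Y) T S"
    unfolding homeomorphic_maps_def top
    using bounded_between_continuous[OF X Y T] bounded_between_continuous[OF Y X S] ST TS by blast
  then have "homeomorphic_map (ntopology X) (ntopology Y) T"
    using homeomorphic_map_maps by blast
  moreover have "linear_between X Y T"
    using T by (simp add: bounded_between_def)
  ultimately show ?thesis
    unfolding isomorphic_def by blast
qed

section \<open>The concrete spaces\<close>

text \<open>Two descriptions of one space: the same vectors with the same norms.\<close>

definition same_norm :: "'v nspace \<Rightarrow> 'v nspace \<Rightarrow> bool" where
  "same_norm X Y \<longleftrightarrow> vecs X = vecs Y \<and> (\<forall>x\<in>vecs X. nrm X x = nrm Y x)"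

lemma same_norm_sym: "same_norm X Y \<Longrightarrow> same_norm Y X"
  by (auto simp: same_norm_def)

lemma same_norm_trans: "same_norm X Y \<Longrightarrow> same_norm Y Z \<Longrightarrow> same_norm X Z"
  by (auto simp: same_norm_def)

lemma same_norm_normed:
  assumes "same_norm X Y" "normed Y"
  shows "normed X"
  using assms unfolding same_norm_def normed_def by (simp cong: conj_cong)

lemma same_norm_lin_iso:
  assumes "same_norm X Y"
  shows "X \<cong>\<^sub>B Y"
proof (rule lin_isoI)
  show "bounded_between X Y (\<lambda>x. x)"
    by (rule bounded_betweenI[where C = 1]) (use assms in \<open>auto simp: same_norm_def\<close>)
  show "bounded_between Y X (\<lambda>x. x)"
    by (rule bounded_betweenI[where C = 1]) (use assms in \<open>auto simp: same_norm_def\<close>)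
qed auto

lemma same_norm_balls:
  assumes "\<And>x. 0 \<le> nrm X x" "\<And>x. 0 \<le> nrm Y x"
    and "\<And>x R. 0 \<le> R \<Longrightarrow> x \<in> vecs X \<and> nrm X x \<le> R \<longleftrightarrow> x \<in> vecs Y \<and> nrm Y x \<le> R"
  shows "same_norm X Y"
  unfolding same_norm_def
proof (intro conjI ballI)
  show "vecs X = vecs Y"
    using assms by blast
  show "nrm X x = nrm Y x" if "x \<in> vecs X" for x
    using assms(1)[of x] assms(2)[of x] assms(3)[of "nrm X x" x] assms(3)[of "nrm Y x" x] that
    by (intro antisym) auto
qed

lemma cell_space_ball:
  assumes "0 < p" "0 \<le> R"
  shows "x \<in> vecs (cell_space p J c w) \<and> nrm (cell_space p J c w) x \<le> R \<longleftrightarrow>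
    (\<forall>j. j \<notin> J \<longrightarrow> x j = 0) \<and> (\<forall>F\<in>Fpow J. psum p F x \<le> R powr p) \<and>
    (\<forall>F\<in>Fpow J. qsum p c w F x \<le> R powr p)"
proof
  assume *: "x \<in> vecs (cell_space p J c w) \<and> nrm (cell_space p J c w) x \<le> R"
  have "secn p c w F x \<le> R powr p" if "F \<in> Fpow J" for F
  proof -
    have "secn p c w F x \<le> nrm (cell_space p J c w) x powr p"
      using * assms(1) that by (intro cell_space_vecsD(2)) auto
    also have "\<dots> \<le> R powr p"
      using * assms by (intro powr_mono2) auto
    finally show ?thesis .
  qed
  then show "(\<forall>j. j \<notin> J \<longrightarrow> x j = 0) \<and> (\<forall>F\<in>Fpow J. psum p F x \<le> R powr p) \<and>
      (\<forall>F\<in>Fpow J. qsum p c w F x \<le> R powr p)"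
    using cell_space_off[of x p J c w] * by (auto simp: secn_def)
next
  assume "(\<forall>j. j \<notin> J \<longrightarrow> x j = 0) \<and> (\<forall>F\<in>Fpow J. psum p F x \<le> R powr p) \<and>
      (\<forall>F\<in>Fpow J. qsum p c w F x \<le> R powr p)"
  then show "x \<in> vecs (cell_space p J c w) \<and> nrm (cell_space p J c w) x \<le> R"
    using cell_space_bound[OF assms, of J x c w] by (auto simp: secn_def)
qed

lemma summable_infsum_le_iff:
  fixes f :: "'a \<Rightarrow> real"
  assumes "\<And>j. j \<in> A \<Longrightarrow> 0 \<le> f j"
  shows "f summable_on A \<and> infsum f A \<le> C \<longleftrightarrow> (\<forall>F\<in>Fpow A. sum f F \<le> C)"
proof
  assume *: "f summable_on A \<and> infsum f A \<le> C"
  show "\<forall>F\<in>Fpow A. sum f F \<le> C"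
  proof
    fix F assume F: "F \<in> Fpow A"
    have "sum f F \<le> infsum f A"
      using * F assms by (intro finite_sum_le_infsum) (auto simp: Fpow_def)
    then show "sum f F \<le> C"
      using * by simp
  qed
next
  assume *: "\<forall>F\<in>Fpow A. sum f F \<le> C"
  then have "f summable_on A"
    using assms by (intro nonneg_bdd_above_summable_on bdd_aboveI2[where M = C]) (auto simp: Fpow_def)
  then show "f summable_on A \<and> infsum f A \<le> C"
    using * by (auto intro!: infsum_le_finite_sums simp: Fpow_def)
qed

lemma powr_le_powr_iff:
  fixes a b t :: real
  assumes "0 < t" "0 \<le> a" "0 \<le> b"
  shows "a powr t \<le> b powr t \<longleftrightarrow> a \<le> b"
  using assms powr_less_mono2[of t b a] powr_mono2[of t a b] by (meson less_imp_le not_le)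

lemma powr_inverse_le_iff:
  fixes a b t :: real
  assumes "0 < t" "0 \<le> a" "0 \<le> b"
  shows "a powr (1 / t) \<le> b \<longleftrightarrow> a \<le> b powr t"
  using powr_le_powr_iff[of t "a powr (1 / t)" b] assms by (simp add: powr_powr)

text \<open>
  An iterated infinite sum of nonnegative terms over the cells of a partition, with a power applied to the
  inner sums, is controlled by the finite sets of indices.
\<close>

lemma two_level_sum_iff:
  fixes f :: "'a \<Rightarrow> real" and c :: "'a \<Rightarrow> 'b"
  assumes f: "\<And>j. j \<in> A \<Longrightarrow> 0 \<le> f j" and B: "c ` A \<subseteq> B" and t: "0 < t"
  defines "cell \<equiv> \<lambda>i. {j. j \<in> A \<and> c j = i}"
  shows "(\<forall>i\<in>B. f summable_on cell i) \<and> (\<lambda>i. infsum f (cell i) powr t) summable_on B \<and>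
      (\<Sum>\<^sub>\<infinity>i\<in>B. infsum f (cell i) powr t) \<le> C \<longleftrightarrow>
    (\<forall>F\<in>Fpow A. (\<Sum>i\<in>c ` F. (\<Sum>j | j \<in> F \<and> c j = i. f j) powr t) \<le> C)"
    (is "?L \<longleftrightarrow> ?R")
proof
  assume L: ?L
  show ?R
  proof
    fix F assume F: "F \<in> Fpow A"
    have "(\<Sum>i\<in>c ` F. (\<Sum>j | j \<in> F \<and> c j = i. f j) powr t) \<le> (\<Sum>i\<in>c ` F. infsum f (cell i) powr t)"
    proof (rule sum_mono)
      fix i assume "i \<in> c ` F"
      then have "f summable_on cell i"
        using L F B by (auto simp: Fpow_def)
      then have "(\<Sum>j | j \<in> F \<and> c j = i. f j) \<le> infsum f (cell i)"
        using F f by (intro finite_sum_le_infsum) (auto simp: cell_def Fpow_def)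
      then show "(\<Sum>j | j \<in> F \<and> c j = i. f j) powr t \<le> infsum f (cell i) powr t"
        using t F f by (intro powr_mono2) (auto simp: Fpow_def intro!: sum_nonneg)
    qed
    also have "\<dots> \<le> (\<Sum>\<^sub>\<infinity>i\<in>B. infsum f (cell i) powr t)"
      using L F B by (intro finite_sum_le_infsum) (auto simp: Fpow_def)
    finally show "(\<Sum>i\<in>c ` F. (\<Sum>j | j \<in> F \<and> c j = i. f j) powr t) \<le> C"
      using L by simp
  qed
next
  assume R: ?R
  have "{} \<in> Fpow A"
    by (simp add: Fpow_def)
  with R have C: "0 \<le> C"
    by fastforce
  have sm: "f summable_on cell i" for i
  proof -
    have "sum f F \<le> C powr (1 / t)" if F: "F \<in> Fpow (cell i)" for F
    proof (cases "F = {}")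
      case False
      have "c ` F = {i}" "{j. j \<in> F \<and> c j = i} = F"
        using F False by (auto simp: Fpow_def cell_def)
      moreover have "F \<in> Fpow A"
        using F by (auto simp: Fpow_def cell_def)
      ultimately have "sum f F powr t \<le> C"
        using R by fastforce
      then have "(sum f F powr t) powr (1 / t) \<le> C powr (1 / t)"
        using t by (intro powr_mono2) auto
      moreover have "0 \<le> sum f F"
        using F f by (intro sum_nonneg) (auto simp: Fpow_def cell_def)
      ultimately show ?thesis
        using t by (simp add: powr_powr)
    qed simp
    then show ?thesis
      using summable_infsum_le_iff[of "cell i" f "C powr (1 / t)"] f by (auto simp: cell_def)
  qed
  have nonneg: "0 \<le> infsum f (cell i)" for i
    using f by (intro infsum_nonneg) (auto simp: cell_def)
  have "(\<Sum>i\<in>I. infsum f (cell i) powr t) \<le> C" if I: "I \<in> Fpow B" for I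
  proof (rule tendsto_upperbound)
    let ?g = "\<lambda>F i. sum f (F \<inter> cell i)"
    have lim: "((\<lambda>F. ?g F i) \<longlongrightarrow> infsum f (cell i)) (finite_subsets_at_top A)" for i
    proof -
      have "filterlim (\<lambda>F. F \<inter> cell i) (finite_subsets_at_top (cell i)) (finite_subsets_at_top A)"
        unfolding filterlim_finite_subsets_at_top
      proof (intro allI impI)
        fix G assume G: "finite G \<and> G \<subseteq> cell i"
        then have "finite G \<and> G \<subseteq> A"
          by (auto simp: cell_def)
        then show "\<forall>\<^sub>F F in finite_subsets_at_top A. finite (F \<inter> cell i) \<and> G \<subseteq> F \<inter> cell i \<and> F \<inter> cell i \<subseteq> cell i"
          unfolding eventually_finite_subsets_at_top using G by (intro exI[of _ G]) auto
      qed
      from filterlim_compose[OF infsum_tendsto[OF sm] this] show ?thesis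
        by simp
    qed
    have pos: "\<forall>\<^sub>F F in finite_subsets_at_top A. 0 \<le> ?g F i" for i
      by (rule eventually_finite_subsets_at_top_weakI) (use f in \<open>auto intro!: sum_nonneg simp: cell_def\<close>)
    show "((\<lambda>F. \<Sum>i\<in>I. ?g F i powr t) \<longlongrightarrow> (\<Sum>i\<in>I. infsum f (cell i) powr t)) (finite_subsets_at_top A)"
      using t pos by (intro tendsto_sum tendsto_powr'[OF lim] tendsto_const) auto
    show "\<forall>\<^sub>F F in finite_subsets_at_top A. (\<Sum>i\<in>I. ?g F i powr t) \<le> C"
    proof (rule eventually_finite_subsets_at_top_weakI)
      fix F assume F: "finite F" "F \<subseteq> A"
      have g0: "?g F i = 0" if "i \<notin> c ` F" for i
        using that by (intro sum.neutral) (auto simp: cell_def)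
      have "(\<Sum>i\<in>I. ?g F i powr t) \<le> (\<Sum>i\<in>I \<union> c ` F. ?g F i powr t)"
        using I F by (intro sum_mono2) (auto simp: Fpow_def)
      also have "\<dots> = (\<Sum>i\<in>c ` F. ?g F i powr t)"
        using I F g0 by (intro sum.mono_neutral_right) (auto simp: Fpow_def)
      also have "\<dots> = (\<Sum>i\<in>c ` F. (\<Sum>j | j \<in> F \<and> c j = i. f j) powr t)"
      proof (rule sum.cong[OF refl])
        fix i
        have "F \<inter> cell i = {j. j \<in> F \<and> c j = i}"
          using F by (auto simp: cell_def)
        then show "?g F i powr t = (\<Sum>j | j \<in> F \<and> c j = i. f j) powr t"
          by simp
      qed
      also have "\<dots> \<le> C"
        using R F by (auto simp: Fpow_def)
      finally show "(\<Sum>i\<in>I. ?g F i powr t) \<le> C" .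
    qed
  qed simp
  then have "(\<lambda>i. infsum f (cell i) powr t) summable_on B \<and> (\<Sum>\<^sub>\<infinity>i\<in>B. infsum f (cell i) powr t) \<le> C"
    by (subst summable_infsum_le_iff) (rule powr_ge_zero, blast)
  then show ?L
    using sm by blast
qed

lemma qsum_alt: "qsum p c w F x = (\<Sum>i\<in>c ` F. (\<Sum>j | j \<in> F \<and> c j = i. (x j)\<^sup>2 * (w j)\<^sup>2) powr (p / 2))"
  by (simp add: qsum_def power_mult_distrib mult.commute)

lemma alspach_same_norm:
  assumes p: "0 < p" and N: "\<And>i. i \<in> B \<Longrightarrow> N i = {j. j \<in> A \<and> c j = i}" and B: "c ` A \<subseteq> B"
  shows "same_norm (alspach p A B N w) (cell_space p A c w)"
proof (rule same_norm_balls)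
  fix x and R :: real assume R: "0 \<le> R"
  let ?f = "\<lambda>j. (x j)\<^sup>2 * (w j)\<^sup>2" and ?cell = "\<lambda>i. {j. j \<in> A \<and> c j = i}"
  let ?P = "\<Sum>\<^sub>\<infinity>j\<in>A. \<bar>x j\<bar> powr p" and ?Q = "\<Sum>\<^sub>\<infinity>i\<in>B. infsum ?f (?cell i) powr (p / 2)"
  have NB1: "(\<forall>i\<in>B. ?f summable_on N i) \<longleftrightarrow> (\<forall>i\<in>B. ?f summable_on ?cell i)"
    by (intro ball_cong refl) (simp add: N)
  have NB2: "(\<lambda>i. infsum ?f (N i) powr (p / 2)) summable_on B \<longleftrightarrow> (\<lambda>i. infsum ?f (?cell i) powr (p / 2)) summable_on B"
    by (rule summable_on_cong) (simp add: N)
  have NB3: "(\<Sum>\<^sub>\<infinity>i\<in>B. infsum ?f (N i) powr (p / 2)) = ?Q"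
    by (rule infsum_cong) (simp add: N)
  note NB = NB1 NB2 NB3
  have P0: "0 \<le> ?P" "0 \<le> ?Q"
    by (auto intro!: infsum_nonneg)
  have "x \<in> vecs (alspach p A B N w) \<and> nrm (alspach p A B N w) x \<le> R \<longleftrightarrow>
      (\<forall>j. j \<notin> A \<longrightarrow> x j = 0) \<and> ((\<lambda>j. \<bar>x j\<bar> powr p) summable_on A \<and> ?P \<le> R powr p) \<and>
      ((\<forall>i\<in>B. ?f summable_on ?cell i) \<and> (\<lambda>i. infsum ?f (?cell i) powr (p / 2)) summable_on B \<and>
        ?Q \<le> R powr p)"
    using P0 R p by (auto simp: alspach_def NB powr_inverse_le_iff)
  also have "\<dots> \<longleftrightarrow> x \<in> vecs (cell_space p A c w) \<and> nrm (cell_space p A c w) x \<le> R"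
    unfolding cell_space_ball[OF p R] psum_def qsum_alt
    by (subst summable_infsum_le_iff, simp, subst two_level_sum_iff[OF _ B]) (use p in auto)
  finally show "x \<in> vecs (alspach p A B N w) \<and> nrm (alspach p A B N w) x \<le> R \<longleftrightarrow>
      x \<in> vecs (cell_space p A c w) \<and> nrm (cell_space p A c w) x \<le> R" .
qed (auto simp: alspach_def le_max_iff_disj)

lemma qsum_single_cell: "qsum p (\<lambda>_. ()) w F x = (\<Sum>j\<in>F. (w j)\<^sup>2 * (x j)\<^sup>2) powr (p / 2)"
proof (cases "F = {}")
  case False
  then have "(\<lambda>_. ()) ` F = {()}" by auto
  then show ?thesis
    unfolding qsum_def by (simp only:) (simp add: power_mult_distrib)
qed (simp add: qsum_def)

lemma square_powr_half: "0 \<le> (R::real) \<Longrightarrow> (R\<^sup>2) powr (p / 2) = R powr p"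
  using powr_powr[of R 2 "p / 2"] by simp

lemma Xpv_same_norm:
  assumes p: "0 < p"
  shows "same_norm (Xpv p v) (Xp_cell p v)"
proof (rule same_norm_balls)
  fix x and R :: real assume R: "0 \<le> R"
  let ?f = "\<lambda>n. (v n)\<^sup>2 * (x n)\<^sup>2"
  have P0: "0 \<le> (\<Sum>\<^sub>\<infinity>j. \<bar>x j\<bar> powr p)" "0 \<le> infsum ?f UNIV"
    by (auto intro!: infsum_nonneg)
  have Q: "(\<forall>F\<in>Fpow UNIV. qsum p (\<lambda>_. ()) v F x \<le> R powr p) \<longleftrightarrow> (\<forall>F\<in>Fpow UNIV. sum ?f F \<le> R\<^sup>2)"
    unfolding qsum_single_cell square_powr_half[OF R, symmetric]
    using p by (subst powr_le_powr_iff) (auto intro!: sum_nonneg)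
  have "sqrt (infsum ?f UNIV) \<le> R \<longleftrightarrow> infsum ?f UNIV \<le> R\<^sup>2"
    using real_sqrt_le_iff[of "infsum ?f UNIV" "R\<^sup>2"] R by simp
  then have "x \<in> vecs (Xpv p v) \<and> nrm (Xpv p v) x \<le> R \<longleftrightarrow>
      ((\<lambda>n. \<bar>x n\<bar> powr p) summable_on UNIV \<and> (\<Sum>\<^sub>\<infinity>n. \<bar>x n\<bar> powr p) \<le> R powr p) \<and>
      (?f summable_on UNIV \<and> infsum ?f UNIV \<le> R\<^sup>2)"
    using P0 R p by (auto simp: Xpv_def powr_inverse_le_iff)
  also have "\<dots> \<longleftrightarrow> x \<in> vecs (Xp_cell p v) \<and> nrm (Xp_cell p v) x \<le> R"
    unfolding cell_space_ball[OF p R] psum_def Q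
    by (subst (1 2) summable_infsum_le_iff) auto
  finally show "x \<in> vecs (Xpv p v) \<and> nrm (Xpv p v) x \<le> R \<longleftrightarrow>
      x \<in> vecs (Xp_cell p v) \<and> nrm (Xp_cell p v) x \<le> R" .
qed (auto simp: Xpv_def le_max_iff_disj)

lemma lp_ball:
  assumes p: "0 < p" and R: "0 \<le> R"
  shows "x \<in> vecs (lp p) \<and> nrm (lp p) x \<le> R \<longleftrightarrow> (\<forall>F\<in>Fpow UNIV. psum p F x \<le> R powr p)"
proof -
  have P0: "0 \<le> (\<Sum>\<^sub>\<infinity>j. \<bar>x j\<bar> powr p)"
    by (auto intro!: infsum_nonneg)
  have "x \<in> vecs (lp p) \<and> nrm (lp p) x \<le> R \<longleftrightarrow>
      (\<lambda>n. \<bar>x n\<bar> powr p) summable_on UNIV \<and> (\<Sum>\<^sub>\<infinity>n. \<bar>x n\<bar> powr p) \<le> R powr p"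
    using P0 R p by (auto simp: lp_def powr_inverse_le_iff)
  also have "\<dots> \<longleftrightarrow> (\<forall>F\<in>Fpow UNIV. psum p F x \<le> R powr p)"
    unfolding psum_def by (rule summable_infsum_le_iff) simp
  finally show ?thesis .
qed

lemma lp_same_norm:
  assumes p: "0 < p"
  shows "same_norm (lp p) (ell p UNIV)"
proof (rule same_norm_balls)
  have "qsum p (\<lambda>j. j) (\<lambda>_. 1) F x \<le> psum p F x" for F and x :: "nat \<Rightarrow> real"
    using secn_singletons[of p F x] by (simp add: secn_def)
  then show "x \<in> vecs (lp p) \<and> nrm (lp p) x \<le> R \<longleftrightarrow> x \<in> vecs (ell p UNIV) \<and> nrm (ell p UNIV) x \<le> R"
    if "0 \<le> R" for x :: "nat \<Rightarrow> real" and R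
    unfolding lp_ball[OF p that] cell_space_ball[OF p that] by (auto intro: order_trans)
qed (auto simp: lp_def)

lemma psum_le_square_sum:
  assumes "2 \<le> p" "finite F"
  shows "psum p F x \<le> (\<Sum>j\<in>F. (x j)\<^sup>2) powr (p / 2)"
proof -
  let ?s = "\<Sum>j\<in>F. (x j)\<^sup>2"
  have split: "a powr (p / 2) = a * a powr (p / 2 - 1)" if "0 \<le> a" for a :: real
    using powr_mult_base[OF that, of "p / 2 - 1"] by simp
  have s0: "0 \<le> ?s"
    by (intro sum_nonneg) auto
  have "psum p F x = (\<Sum>j\<in>F. (x j)\<^sup>2 * ((x j)\<^sup>2) powr (p / 2 - 1))"
    unfolding psum_def
  proof (rule sum.cong[OF refl])
    fix j
    show "\<bar>x j\<bar> powr p = (x j)\<^sup>2 * ((x j)\<^sup>2) powr (p / 2 - 1)"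
      using square_powr_half[of "\<bar>x j\<bar>" p] split[of "(x j)\<^sup>2"] by simp
  qed
  also have "\<dots> \<le> (\<Sum>j\<in>F. (x j)\<^sup>2 * ?s powr (p / 2 - 1))"
    using assms by (intro sum_mono mult_left_mono powr_mono2 member_le_sum) auto
  also have "\<dots> = ?s powr (p / 2)"
    unfolding split[OF s0] by (simp add: sum_distrib_right)
  finally show ?thesis .
qed

lemma l2_same_norm:
  assumes p: "2 < p"
  shows "same_norm (lp 2) (l2_cell p)"
proof (rule same_norm_balls)
  fix x :: "nat \<Rightarrow> real" and R :: real assume R: "0 \<le> R"
  have p0: "0 < p" using p by simp
  have sq: "psum 2 F x = (\<Sum>j\<in>F. (x j)\<^sup>2)" for F
    by (simp add: psum_def)
  have "qsum p (\<lambda>_. ()) (\<lambda>_. 1) F x \<le> R powr p \<longleftrightarrow> psum 2 F x \<le> R powr 2" for F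
    unfolding qsum_single_cell square_powr_half[OF R, symmetric, of p] sq
    using p R by (simp add: powr_le_powr_iff sum_nonneg)
  moreover have "psum p F x \<le> qsum p (\<lambda>_. ()) (\<lambda>_. 1) F x" if "F \<in> Fpow UNIV" for F
    unfolding qsum_single_cell using psum_le_square_sum[of p F x] p that by (simp add: Fpow_def)
  ultimately show "x \<in> vecs (lp 2) \<and> nrm (lp 2) x \<le> R \<longleftrightarrow> x \<in> vecs (l2_cell p) \<and> nrm (l2_cell p) x \<le> R"
    unfolding lp_ball[OF zero_less_numeral R] cell_space_ball[OF p0 R] by (fastforce intro: order_trans)
qed (auto simp: lp_def)

lemma same_norm_lp_sum:
  assumes "\<And>n. same_norm (Y n) (Z n)"
  shows "same_norm (lp_sum p Y) (lp_sum p Z)"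
proof -
  have v: "vecs (Y n) = vecs (Z n)" and nr: "x \<in> vecs (Z n) \<Longrightarrow> nrm (Y n) x = nrm (Z n) x" for n x
    using assms[of n] by (auto simp: same_norm_def)
  have "(\<lambda>n. nrm (Y n) (y n) powr p) = (\<lambda>n. nrm (Z n) (y n) powr p)" if "\<forall>n. y n \<in> vecs (Z n)" for y
    using that nr by auto
  then show ?thesis
    by (auto simp: same_norm_def lp_sum_def v)
qed

lemma lp_sum_ball:
  assumes "0 < p" "0 \<le> R"
  shows "y \<in> vecs (lp_sum p Y) \<and> nrm (lp_sum p Y) y \<le> R \<longleftrightarrow>
    (\<forall>n. y n \<in> vecs (Y n)) \<and> (\<forall>F\<in>Fpow UNIV. (\<Sum>n\<in>F. nrm (Y n) (y n) powr p) \<le> R powr p)"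
proof -
  have P0: "0 \<le> (\<Sum>\<^sub>\<infinity>n. nrm (Y n) (y n) powr p)"
    by (auto intro!: infsum_nonneg)
  have "y \<in> vecs (lp_sum p Y) \<and> nrm (lp_sum p Y) y \<le> R \<longleftrightarrow> (\<forall>n. y n \<in> vecs (Y n)) \<and>
      ((\<lambda>n. nrm (Y n) (y n) powr p) summable_on UNIV \<and> (\<Sum>\<^sub>\<infinity>n. nrm (Y n) (y n) powr p) \<le> R powr p)"
    using P0 assms by (auto simp: lp_sum_def powr_inverse_le_iff)
  also have "(\<lambda>n. nrm (Y n) (y n) powr p) summable_on UNIV \<and> (\<Sum>\<^sub>\<infinity>n. nrm (Y n) (y n) powr p) \<le> R powr p \<longleftrightarrow>
      (\<forall>F\<in>Fpow UNIV. (\<Sum>n\<in>F. nrm (Y n) (y n) powr p) \<le> R powr p)"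
    by (rule summable_infsum_le_iff) simp
  finally show ?thesis .
qed

lemma normed_lp_sum:
  assumes p: "1 \<le> p" and Y: "\<And>n. normed (Y n)"
  shows "normed (lp_sum p Y)"
  unfolding normed_def
proof (intro conjI ballI allI impI)
  let ?L = "lp_sum p Y"
  have p0: "0 < p" using p by simp
  have nn: "0 \<le> nrm ?L y" for y
    by (simp add: lp_sum_def)
  note ball = lp_sum_ball[OF p0, where Y = Y]
  have D: "\<And>n. y n \<in> vecs (Y n)" "\<And>F. F \<in> Fpow UNIV \<Longrightarrow> (\<Sum>n\<in>F. nrm (Y n) (y n) powr p) \<le> nrm ?L y powr p"
    if "y \<in> vecs ?L" for y
    using ball[OF nn, of y y] that by auto
  note I = ball[THEN iffD2]
  show "0 \<in> vecs ?L"
    using I[OF order_refl, of 0] by (simp add: normedD[OF Y])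
  fix y assume y: "y \<in> vecs ?L"
  {
    fix z assume z: "z \<in> vecs ?L"
    have "(\<Sum>n\<in>F. nrm (Y n) ((y + z) n) powr p) \<le> (nrm ?L y + nrm ?L z) powr p" if F: "F \<in> Fpow UNIV" for F
    proof -
      have fF: "finite F" using F by (simp add: Fpow_def)
      have r: "(\<Sum>n\<in>F. \<bar>nrm (Y n) (y n)\<bar> powr p) powr (1 / p) \<le> nrm ?L y" if "y \<in> vecs ?L" for y
      proof -
        have "(\<Sum>n\<in>F. \<bar>nrm (Y n) (y n)\<bar> powr p) = (\<Sum>n\<in>F. nrm (Y n) (y n) powr p)"
          using normedD(9)[OF Y D(1)[OF that]] by simp
        then show ?thesis
          using D(2)[OF that F] nn[of y] p0 by (subst powr_inverse_le_iff) (auto intro!: sum_nonneg)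
      qed
      have "(\<Sum>n\<in>F. nrm (Y n) ((y + z) n) powr p) \<le> (\<Sum>n\<in>F. \<bar>nrm (Y n) (y n) + nrm (Y n) (z n)\<bar> powr p)"
      proof (rule sum_mono)
        fix n
        have m: "y n \<in> vecs (Y n)" "z n \<in> vecs (Y n)"
          using D(1) y z by auto
        then have "nrm (Y n) ((y + z) n) \<le> \<bar>nrm (Y n) (y n) + nrm (Y n) (z n)\<bar>"
          using normedD(5)[OF Y m] by simp
        then show "nrm (Y n) ((y + z) n) powr p \<le> \<bar>nrm (Y n) (y n) + nrm (Y n) (z n)\<bar> powr p"
          using p0 normedD(9)[OF Y normedD(2)[OF Y m]] by (intro powr_mono2) auto
      qed
      moreover have "(\<Sum>n\<in>F. \<bar>nrm (Y n) (y n) + nrm (Y n) (z n)\<bar> powr p) powr (1 / p) \<le> nrm ?L y + nrm ?L z"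
        using Minkowski_sum[OF p fF, of "\<lambda>n. nrm (Y n) (y n)" "\<lambda>n. nrm (Y n) (z n)"] r[OF y] r[OF z] by linarith
      ultimately show ?thesis
        using p0 nn[of y] nn[of z] by (subst (asm) powr_inverse_le_iff) (auto intro!: sum_nonneg add_nonneg_nonneg)
    qed
    then have "y + z \<in> vecs ?L \<and> nrm ?L (y + z) \<le> nrm ?L y + nrm ?L z"
      using D(1)[OF y] D(1)[OF z] nn[of y] nn[of z] by (intro I) (auto simp: normedD[OF Y])
    then show "y + z \<in> vecs ?L" "nrm ?L (y + z) \<le> nrm ?L y + nrm ?L z"
      by auto
  }
  {
    fix a
    have *: "nrm (Y n) ((a *\<^sub>R y) n) powr p = \<bar>a\<bar> powr p * nrm (Y n) (y n) powr p" for n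
      using normedD(6)[OF Y D(1)[OF y]] by (simp add: scaleR_fun_def powr_mult)
    have "(a *\<^sub>R y) n \<in> vecs (Y n)" for n
      using normedD(4)[OF Y D(1)[OF y]] by (simp add: scaleR_fun_def)
    moreover have "(\<lambda>n. nrm (Y n) (y n) powr p) summable_on UNIV"
      using y by (simp add: lp_sum_def)
    ultimately show "a *\<^sub>R y \<in> vecs ?L" "nrm ?L (a *\<^sub>R y) = \<bar>a\<bar> * nrm ?L y"
      using p0 by (auto simp: lp_sum_def * infsum_cmult_right' powr_mult powr_powr intro: summable_on_cmult_right)
  }
  assume n0: "nrm ?L y = 0"
  show "y = 0"
  proof
    fix n
    have "nrm (Y n) (y n) powr p \<le> 0"
      using D(2)[OF y, of "{n}"] n0 by (simp add: Fpow_def)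
    then show "y n = 0 n"
      using normedD(7)[OF Y D(1)[OF y]] by simp
  qed
qed

text \<open>
  The isomorphism is currying.  The two norms differ in that one is the maximum of two sums over the
  cells and the other the sum of the maxima, which is at most twice as large before the root is taken.
\<close>

lemma lp_sum_lin_iso_cell_space:
  fixes u :: "nat \<Rightarrow> nat \<Rightarrow> real"
  assumes p: "1 \<le> p"
  shows "cell_space p UNIV fst (\<lambda>z. u (fst z) (snd z)) \<cong>\<^sub>B lp_sum p (\<lambda>n. Xpv p (u n))"
proof -
  let ?X = "cell_space p UNIV fst (\<lambda>z. u (fst z) (snd z))" and ?L = "lp_sum p (\<lambda>n. Xpv p (u n))"
  have p0: "0 < p" using p by simp
  have nX: "0 \<le> nrm (Xpv p v) x" for v x
    by (simp add: Xpv_def le_max_iff_disj)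
  have nL: "0 \<le> nrm ?L y" for y
    by (simp add: lp_sum_def)
  have Xball: "x \<in> vecs (Xpv p v) \<and> nrm (Xpv p v) x \<le> R \<longleftrightarrow>
      (\<forall>F\<in>Fpow UNIV. psum p F x \<le> R powr p) \<and> (\<forall>F\<in>Fpow UNIV. qsum p (\<lambda>_. ()) v F x \<le> R powr p)"
    if "0 \<le> R" for v x and R :: real
    using Xpv_same_norm[OF p0, of v] cell_space_ball[OF p0 that, of x UNIV "\<lambda>_. ()" v]
    by (auto simp: same_norm_def)
  have nrm_le: "nrm (Xpv p v) x powr p \<le>
      (\<Sum>\<^sub>\<infinity>j. \<bar>x j\<bar> powr p) powr 1 + (\<Sum>\<^sub>\<infinity>j. (v j)\<^sup>2 * (x j)\<^sup>2) powr (p / 2)" for v x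
  proof -
    let ?P = "\<Sum>\<^sub>\<infinity>j. \<bar>x j\<bar> powr p" and ?Q = "\<Sum>\<^sub>\<infinity>j. (v j)\<^sup>2 * (x j)\<^sup>2"
    have PQ: "0 \<le> ?P" "0 \<le> ?Q"
      by (auto intro!: infsum_nonneg)
    then have "(?P powr (1 / p)) powr p = ?P powr 1" "sqrt ?Q powr p = ?Q powr (p / 2)"
      using p0 by (simp_all add: powr_powr powr_half_sqrt[symmetric])
    then show ?thesis
      by (simp add: Xpv_def max_def)
  qed
  have slice: "{z :: nat \<times> nat. z \<in> UNIV \<and> fst z = n} = Pair n ` UNIV" for n
    by (auto simp: image_iff)
  have inj: "inj_on (Pair n) E" for n :: nat and E :: "nat set"
    by (auto simp: inj_on_def)
  have inf_slice: "infsum f {z :: nat \<times> nat. z \<in> UNIV \<and> fst z = n} = (\<Sum>\<^sub>\<infinity>j. f (n, j))"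
    for f :: "nat \<times> nat \<Rightarrow> real" and n
    unfolding slice infsum_reindex[OF inj] by (simp add: o_def)
  have T: "bounded_between ?X ?L (\<lambda>x n j. x (n, j))"
  proof -
    have "(\<lambda>n j. x (n, j)) \<in> vecs ?L \<and> nrm ?L (\<lambda>n j. x (n, j)) \<le> 2 powr (1 / p) * nrm ?X x"
      if x: "x \<in> vecs ?X" for x
    proof -
      define R where "R = nrm ?X x"
      have R0: "0 \<le> R" "0 \<le> 2 powr (1 / p) * R"
        by (simp_all add: R_def)
      have b: "psum p F x \<le> R powr p" "qsum p fst (\<lambda>z. u (fst z) (snd z)) F x \<le> R powr p"
        if "F \<in> Fpow UNIV" for F
        using cell_space_ball[OF p0 R0(1), of x UNIV fst "\<lambda>z. u (fst z) (snd z)"] x that by (auto simp: R_def)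
      have mem: "(\<lambda>j. x (n, j)) \<in> vecs (Xpv p (u n))" for n
      proof -
        have "psum p F (\<lambda>j. x (n, j)) \<le> R powr p \<and> qsum p (\<lambda>_. ()) (u n) F (\<lambda>j. x (n, j)) \<le> R powr p"
          if F: "F \<in> Fpow UNIV" for F
        proof -
          have F': "Pair n ` F \<in> Fpow UNIV"
            using F by (simp add: Fpow_def)
          have "psum p (Pair n ` F) x = psum p F (\<lambda>j. x (n, j))"
            unfolding psum_def by (simp add: sum.reindex[OF inj])
          moreover have "qsum p fst (\<lambda>z. u (fst z) (snd z)) (Pair n ` F) x = qsum p (\<lambda>_. ()) (u n) F (\<lambda>j. x (n, j))"
          proof (cases "F = {}")
            case False
            have "fst ` Pair n ` F = {n}" "{z. z \<in> Pair n ` F \<and> fst z = n} = Pair n ` F"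
              using False by (auto simp: image_image)
            then have "qsum p fst (\<lambda>z. u (fst z) (snd z)) (Pair n ` F) x =
                (\<Sum>j\<in>F. (u n j * x (n, j))\<^sup>2) powr (p / 2)"
              unfolding qsum_def by (simp add: sum.reindex[OF inj])
            then show ?thesis
              by (simp add: qsum_single_cell power_mult_distrib)
          qed (simp add: qsum_def)
          ultimately show ?thesis
            using b[OF F'] by simp
        qed
        then show ?thesis
          using Xball[OF R0(1), of "\<lambda>j. x (n, j)" "u n"] by blast
      qed
      have P: "(\<Sum>n\<in>I. (\<Sum>\<^sub>\<infinity>j. \<bar>x (n, j)\<bar> powr p) powr 1) \<le> R powr p" if I: "I \<in> Fpow UNIV" for I
      proof -
        have "\<forall>F\<in>Fpow UNIV. (\<Sum>i\<in>fst ` F. (\<Sum>z | z \<in> F \<and> fst z = i. \<bar>x z\<bar> powr p) powr 1) \<le> R powr p"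
        proof
          fix F :: "(nat \<times> nat) set" assume F: "F \<in> Fpow UNIV"
          then have "finite F" by (simp add: Fpow_def)
          have "(\<Sum>i\<in>fst ` F. (\<Sum>z | z \<in> F \<and> fst z = i. \<bar>x z\<bar> powr p) powr 1) =
              (\<Sum>i\<in>fst ` F. (\<Sum>z | z \<in> F \<and> fst z = i. \<bar>x z\<bar> powr p))"
            by (intro sum.cong refl powr_one sum_nonneg) simp
          also have "\<dots> = psum p F x"
            unfolding psum_def by (rule sum.image_gen[OF \<open>finite F\<close>, symmetric])
          finally show "(\<Sum>i\<in>fst ` F. (\<Sum>z | z \<in> F \<and> fst z = i. \<bar>x z\<bar> powr p) powr 1) \<le> R powr p"
            using b(1)[OF F] by simp
        qed
        then have "(\<lambda>i. (\<Sum>\<^sub>\<infinity>j. \<bar>x (i, j)\<bar> powr p) powr 1) summable_on UNIV \<and>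
            (\<Sum>\<^sub>\<infinity>i. (\<Sum>\<^sub>\<infinity>j. \<bar>x (i, j)\<bar> powr p) powr 1) \<le> R powr p"
          using two_level_sum_iff[of UNIV "\<lambda>z. \<bar>x z\<bar> powr p" fst UNIV 1 "R powr p"]
          unfolding inf_slice by auto
        then show ?thesis
          using summable_infsum_le_iff[of UNIV "\<lambda>i. (\<Sum>\<^sub>\<infinity>j. \<bar>x (i, j)\<bar> powr p) powr 1" "R powr p"] I by auto
      qed
      have Q: "(\<Sum>n\<in>I. (\<Sum>\<^sub>\<infinity>j. (u n j)\<^sup>2 * (x (n, j))\<^sup>2) powr (p / 2)) \<le> R powr p" if I: "I \<in> Fpow UNIV" for I
      proof -
        have "\<forall>F\<in>Fpow UNIV. (\<Sum>i\<in>fst ` F. (\<Sum>z | z \<in> F \<and> fst z = i. (u (fst z) (snd z))\<^sup>2 * (x z)\<^sup>2) powr (p / 2)) \<le> R powr p"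
          using b(2) by (simp add: qsum_def power_mult_distrib)
        then have "(\<lambda>i. (\<Sum>\<^sub>\<infinity>j. (u i j)\<^sup>2 * (x (i, j))\<^sup>2) powr (p / 2)) summable_on UNIV \<and>
            (\<Sum>\<^sub>\<infinity>i. (\<Sum>\<^sub>\<infinity>j. (u i j)\<^sup>2 * (x (i, j))\<^sup>2) powr (p / 2)) \<le> R powr p"
          using two_level_sum_iff[of UNIV "\<lambda>z. (u (fst z) (snd z))\<^sup>2 * (x z)\<^sup>2" fst UNIV "p / 2" "R powr p"] p0
          unfolding inf_slice by simp
        then show ?thesis
          using summable_infsum_le_iff[of UNIV "\<lambda>i. (\<Sum>\<^sub>\<infinity>j. (u i j)\<^sup>2 * (x (i, j))\<^sup>2) powr (p / 2)" "R powr p"] I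
          by auto
      qed
      have "(\<Sum>n\<in>I. nrm (Xpv p (u n)) (\<lambda>j. x (n, j)) powr p) \<le> (2 powr (1 / p) * R) powr p"
        if I: "I \<in> Fpow UNIV" for I
      proof -
        have "(\<Sum>n\<in>I. nrm (Xpv p (u n)) (\<lambda>j. x (n, j)) powr p) \<le>
            (\<Sum>n\<in>I. (\<Sum>\<^sub>\<infinity>j. \<bar>x (n, j)\<bar> powr p) powr 1 + (\<Sum>\<^sub>\<infinity>j. (u n j)\<^sup>2 * (x (n, j))\<^sup>2) powr (p / 2))"
          by (intro sum_mono nrm_le)
        also have "\<dots> \<le> 2 * R powr p"
          unfolding sum.distrib using P[OF I] Q[OF I] by linarith
        also have "\<dots> = (2 powr (1 / p) * R) powr p"
          using p0 by (simp add: powr_mult powr_powr)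
        finally show ?thesis .
      qed
      then show ?thesis
        using lp_sum_ball[OF p0 R0(2), of "\<lambda>n j. x (n, j)" "\<lambda>n. Xpv p (u n)"] mem by (auto simp: R_def)
    qed
    then show ?thesis
      by (intro bounded_betweenI[where C = "2 powr (1 / p)"]) (auto simp: fun_eq_iff scaleR_fun_def)
  qed
  have S: "bounded_between ?L ?X (\<lambda>y z. y (fst z) (snd z))"
  proof -
    have "(\<lambda>z. y (fst z) (snd z)) \<in> vecs ?X \<and> nrm ?X (\<lambda>z. y (fst z) (snd z)) \<le> nrm ?L y"
      if y: "y \<in> vecs ?L" for y
    proof -
      let ?z = "\<lambda>z. y (fst z) (snd z)"
      have D: "y n \<in> vecs (Xpv p (u n))" "I \<in> Fpow UNIV \<Longrightarrow> (\<Sum>n\<in>I. nrm (Xpv p (u n)) (y n) powr p) \<le> nrm ?L y powr p"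
        for n I
        using lp_sum_ball[OF p0 nL, of y "\<lambda>n. Xpv p (u n)" y] y by auto
      have X: "psum p G (y n) \<le> nrm (Xpv p (u n)) (y n) powr p"
        "qsum p (\<lambda>_. ()) (u n) G (y n) \<le> nrm (Xpv p (u n)) (y n) powr p" if "finite G" for n G
        using Xball[OF nX, of "y n" "u n" "u n" "y n"] D(1)[of n] that by (auto simp: Fpow_def)
      have "psum p F ?z \<le> nrm ?L y powr p \<and> qsum p fst (\<lambda>z. u (fst z) (snd z)) F ?z \<le> nrm ?L y powr p"
        if F: "F \<in> Fpow UNIV" for F
      proof -
        have fF: "finite F" using F by (simp add: Fpow_def)
        define G where "G n = snd ` {z. z \<in> F \<and> fst z = n}" for n
        have G: "finite (G n)" "{z. z \<in> F \<and> fst z = n} = Pair n ` G n" for n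
          using fF by (auto simp: G_def image_iff)
        have "psum p F ?z = (\<Sum>n\<in>fst ` F. \<Sum>z | z \<in> F \<and> fst z = n. \<bar>?z z\<bar> powr p)"
          unfolding psum_def by (rule sum.image_gen[OF fF])
        also have "\<dots> = (\<Sum>n\<in>fst ` F. psum p (G n) (y n))"
          unfolding G(2) psum_def by (simp add: sum.reindex[OF inj])
        also have "\<dots> \<le> (\<Sum>n\<in>fst ` F. nrm (Xpv p (u n)) (y n) powr p)"
          by (intro sum_mono X G)
        also have "\<dots> \<le> nrm ?L y powr p"
          using fF by (intro D(2)) (simp add: Fpow_def)
        finally have 1: "psum p F ?z \<le> nrm ?L y powr p" .
        have "qsum p fst (\<lambda>z. u (fst z) (snd z)) F ?z = (\<Sum>n\<in>fst ` F. qsum p (\<lambda>_. ()) (u n) (G n) (y n))"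
          unfolding qsum_def[of p fst] qsum_single_cell G(2)
          by (simp add: sum.reindex[OF inj] power_mult_distrib)
        also have "\<dots> \<le> (\<Sum>n\<in>fst ` F. nrm (Xpv p (u n)) (y n) powr p)"
          by (intro sum_mono X G)
        also have "\<dots> \<le> nrm ?L y powr p"
          using fF by (intro D(2)) (simp add: Fpow_def)
        finally show ?thesis
          using 1 by simp
      qed
      then show ?thesis
        using cell_space_ball[OF p0 nL, of ?z UNIV fst "\<lambda>z. u (fst z) (snd z)" y] by auto
    qed
    then show ?thesis
      by (intro bounded_betweenI[where C = 1]) (auto simp: fun_eq_iff scaleR_fun_def)
  qed
  show ?thesis
    by (rule lin_isoI[OF T S]) auto
qed

section \<open>The spaces of the theorem\<close>

lemma metric_nspaceI:
  assumes "same_norm X Y" "normed Y" "\<And>x. 0 \<le> nrm X x" "\<And>x. nrm X (- x) = nrm X x"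
  shows "metric_nspace X"
  using same_norm_normed[OF assms(1,2)] assms(3,4) by (simp add: metric_nspace_def)

lemma metric_nspace_alspach:
  assumes "1 \<le> p" "\<And>i. i \<in> B \<Longrightarrow> N i = {j. j \<in> A \<and> c j = i}" "c ` A \<subseteq> B"
  shows "metric_nspace (alspach p A B N w)"
  by (rule metric_nspaceI[OF alspach_same_norm[OF _ assms(2,3)] normed_cell_space[OF assms(1)]])
     (use assms(1) in \<open>auto simp: alspach_def le_max_iff_disj\<close>)

lemma metric_nspace_lp:
  assumes "1 \<le> p"
  shows "metric_nspace (lp p)"
  by (rule metric_nspaceI[OF lp_same_norm normed_cell_space[OF assms]])
     (use assms in \<open>auto simp: lp_def\<close>)

lemma metric_nspace_Xpv:
  assumes "1 \<le> p"
  shows "metric_nspace (Xpv p v)"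
  by (rule metric_nspaceI[OF Xpv_same_norm normed_cell_space[OF assms]])
     (use assms in \<open>auto simp: Xpv_def le_max_iff_disj\<close>)

lemma metric_nspace_lp_sum:
  assumes "1 \<le> p" "\<And>n. metric_nspace (Y n)"
  shows "metric_nspace (lp_sum p Y)"
  using assms normed_lp_sum[of p Y] by (simp add: metric_nspace_def) (simp add: lp_sum_def)

lemma metric_nspace_dsum: "metric_nspace X \<Longrightarrow> metric_nspace Y \<Longrightarrow> metric_nspace (X \<oplus>\<^sub>B Y)"
  by (auto simp: metric_nspace_def normed_dsum le_max_iff_disj)

lemma rexp_inverse: "2 < p \<Longrightarrow> (p - 2) / (2 * p) = 1 / rexp p"
  by (simp add: rexp_def)

lemma lin_iso_dsum_metric:
  assumes "Y1 \<cong>\<^sub>B Z1" "Y2 \<cong>\<^sub>B Z2" "normed Y1" "normed Y2" "metric_nspace Z1" "metric_nspace Z2"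
  shows "Y1 \<oplus>\<^sub>B Y2 \<cong>\<^sub>B Z1 \<oplus>\<^sub>B Z2"
  using assms by (intro lin_iso_dsum_cong) (auto simp: metric_nspace_def)

lemma isomorphic_chain:
  assumes "metric_nspace X" "X \<cong>\<^sub>B X'" "normed X'" "X' \<cong>\<^sub>B Y'" "Y' \<cong>\<^sub>B Y" "normed Y'" "metric_nspace Y"
  shows "X \<simeq>\<^sub>B Y"
  by (rule lin_iso_imp_isomorphic[OF assms(1,7)
        lin_iso_trans[OF assms(2) lin_iso_trans[OF assms(4,5,6)] assms(3)]])

theorem proposition2p2:
  fixes p :: real and A :: "'a set" and B :: "'b set" and N :: "'b \<Rightarrow> 'a set"
    and w :: "'a \<Rightarrow> real" and v :: "nat \<Rightarrow> real"
  assumes p: "2 < p"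
    and A: "countable A" "infinite A"
    and P: "regular_partition A (N ` B)" "inj_on N B"
    and w: "\<And>j. j \<in> A \<Longrightarrow> 0 < w j \<and> w j \<le> 1"
    and v: "slow_weights p v"
  defines "X \<equiv> alspach p A B N w"
    and "I \<equiv> {i \<in> B. infinite (N i)}"
    and "Xp \<equiv> Xpv p v"
  shows
    "(finite I \<longrightarrow> X \<simeq>\<^sub>B lp p \<or> X \<simeq>\<^sub>B Xp \<or> X \<simeq>\<^sub>B lp 2 \<or> X \<simeq>\<^sub>B lp 2 \<oplus>\<^sub>B lp p) \<and>
     (infinite I \<longrightarrow>
        X \<simeq>\<^sub>B lp p \<or> X \<simeq>\<^sub>B Xp \<or> X \<simeq>\<^sub>B lp 2 \<oplus>\<^sub>B lp p \<or> X \<simeq>\<^sub>B Bp p \<or>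
        X \<simeq>\<^sub>B lp_sum p (\<lambda>_. lp 2) \<or> X \<simeq>\<^sub>B lp_sum p (\<lambda>_. lp 2) \<oplus>\<^sub>B Xp \<or>
        X \<simeq>\<^sub>B Bp p \<oplus>\<^sub>B Xp \<or> X \<simeq>\<^sub>B lp_sum p (\<lambda>_. Xp))"
proof -
  have p0: "0 < p" "1 \<le> p" using p by auto
  note n = normed_cell_space[OF p0(2)]
  have "partition_on A (N ` B)"
    using P(1) by (simp add: regular_partition_def)
  then have part: "\<Union> (N ` B) = A" "disjoint (N ` B)"
    using partition_onD1 partition_onD2 by blast+
  have disj: "i = k" if "i \<in> B" "k \<in> B" "j \<in> N i" "j \<in> N k" for i k j
    using disjointD[OF part(2), of "N i" "N k"] inj_onD[OF P(2), of i k] that by blast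
  have "\<forall>j\<in>A. \<exists>i. i \<in> B \<and> j \<in> N i"
    using part(1) by blast
  from bchoice[OF this] obtain c where c: "\<forall>j\<in>A. c j \<in> B \<and> j \<in> N (c j)"
    by (rule exE)
  have cB: "c ` A \<subseteq> B"
    using c by blast
  have cN: "N i = {j. j \<in> A \<and> c j = i}" if "i \<in> B" for i
    using part(1) c disj that by blast
  have I: "I = {i. infinite {j. j \<in> A \<and> c j = i}}"
  proof (rule set_eqI)
    fix i
    show "i \<in> I \<longleftrightarrow> i \<in> {i. infinite {j. j \<in> A \<and> c j = i}}"
    proof (cases "i \<in> B")
      case False
      then have "{j. j \<in> A \<and> c j = i} = {}"
        using cB by blast
      then have "finite {j. j \<in> A \<and> c j = i}"
        by (simp only: finite.emptyI)
      then show ?thesis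
        using False by (simp add: I_def)
    qed (simp add: I_def cN)
  qed
  let ?X = "cell_space p A c w"
  have mX: "metric_nspace X"
    unfolding X_def by (rule metric_nspace_alspach[OF p0(2) cN cB])
  have X: "X \<cong>\<^sub>B ?X"
    unfolding X_def by (rule same_norm_lin_iso[OF alspach_same_norm[OF p0(1) cN cB]])
  note tr = isomorphic_chain[OF mX X n]
  have lp: "ell p (UNIV :: nat set) \<cong>\<^sub>B lp p" "metric_nspace (lp p)"
    using lin_iso_sym[OF same_norm_lin_iso[OF lp_same_norm[OF p0(1)]]] metric_nspace_lp[OF p0(2)] by auto
  have l2: "l2_cell p \<cong>\<^sub>B lp 2" "metric_nspace (lp 2)"
    using lin_iso_sym[OF same_norm_lin_iso[OF l2_same_norm[OF p]]] metric_nspace_lp[of 2] by auto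
  have Xp: "Xp_cell p v \<cong>\<^sub>B Xp" "metric_nspace Xp"
    unfolding Xp_def
    using lin_iso_sym[OF same_norm_lin_iso[OF Xpv_same_norm[OF p0(1)]]] metric_nspace_Xpv[OF p0(2)] by auto
  have Bp: "Bp_cell p \<cong>\<^sub>B Bp p" "metric_nspace (Bp p)"
    unfolding Bp_def rexp_inverse[OF p]
    using lp_sum_lin_iso_cell_space[OF p0(2), of "\<lambda>n _. real (Suc n) powr (- (1 / rexp p))"]
      metric_nspace_lp_sum[OF p0(2) metric_nspace_Xpv[OF p0(2)]] by auto
  have sXp: "sum_Xp_cell p v \<cong>\<^sub>B lp_sum p (\<lambda>_. Xp)" "metric_nspace (lp_sum p (\<lambda>_. Xp))"
    unfolding Xp_def
    using lp_sum_lin_iso_cell_space[OF p0(2), of "\<lambda>_. v"]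
      metric_nspace_lp_sum[OF p0(2) metric_nspace_Xpv[OF p0(2)]] by auto
  have sl2: "sum_l2_cell p \<cong>\<^sub>B lp_sum p (\<lambda>_. lp 2)" "metric_nspace (lp_sum p (\<lambda>_. lp 2))"
  proof -
    show "metric_nspace (lp_sum p (\<lambda>_. lp 2))"
      by (rule metric_nspace_lp_sum[OF p0(2) l2(2)])
    have "same_norm (Xpv p (\<lambda>_. 1)) (lp 2)"
      by (rule same_norm_trans[OF Xpv_same_norm[OF p0(1)] same_norm_sym[OF l2_same_norm[OF p]]])
    then have "lp_sum p (\<lambda>_. Xpv p (\<lambda>_. 1)) \<cong>\<^sub>B lp_sum p (\<lambda>_. lp 2)"
      by (intro same_norm_lin_iso same_norm_lp_sum)
    moreover have "normed (lp_sum p (\<lambda>_. Xpv p (\<lambda>_. 1)))"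
      using metric_nspace_Xpv[OF p0(2)] by (intro normed_lp_sum p0) (simp add: metric_nspace_def)
    ultimately show "sum_l2_cell p \<cong>\<^sub>B lp_sum p (\<lambda>_. lp 2)"
      by (rule lin_iso_trans[OF lp_sum_lin_iso_cell_space[OF p0(2), of "\<lambda>_ _. 1"]])
  qed
  note nn = normed_dsum[OF n n] and mm = metric_nspace_dsum
  have "?X \<cong>\<^sub>B ell p (UNIV :: nat set) \<Longrightarrow> X \<simeq>\<^sub>B lp p"
    by (rule tr[OF _ lp(1) n lp(2)])
  moreover have "?X \<cong>\<^sub>B Xp_cell p v \<Longrightarrow> X \<simeq>\<^sub>B Xp"
    by (rule tr[OF _ Xp(1) n Xp(2)])
  moreover have "?X \<cong>\<^sub>B l2_cell p \<Longrightarrow> X \<simeq>\<^sub>B lp 2"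
    by (rule tr[OF _ l2(1) n l2(2)])
  moreover have "?X \<cong>\<^sub>B l2_cell p \<oplus>\<^sub>B ell p (UNIV :: nat set) \<Longrightarrow> X \<simeq>\<^sub>B lp 2 \<oplus>\<^sub>B lp p"
    by (rule tr[OF _ lin_iso_dsum_metric[OF l2(1) lp(1) n n l2(2) lp(2)] nn mm[OF l2(2) lp(2)]])
  moreover have "?X \<cong>\<^sub>B Bp_cell p \<Longrightarrow> X \<simeq>\<^sub>B Bp p"
    by (rule tr[OF _ Bp(1) n Bp(2)])
  moreover have "?X \<cong>\<^sub>B sum_l2_cell p \<Longrightarrow> X \<simeq>\<^sub>B lp_sum p (\<lambda>_. lp 2)"
    by (rule tr[OF _ sl2(1) n sl2(2)])
  moreover have "?X \<cong>\<^sub>B sum_l2_cell p \<oplus>\<^sub>B Xp_cell p v \<Longrightarrow> X \<simeq>\<^sub>B lp_sum p (\<lambda>_. lp 2) \<oplus>\<^sub>B Xp"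
    by (rule tr[OF _ lin_iso_dsum_metric[OF sl2(1) Xp(1) n n sl2(2) Xp(2)] nn mm[OF sl2(2) Xp(2)]])
  moreover have "?X \<cong>\<^sub>B Bp_cell p \<oplus>\<^sub>B Xp_cell p v \<Longrightarrow> X \<simeq>\<^sub>B Bp p \<oplus>\<^sub>B Xp"
    by (rule tr[OF _ lin_iso_dsum_metric[OF Bp(1) Xp(1) n n Bp(2) Xp(2)] nn mm[OF Bp(2) Xp(2)]])
  moreover have "?X \<cong>\<^sub>B sum_Xp_cell p v \<Longrightarrow> X \<simeq>\<^sub>B lp_sum p (\<lambda>_. Xp)"
    by (rule tr[OF _ sXp(1) n sXp(2)])
  moreover note cell_space_classification[where c = c and w = w, OF p A w v, folded I]
  ultimately show ?thesis
    by blast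
qed

end
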